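(* Let $G$ be of type $B_n$, let $\mathbf{i}_0=(1\,2\cdots n)^n$, and let $c=(c^{(m)}_i)_{1\le i,m\le n}=(c^{(1)}_1,c^{(1)}_2,\dots,c^{(n)}_{n-1},c^{(n)}_n)\in(\mathbb{C}^\times)^{n^2}$. Put $c^{(m)}_0=1$. Then for $k=1,\dots,n-1$, $$\Delta_{w_0\Lambda_k,s_k\Lambda_k}(\Theta^-_{\mathbf{i}_0}(c))=\sum_{j=1}^{n-1}\frac{c^{(k)}_j}{c^{(k+1)}_{j-1}}+\frac{(c^{(k)}_n)^2}{c^{(k+1)}_{n-1}}+2\frac{c^{(k)}_n}{c^{(k+1)}_n}+\frac{c^{(k+1)}_{n-1}}{(c^{(k+1)}_n)^2}+\sum_{j=k+1}^{n-1}\frac{c^{(n+k-j+1)}_{j-1}}{c^{(n+k-j+1)}_j}$$ (the last sum being $\frac{c^{(k+2)}_{n-2}}{c^{(k+2)}_{n-1}}+\cdots+\frac{c^{(n)}_k}{c^{(n)}_{k+1}}$), and for $k=n$, $\Delta_{w_0\Lambda_n,s_n\Lambda_n}(\Theta^-_{\mathbf{i}_0}(c))=c^{(n)}_n$.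
   Context: $G$ is the simply connected simple algebraic group over $\mathbb{C}$ of type $B_n$ ($n\ge2$), $I=\{1,\dots,n\}$, with Chevalley generators $e_i,f_i,h_i$ of its Lie algebra, simple roots $\alpha_i$, fundamental weights $\Lambda_i$ ($\Lambda_i(h_j)=\delta_{ij}$), and Cartan matrix $a_{ij}=\alpha_j(h_i)$ given by $a_{ii}=2$, $a_{n,n-1}=-2$, $a_{ij}=-1$ for other $|i-j|=1$, and $0$ otherwise ($\alpha_n$ is the short root). $T$ is the maximal torus, $U^{\pm}$ the unipotent subgroups generated by $x_i(t)=\exp(te_i)$, resp. $y_i(t)=\exp(tf_i)$; $\alpha_i^\vee:\mathbb{C}^\times\to T$ is the coroot one-parameter subgroup. $W$ is the Weyl group, $s_i$ the simple reflections, $w_0$ the longest element. Set $\overline{s}_i=x_i(-1)y_i(1)x_i(-1)$ and $\overline{w}=\overline{s}_{i_1}\cdots\overline{s}_{i_l}$ for any reduced expression $w=s_{i_1}\cdots s_{i_l}$. Generalized minors: $\Delta_{\Lambda_i}$ is the regular function on $G$ with $\Delta_{\Lambda_i}(u^-tu^+)=\Lambda_i(t)$ for $u^\pm\in U^\pm$, $t\in T$; for $u,v\in W$, $\Delta_{u\Lambda_i,v\Lambda_i}(g)=\Delta_{\Lambda_i}(\overline{u}^{-1}g\,\overline{v})$. Set $\mathbf{y}_i(c)=y_i(c)\alpha_i^\vee(c^{-1})$. The word $\mathbf{i}_0=(12\cdots n)^n$ is a reduced word of $w_0$ and $$\Theta^-_{\mathbf{i}_0}(c)=\prod_{m=1}^{n}\mathbf{y}_1(c^{(m)}_1)\mathbf{y}_2(c^{(m)}_2)\cdots\mathbf{y}_n(c^{(m)}_n),$$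 the factors for $m=1,2,\dots,n$ being multiplied from left to right. *)

theory Defs
  imports "HOL-Analysis.Analysis"
begin

text \<open>
  The simply connected group of type \<open>B\<^sub>n\<close> is treated as a matrix group.  A realisation of it is
  given by complex matrices \<open>e i, f i, h i\<close> (\<open>1 \<le> i \<le> n\<close>) satisfying the Chevalley--Serre relations,
  so that they are Chevalley generators of the image of the simple Lie algebra in some
  representation, such that the weights of this representation span the full weight lattice.
  The subgroup of \<open>GL\<close> generated by all \<open>exp (t e i)\<close> and \<open>exp (t f i)\<close> is then a closed connected
  simple algebraic group of type \<open>B\<^sub>n\<close> whose character lattice is the full weight lattice, i.e. it is
  simply connected, and every matrix form of the group arises in this way.
  Indices of Chevalley generators are natural numbers in \<open>{1..n}\<close>; values elsewhere are irrelevant.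
\<close>

type_synonym 'd cmat = "complex^'d^'d"

subsection \<open>Chevalley generators\<close>

definition cartan_B :: "nat \<Rightarrow> nat \<Rightarrow> nat \<Rightarrow> int" where
  "cartan_B n i j =
     (if i = j then 2
      else if i = n \<and> Suc j = n then - 2
      else if i = Suc j \<or> j = Suc i then - 1
      else 0)"

definition cscale :: "complex \<Rightarrow> 'd::finite cmat \<Rightarrow> 'd cmat" where
  "cscale c A = map_matrix (\<lambda>z. c * z) A"

definition lie :: "'d::finite cmat \<Rightarrow> 'd cmat \<Rightarrow> 'd cmat" where
  "lie A B = A ** B - B ** A"

definition chevalley_gens_B ::
  "nat \<Rightarrow> (nat \<Rightarrow> 'd::finite cmat) \<Rightarrow> (nat \<Rightarrow> 'd cmat) \<Rightarrow> (nat \<Rightarrow> 'd cmat) \<Rightarrow> bool" where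
  "chevalley_gens_B n e f h \<longleftrightarrow>
     (\<forall>i\<in>{1..n}. \<forall>j\<in>{1..n}.
        lie (h i) (h j) = 0 \<and>
        lie (e i) (f j) = (if i = j then h i else 0) \<and>
        lie (h i) (e j) = cscale (of_int (cartan_B n i j)) (e j) \<and>
        lie (h i) (f j) = cscale (- of_int (cartan_B n i j)) (f j) \<and>
        (i \<noteq> j \<longrightarrow>
           (lie (e i) ^^ nat (1 - cartan_B n i j)) (e j) = 0 \<and>
           (lie (f i) ^^ nat (1 - cartan_B n i j)) (f j) = 0))"

text \<open>
  An integral weight \<open>\<lambda>\<close> is encoded by its values \<open>i \<mapsto> \<lambda>(h\<^sub>i)\<close>, i.e. by its coordinates with respect
  to the fundamental weights.  (All weights of a finite-dimensional representation are integral.)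
\<close>

definition fund_weight :: "nat \<Rightarrow> nat \<Rightarrow> int" where
  "fund_weight k = (\<lambda>i. if i = k then 1 else 0)"

definition is_weight :: "nat \<Rightarrow> (nat \<Rightarrow> 'd::finite cmat) \<Rightarrow> (nat \<Rightarrow> int) \<Rightarrow> bool" where
  "is_weight n h l \<longleftrightarrow>
     (\<exists>v::complex^'d. v \<noteq> 0 \<and> (\<forall>i\<in>{1..n}. h i *v v = of_int (l i) *s v))"

definition weights_span_full :: "nat \<Rightarrow> (nat \<Rightarrow> 'd::finite cmat) \<Rightarrow> bool" where
  "weights_span_full n h \<longleftrightarrow>
     (\<forall>k\<in>{1..n}. \<exists>S (m :: (nat \<Rightarrow> int) \<Rightarrow> int).
        finite S \<and> (\<forall>l\<in>S. is_weight n h l) \<and>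
        (\<forall>i\<in>{1..n}. fund_weight k i = (\<Sum>l\<in>S. m l * l i)))"

definition simply_connected_B ::
  "nat \<Rightarrow> (nat \<Rightarrow> 'd::finite cmat) \<Rightarrow> (nat \<Rightarrow> 'd cmat) \<Rightarrow> (nat \<Rightarrow> 'd cmat) \<Rightarrow> bool" where
  "simply_connected_B n e f h \<longleftrightarrow> chevalley_gens_B n e f h \<and> weights_span_full n h"

subsection \<open>The group and its subgroups\<close>

definition mexp :: "'d::finite cmat \<Rightarrow> 'd cmat" where
  "mexp A = (\<Sum>k. (1 / fact k) *\<^sub>R (((**) A) ^^ k) (mat 1))"

text \<open>\<open>one_param (e i) t\<close> and \<open>one_param (f i) t\<close> are \<open>x\<^sub>i(t)\<close> and \<open>y\<^sub>i(t)\<close>.\<close>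

definition one_param :: "'d::finite cmat \<Rightarrow> complex \<Rightarrow> 'd cmat" where
  "one_param A t = mexp (cscale t A)"

text \<open>
  \<open>coroot (h i) c\<close> is \<open>\<alpha>\<^sub>i\<^sup>\<or>(c)\<close> for \<open>c \<noteq> 0\<close>: since \<open>h i\<close> is diagonalisable with integer eigenvalues,
  \<open>exp (ln c \<cdot> h i)\<close> acts by \<open>c ^ m\<close> on the eigenspace for \<open>m\<close>, whichever branch of \<open>ln\<close> is taken.
\<close>

definition coroot :: "'d::finite cmat \<Rightarrow> complex \<Rightarrow> 'd cmat" where
  "coroot A c = mexp (cscale (ln c) A)"

definition mprod :: "'d::finite cmat list \<Rightarrow> 'd cmat" where
  "mprod As = foldr (**) As (mat 1)"

inductive_set subgroup_gen :: "'d::finite cmat set \<Rightarrow> 'd cmat set" for S where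
  one: "mat 1 \<in> subgroup_gen S"
| gen: "A \<in> S \<Longrightarrow> B \<in> subgroup_gen S \<Longrightarrow> A ** B \<in> subgroup_gen S"
| inv: "A \<in> S \<Longrightarrow> B \<in> subgroup_gen S \<Longrightarrow> matrix_inv A ** B \<in> subgroup_gen S"

text \<open>
  \<open>unip n e\<close> is \<open>U\<^sup>+\<close> and \<open>unip n f\<close> is \<open>U\<^sup>-\<close>.
\<close>

definition unip :: "nat \<Rightarrow> (nat \<Rightarrow> 'd::finite cmat) \<Rightarrow> 'd cmat set" where
  "unip n e = subgroup_gen {one_param (e i) t | i t. i \<in> {1..n}}"

definition group_B :: "nat \<Rightarrow> (nat \<Rightarrow> 'd::finite cmat) \<Rightarrow> (nat \<Rightarrow> 'd cmat) \<Rightarrow> 'd cmat set" where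
  "group_B n e f = subgroup_gen
     ({one_param (e i) t | i t. i \<in> {1..n}} \<union> {one_param (f i) t | i t. i \<in> {1..n}})"

text \<open>
  As the group is simply connected, its maximal torus consists of the elements
  \<open>torus_elem n h a = \<Prod>\<^sub>i \<alpha>\<^sub>i\<^sup>\<or>(a i)\<close> with all \<open>a i \<noteq> 0\<close>, and the value of the character \<open>\<lambda>\<close> at such an
  element is \<open>\<Prod>\<^sub>i (a i) ^ \<lambda>(h\<^sub>i)\<close>.
\<close>

definition torus_elem :: "nat \<Rightarrow> (nat \<Rightarrow> 'd::finite cmat) \<Rightarrow> (nat \<Rightarrow> complex) \<Rightarrow> 'd cmat" where
  "torus_elem n h a = mprod (map (\<lambda>i. coroot (h i) (a i)) [1..<Suc n])"

definition char_val :: "nat \<Rightarrow> (nat \<Rightarrow> int) \<Rightarrow> (nat \<Rightarrow> complex) \<Rightarrow> complex" where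
  "char_val n l a = (\<Prod>i\<in>{1..n}. a i powi l i)"

text \<open>
  Regular functions on the group are the restrictions of polynomials in the matrix entries.
  (The inverse of the determinant is not needed: all elements of the group have determinant 1.)
\<close>

inductive poly_map :: "('d::finite cmat \<Rightarrow> complex) \<Rightarrow> bool" where
  const: "poly_map (\<lambda>_. c)"
| entry: "poly_map (\<lambda>g. g $ r $ s)"
| add: "poly_map p \<Longrightarrow> poly_map q \<Longrightarrow> poly_map (\<lambda>g. p g + q g)"
| mult: "poly_map p \<Longrightarrow> poly_map q \<Longrightarrow> poly_map (\<lambda>g. p g * q g)"

definition regular_on :: "'d::finite cmat set \<Rightarrow> ('d cmat \<Rightarrow> complex) \<Rightarrow> bool" where
  "regular_on G D \<longleftrightarrow> (\<exists>p. poly_map p \<and> (\<forall>g\<in>G. D g = p g))"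

text \<open>
  \<open>is_principal_minor n e f h k D\<close>: on the group, \<open>D\<close> is the function \<open>\<Delta>\<close> for the weight \<open>\<Lambda>\<^sub>k\<close>.  Such a
  regular function exists, and it is unique since \<open>U\<^sup>- T U\<^sup>+\<close> is dense; the values of \<open>D\<close> outside
  the group are not constrained.
\<close>

definition is_principal_minor ::
  "nat \<Rightarrow> (nat \<Rightarrow> 'd::finite cmat) \<Rightarrow> (nat \<Rightarrow> 'd cmat) \<Rightarrow> (nat \<Rightarrow> 'd cmat) \<Rightarrow> nat
    \<Rightarrow> ('d cmat \<Rightarrow> complex) \<Rightarrow> bool" where
  "is_principal_minor n e f h k D \<longleftrightarrow>
     regular_on (group_B n e f) D \<and>
     (\<forall>u\<in>unip n f. \<forall>v\<in>unip n e. \<forall>a. (\<forall>i\<in>{1..n}. a i \<noteq> 0) \<longrightarrow>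
        D (u ** torus_elem n h a ** v) = char_val n (fund_weight k) a)"

subsection \<open>The Weyl group\<close>

text \<open>
  The Weyl group acts on weights (in coordinates as above) by \<open>s\<^sub>i \<lambda> = \<lambda> - \<lambda>(h\<^sub>i) \<alpha>\<^sub>i\<close>, and the simple
  root \<open>\<alpha>\<^sub>i\<close> has coordinates \<open>\<alpha>\<^sub>i(h\<^sub>j) = cartan_B n j i\<close>.  Coordinates outside \<open>{1..n}\<close> are left alone.
\<close>

definition simple_refl :: "nat \<Rightarrow> nat \<Rightarrow> (nat \<Rightarrow> int) \<Rightarrow> (nat \<Rightarrow> int)" where
  "simple_refl n i l = (\<lambda>j. if j \<in> {1..n} then l j - l i * cartan_B n j i else l j)"

definition weyl_word :: "nat \<Rightarrow> nat list \<Rightarrow> (nat \<Rightarrow> int) \<Rightarrow> (nat \<Rightarrow> int)" where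
  "weyl_word n is = foldr (\<lambda>i w. simple_refl n i \<circ> w) is id"

definition weyl_group :: "nat \<Rightarrow> ((nat \<Rightarrow> int) \<Rightarrow> (nat \<Rightarrow> int)) set" where
  "weyl_group n = {weyl_word n is | is. set is \<subseteq> {1..n}}"

definition weyl_length :: "nat \<Rightarrow> ((nat \<Rightarrow> int) \<Rightarrow> (nat \<Rightarrow> int)) \<Rightarrow> nat" where
  "weyl_length n w = (LEAST k. \<exists>is. set is \<subseteq> {1..n} \<and> length is = k \<and> weyl_word n is = w)"

definition reduced_word :: "nat \<Rightarrow> ((nat \<Rightarrow> int) \<Rightarrow> (nat \<Rightarrow> int)) \<Rightarrow> nat list \<Rightarrow> bool" where
  "reduced_word n w is \<longleftrightarrow>
     set is \<subseteq> {1..n} \<and> weyl_word n is = w \<and> length is = weyl_length n w"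

definition longest_elem :: "nat \<Rightarrow> (nat \<Rightarrow> int) \<Rightarrow> (nat \<Rightarrow> int)" where
  "longest_elem n =
     (THE w. w \<in> weyl_group n \<and> (\<forall>v\<in>weyl_group n. weyl_length n v \<le> weyl_length n w))"

definition sbar :: "(nat \<Rightarrow> 'd::finite cmat) \<Rightarrow> (nat \<Rightarrow> 'd cmat) \<Rightarrow> nat \<Rightarrow> 'd cmat" where
  "sbar e f i = one_param (e i) (- 1) ** one_param (f i) 1 ** one_param (e i) (- 1)"

text \<open>The product below does not depend on the reduced word chosen.\<close>

definition wbar ::
  "nat \<Rightarrow> (nat \<Rightarrow> 'd::finite cmat) \<Rightarrow> (nat \<Rightarrow> 'd cmat) \<Rightarrow> ((nat \<Rightarrow> int) \<Rightarrow> (nat \<Rightarrow> int)) \<Rightarrow> 'd cmat"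
  where "wbar n e f w = mprod (map (sbar e f) (SOME is. reduced_word n w is))"

subsection \<open>Generalised minors and the parametrisation\<close>

text \<open>
  \<open>gen_minor n e f D u v g\<close> is the minor indexed by \<open>u \<Lambda>, v \<Lambda>\<close> at \<open>g\<close> when \<open>D\<close> is the principal minor
  for the weight \<open>\<Lambda>\<close>.
\<close>

definition gen_minor ::
  "nat \<Rightarrow> (nat \<Rightarrow> 'd::finite cmat) \<Rightarrow> (nat \<Rightarrow> 'd cmat) \<Rightarrow> ('d cmat \<Rightarrow> complex)
    \<Rightarrow> ((nat \<Rightarrow> int) \<Rightarrow> (nat \<Rightarrow> int)) \<Rightarrow> ((nat \<Rightarrow> int) \<Rightarrow> (nat \<Rightarrow> int)) \<Rightarrow> 'd cmat \<Rightarrow> complex" where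
  "gen_minor n e f D u v g = D (matrix_inv (wbar n e f u) ** g ** wbar n e f v)"

definition bold_y ::
  "(nat \<Rightarrow> 'd::finite cmat) \<Rightarrow> (nat \<Rightarrow> 'd cmat) \<Rightarrow> nat \<Rightarrow> complex \<Rightarrow> 'd cmat" where
  "bold_y f h i c = one_param (f i) c ** coroot (h i) (inverse c)"

text \<open>\<open>c m i\<close> stands for \<open>c\<^sub>i\<^sup>(\<^sup>m\<^sup>)\<close>.\<close>

definition Theta_minus ::
  "nat \<Rightarrow> (nat \<Rightarrow> 'd::finite cmat) \<Rightarrow> (nat \<Rightarrow> 'd cmat) \<Rightarrow> (nat \<Rightarrow> nat \<Rightarrow> complex) \<Rightarrow> 'd cmat" where
  "Theta_minus n f h c =
     mprod (map (\<lambda>m. mprod (map (\<lambda>i. bold_y f h i (c m i)) [1..<Suc n])) [1..<Suc n])"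

end

theory Submission
  imports Defs
begin

text \<open>
  The elements \<open>bold_y f h i c = x\<^sub>i(1/c) sbar\<^sub>i x\<^sub>i(c)\<close> and a Bruhat-type induction along the reduced word
  give \<open>\<Theta> = u w\<^sub>0 b\<close> with \<open>u\<close>, \<open>b\<close> unipotent and upper triangular.  Conjugation by \<open>w\<^sub>0\<close> turns \<open>u\<close> into an
  element of \<open>U\<^sup>-\<close>, and \<open>b\<close> splits as \<open>x\<^sub>k(t) r\<close> with \<open>sbar\<^sub>k\<^sup>-\<^sup>1 r sbar\<^sub>k \<in> U\<^sup>+\<close>.  Since
  \<open>x\<^sub>k(t) sbar\<^sub>k = y\<^sub>k(1/t) \<alpha>\<^sub>k\<^sup>\<or>(t) x\<^sub>k(-1/t)\<close>, the minor is the coordinate \<open>t\<close> of \<open>b\<close> at \<open>\<alpha>\<^sub>k\<close>.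

  To read \<open>t\<close> off, all computations are carried out simultaneously in the given representation and in
  the vector representation of dimension \<open>2n+1\<close>.  There \<open>t\<close> is an entry of the last row of the product of
  the factors of \<open>\<Theta>\<close> with \<open>m \<ge> k\<close>, the factors with \<open>m < k\<close> having no influence on it; that row is
  computed directly.
\<close>

subsection \<open>Matrix exponentials\<close>

text \<open>Two obstacles shape the proof. The group is given by generators in an unknown
  representation, where no entry of a unipotent element is known; the coordinate t is visible only
  in the vector representation. Two separate decompositions would not show that the two values of t
  agree, so pairs of matrices are decomposed. Secondly, \<open>wbar\<close> picks an arbitrary
  reduced word, so the lift must be shown to be independent of it. This rests on one fact: if w maps
  a simple root to a simple root, its lift maps the root vector to the root vector with coefficient
  exactly 1. The grading by the coweight rho^vee forces a linear combination of the
  \<open>e i\<close>, and the vector representation supplies the coefficients. Commutator formulas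
  for root subgroups are never computed. Rank-one identities hold for nonzero parameters, and
  parameter 0 is reached as a limit. The price is that unipotent subgroups are replaced by their
  closures and that the minor is handled through the polynomial representing it, which is
  continuous; the same continuity settles the case t = 0.\<close>

lemma cscale_nth [simp]: "cscale c A $ r $ s = c * A $ r $ s"
  by (simp add: cscale_def)

lemma mmul_nth: "(A ** B) $ r $ s = (\<Sum>q\<in>UNIV. A $ r $ q * B $ q $ s)"
  by (simp add: matrix_matrix_mult_def)

lemma matrix_sub_ldistrib: "A ** (B - C) = A ** B - A ** (C :: 'd::finite cmat)"
  by (simp add: vec_eq_iff mmul_nth right_diff_distrib sum_subtractf)

lemma matrix_sub_rdistrib: "(A - B) ** C = A ** C - B ** (C :: 'd::finite cmat)"
  by (simp add: vec_eq_iff mmul_nth left_diff_distrib sum_subtractf)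

lemma matrix_add_rdistrib: "(A + B) ** C = A ** C + B ** (C :: 'd::finite cmat)"
  by (simp add: vec_eq_iff mmul_nth distrib_right sum.distrib)

lemma matrix_minus_left: "(- A) ** B = - (A ** (B :: 'd::finite cmat))"
  by (simp add: vec_eq_iff mmul_nth sum_negf)

lemma matrix_minus_right: "A ** (- B) = - (A ** (B :: 'd::finite cmat))"
  by (simp add: vec_eq_iff mmul_nth sum_negf)

lemma cscale_mul_left: "cscale c A ** B = cscale c (A ** B)"
  by (simp add: vec_eq_iff mmul_nth sum_distrib_left mult_ac)

lemma cscale_mul_right: "A ** cscale c B = cscale c (A ** B)"
  by (simp add: vec_eq_iff mmul_nth sum_distrib_left mult_ac)

lemma cscale_cscale: "cscale a (cscale b A) = cscale (a * b) A"
  by (simp add: vec_eq_iff)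

lemma cscale_add: "cscale a (A + B) = cscale a A + cscale a B"
  by (simp add: vec_eq_iff distrib_left)

lemma cscale_diff: "cscale a (A - B) = cscale a A - cscale a B"
  by (simp add: vec_eq_iff right_diff_distrib)

lemma cscale_minus: "cscale a (- A) = - cscale a A"
  by (simp add: vec_eq_iff)

lemma cscale_0 [simp]: "cscale 0 A = 0"
  by (simp add: vec_eq_iff)

lemma cscale_zero [simp]: "cscale a 0 = 0"
  by (simp add: vec_eq_iff)

lemma cscale_1 [simp]: "cscale 1 A = A"
  by (simp add: vec_eq_iff)

lemma cscale_neg: "cscale (- a) A = - cscale a A"
  by (simp add: vec_eq_iff)

lemma mmul_0_left [simp]: "0 ** A = (0 :: 'd::finite cmat)"
  by (simp add: vec_eq_iff mmul_nth)

lemma mmul_0_right [simp]: "A ** 0 = (0 :: 'd::finite cmat)"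
  by (simp add: vec_eq_iff mmul_nth)

lemmas mat_algebra = matrix_add_ldistrib matrix_add_rdistrib matrix_sub_ldistrib matrix_sub_rdistrib
  matrix_minus_left matrix_minus_right cscale_mul_left cscale_mul_right cscale_cscale cscale_add
  cscale_diff cscale_minus matrix_mul_assoc [symmetric]

abbreviation mpow :: "'d::finite cmat \<Rightarrow> nat \<Rightarrow> 'd cmat" where
  "mpow A k \<equiv> (((**) A) ^^ k) (mat 1)"

lemma mpow_Suc_right: "mpow A (Suc k) = mpow A k ** A"
proof (induction k)
  case (Suc k)
  have "mpow A (Suc (Suc k)) = A ** mpow A (Suc k)" by simp
  also have "\<dots> = A ** (mpow A k ** A)" by (simp only: Suc)
  also have "\<dots> = mpow A (Suc k) ** A" by (simp add: matrix_mul_assoc)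
  finally show ?case .
qed simp

lemma mpow_cscale: "mpow (cscale t A) k = cscale (t ^ k) (mpow A k)"
  by (induction k) (simp_all add: mat_algebra mult_ac)

lemma mpow_entry_bound:
  "norm (mpow A k $ r $ s) \<le> (\<Sum>p\<in>UNIV. \<Sum>q\<in>UNIV. norm (A $ p $ q)) ^ k" (is "_ \<le> ?K ^ k")
proof (induction k arbitrary: r)
  case 0
  then show ?case by (simp add: mat_def)
next
  case (Suc k)
  have K0: "0 \<le> ?K" by (intro sum_nonneg norm_ge_zero)
  have "norm (mpow A (Suc k) $ r $ s) \<le> (\<Sum>q\<in>UNIV. norm (A $ r $ q * mpow A k $ q $ s))"
    by (simp add: mmul_nth norm_sum)
  also have "\<dots> \<le> (\<Sum>q\<in>UNIV. norm (A $ r $ q) * ?K ^ k)"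
    by (intro sum_mono) (simp add: norm_mult mult_left_mono Suc)
  also have "\<dots> = (\<Sum>q\<in>UNIV. norm (A $ r $ q)) * ?K ^ k" by (simp add: sum_distrib_right)
  also have "\<dots> \<le> ?K * ?K ^ k"
    by (intro mult_right_mono zero_le_power K0
        member_le_sum [of r UNIV "\<lambda>p. \<Sum>q\<in>UNIV. norm (A $ p $ q)"]) (auto intro: sum_nonneg)
  finally show ?case by simp
qed

lemma summable_mpow_entry: "summable (\<lambda>k. mpow A k $ r $ s / fact k * t ^ k)"
proof (rule summable_comparison_test')
  let ?K = "\<Sum>p\<in>UNIV. \<Sum>q\<in>UNIV. norm (A $ p $ q)"
  show "summable (\<lambda>k. (?K * norm t) ^ k / fact k)"
    using summable_exp [of "?K * norm t"] by (simp add: field_simps)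
  fix k
  have "norm (mpow A k $ r $ s / fact k * t ^ k) = norm (mpow A k $ r $ s) * (norm t ^ k / fact k)"
    by (simp add: norm_mult norm_divide norm_power)
  also have "\<dots> \<le> ?K ^ k * (norm t ^ k / fact k)"
    by (intro mult_right_mono mpow_entry_bound) auto
  finally show "norm (mpow A k $ r $ s / fact k * t ^ k) \<le> (?K * norm t) ^ k / fact k"
    by (simp add: power_mult_distrib)
qed

lemma sums_vec:
  fixes f :: "nat \<Rightarrow> 'a::real_normed_vector ^ 'n"
  assumes "\<And>i. (\<lambda>k. f k $ i) sums (l $ i)"
  shows "f sums l"
  unfolding sums_def by (rule vec_tendstoI) (use assms in \<open>simp add: sums_def\<close>)

lemma one_param_sums_entry:
  "(\<lambda>k. (1 / fact k) *\<^sub>R mpow (cscale t A) k) sums (\<chi> r s. \<Sum>k. mpow A k $ r $ s / fact k * t ^ k)"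
  (is "_ sums ?L")
proof (intro sums_vec)
  fix r s
  have "(\<lambda>k. mpow A k $ r $ s / fact k * t ^ k) sums (?L $ r $ s)"
    using summable_sums [OF summable_mpow_entry, of A r s t] by simp
  then show "(\<lambda>k. ((1 / fact k) *\<^sub>R mpow (cscale t A) k) $ r $ s) sums (?L $ r $ s)"
    by (simp only: vector_scaleR_component mpow_cscale) (simp add: scaleR_conv_of_real mult_ac)
qed

lemma one_param_sums: "(\<lambda>k. (1 / fact k) *\<^sub>R mpow (cscale t A) k) sums one_param A t"
  unfolding one_param_def mexp_def using one_param_sums_entry by (rule sums_unique [THEN subst]) (rule one_param_sums_entry)

lemma one_param_nth: "one_param A t $ r $ s = (\<Sum>k. mpow A k $ r $ s / fact k * t ^ k)"
proof -
  have "one_param A t = (\<chi> r s. \<Sum>k. mpow A k $ r $ s / fact k * t ^ k)"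
    by (rule sums_unique2 [OF one_param_sums one_param_sums_entry])
  then show ?thesis by simp
qed

text \<open>Derivatives are taken entry by entry, so that identities between exponentials reduce to
  checking a linear differential equation.\<close>

definition has_mderiv :: "(complex \<Rightarrow> 'd::finite cmat) \<Rightarrow> 'd cmat \<Rightarrow> complex \<Rightarrow> bool" where
  "has_mderiv F F' t \<longleftrightarrow> (\<forall>r s. ((\<lambda>t. F t $ r $ s) has_field_derivative F' $ r $ s) (at t))"

lemma has_mderiv_const: "has_mderiv (\<lambda>_. A) 0 t"
  by (simp add: has_mderiv_def)

lemma has_mderiv_add: "has_mderiv F F' t \<Longrightarrow> has_mderiv G G' t \<Longrightarrow> has_mderiv (\<lambda>t. F t + G t) (F' + G') t"
  by (auto simp: has_mderiv_def intro!: derivative_eq_intros)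

lemma has_mderiv_mult:
  "has_mderiv F F' t \<Longrightarrow> has_mderiv G G' t \<Longrightarrow> has_mderiv (\<lambda>t. F t ** G t) (F' ** G t + F t ** G') t"
  by (auto simp: has_mderiv_def mmul_nth sum.distrib [symmetric] intro!: derivative_eq_intros sum.cong)

lemma has_mderiv_cscale:
  "(f has_field_derivative f') (at t) \<Longrightarrow> has_mderiv (\<lambda>t. cscale (f t) A) (cscale f' A) t"
  by (auto simp: has_mderiv_def intro!: derivative_eq_intros)

lemma has_mderiv_chain:
  "has_mderiv F F' (f t) \<Longrightarrow> (f has_field_derivative f') (at t) \<Longrightarrow>
   has_mderiv (\<lambda>t. F (f t)) (cscale f' F') t"
  unfolding has_mderiv_def
  by (simp add: mult.commute [of f']) (metis (no_types, lifting) DERIV_chain2 [of "\<lambda>t. F t $ _ $ _"])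

lemma has_mderiv_reflect: "has_mderiv F F' (- t) \<Longrightarrow> has_mderiv (\<lambda>t. F (- t)) (- F') t"
  using has_mderiv_chain [where F = F and f = uminus and t = t and f' = "-1"]
    DERIV_minus [OF DERIV_ident, of t UNIV]
  by (simp add: cscale_neg)

lemma has_mderiv_shift:
  assumes "has_mderiv F F' (s + t)" shows "has_mderiv (\<lambda>s. F (s + t)) F' s"
proof -
  have "((\<lambda>s. s + t) has_field_derivative 1) (at s)" by (auto intro!: derivative_eq_intros)
  then show ?thesis
    using assms has_mderiv_chain [where F = F and f = "\<lambda>s. s + t" and t = s and f' = 1] by simp
qed

lemma has_mderiv_zero_const:
  assumes "\<And>t. has_mderiv F 0 t" shows "F t = F 0"
proof -
  have "F t $ r $ s = F 0 $ r $ s" for r s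
    using has_field_derivative_zero_constant [of UNIV "\<lambda>t. F t $ r $ s"] assms
    by (auto simp: has_mderiv_def)
  then show ?thesis by (simp add: vec_eq_iff)
qed

lemma one_param_0 [simp]: "one_param A 0 = mat 1"
proof -
  have "(\<Sum>k. mpow A k $ r $ s / fact k * 0 ^ k) = mat 1 $ r $ s" for r s
    by (subst powser_zero) simp
  then show ?thesis by (simp add: vec_eq_iff one_param_nth)
qed

lemma diffs_fact: "diffs (\<lambda>k. c k / fact k) = (\<lambda>k. c (Suc k) / (fact k :: complex))"
  by (auto simp: diffs_def fun_eq_iff simp flip: of_nat_Suc)

lemma one_param_mderiv_left: "has_mderiv (one_param A) (A ** one_param A t) t"
  and one_param_mderiv_right: "has_mderiv (one_param A) (one_param A t ** A) t"
proof -
  have d: "((\<lambda>t. one_param A t $ r $ s) has_field_derivative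
       (\<Sum>k. mpow A (Suc k) $ r $ s / fact k * t ^ k)) (at t)" for r s
    unfolding one_param_nth
    using termdiffs_strong_converges_everywhere [OF summable_mpow_entry [of A r s], of t]
    unfolding diffs_fact .
  have s: "(\<lambda>k. mpow A k $ r $ s / fact k * t ^ k) sums one_param A t $ r $ s" for r s
    unfolding one_param_nth by (rule summable_sums [OF summable_mpow_entry])
  have "(\<lambda>k. mpow A (Suc k) $ r $ s / fact k * t ^ k) sums (A ** one_param A t) $ r $ s" for r s
  proof -
    have "(\<lambda>k. \<Sum>q\<in>UNIV. A $ r $ q * (mpow A k $ q $ s / fact k * t ^ k)) sums (A ** one_param A t) $ r $ s"
      unfolding mmul_nth by (intro sums_sum sums_mult s)
    moreover have "(\<Sum>q\<in>UNIV. A $ r $ q * (mpow A k $ q $ s / fact k * t ^ k))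
         = mpow A (Suc k) $ r $ s / fact k * t ^ k" for k
      by (simp add: mmul_nth sum_divide_distrib sum_distrib_right flip: mult.assoc)
    ultimately show ?thesis by simp
  qed
  then have "(A ** one_param A t) $ r $ s = (\<Sum>k. mpow A (Suc k) $ r $ s / fact k * t ^ k)" for r s
    by (rule sums_unique)
  then show "has_mderiv (one_param A) (A ** one_param A t) t"
    using d by (simp add: has_mderiv_def)
  have "(\<lambda>k. mpow A (Suc k) $ r $ s / fact k * t ^ k) sums (one_param A t ** A) $ r $ s" for r s
  proof -
    have "(\<lambda>k. \<Sum>q\<in>UNIV. (mpow A k $ r $ q / fact k * t ^ k) * A $ q $ s) sums (one_param A t ** A) $ r $ s"
      unfolding mmul_nth by (intro sums_sum sums_mult2 s)
    moreover have "(\<Sum>q\<in>UNIV. (mpow A k $ r $ q / fact k * t ^ k) * A $ q $ s)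
         = mpow A (Suc k) $ r $ s / fact k * t ^ k" for k
      unfolding mpow_Suc_right mmul_nth
      by (simp add: sum_divide_distrib sum_distrib_right) (intro sum.cong, auto)
    ultimately show ?thesis by simp
  qed
  then have "(one_param A t ** A) $ r $ s = (\<Sum>k. mpow A (Suc k) $ r $ s / fact k * t ^ k)" for r s
    by (rule sums_unique)
  then show "has_mderiv (one_param A) (one_param A t ** A) t"
    using d by (simp add: has_mderiv_def)
qed

lemma one_param_neg_mderiv: "has_mderiv (\<lambda>t. one_param A (- t)) (- (one_param A (- t) ** A)) t"
  by (rule has_mderiv_reflect [OF one_param_mderiv_right])

text \<open>Uniqueness for F' = A F: the product exp(-tA) F(t) has derivative zero. Applied to
  exp(tA) itself, the same argument shows that exp(-tA) is its inverse, which is what recovers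
  F.\<close>

lemma one_param_ode_left:
  assumes "\<And>t. has_mderiv F (A ** F t) t"
  shows "F t = one_param A t ** F 0"
proof -
  have const: "one_param A (- t) ** G t = G 0" if "\<And>t. has_mderiv G (A ** G t) t" for G t
  proof -
    have "has_mderiv (\<lambda>t. one_param A (- t) ** G t) 0 t" for t
      using has_mderiv_mult [OF one_param_neg_mderiv [of A t] that [of t]] by (simp add: mat_algebra)
    from has_mderiv_zero_const [OF this, of t] show ?thesis by simp
  qed
  have inv: "one_param A (- t) ** one_param A t = mat 1" for t
    using const [OF one_param_mderiv_left] by simp
  have "one_param A t ** (one_param A (- t) ** F t) = F t"
    using inv [of "- t"] by (simp add: matrix_mul_assoc)
  then show ?thesis using const [OF assms] by simp
qed

lemma one_param_intertwine:
  fixes A B C :: "'d::finite cmat"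
  assumes "A ** B = B ** C" shows "one_param A t ** B = B ** one_param C t"
proof -
  have "has_mderiv (\<lambda>t. B ** one_param C t) (A ** (B ** one_param C t)) t" for t
    using has_mderiv_mult [OF has_mderiv_const [of B] one_param_mderiv_left [of C t]] assms
    by (simp add: matrix_mul_assoc)
  from one_param_ode_left [OF this, of t] show ?thesis by simp
qed

lemma one_param_add: "one_param A (s + t) = one_param A s ** one_param A t"
proof -
  have "has_mderiv (\<lambda>s. one_param A (s + t)) (A ** one_param A (s + t)) s" for s
    by (rule has_mderiv_shift [OF one_param_mderiv_left])
  from one_param_ode_left [OF this, of s] show ?thesis by simp
qed

lemma one_param_uminus: "one_param (- A) t = one_param A (- t)"
proof -
  have "has_mderiv (\<lambda>t. one_param A (- t)) ((- A) ** one_param A (- t)) t" for t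
    using has_mderiv_reflect [OF one_param_mderiv_left, of A t] by (simp add: mat_algebra)
  from one_param_ode_left [OF this, of t] show ?thesis by simp
qed

lemma one_param_inverse [simp]:
  "one_param A t ** one_param A (- t) = mat 1" "one_param A (- t) ** one_param A t = mat 1"
  by (simp_all flip: one_param_add)

lemma one_param_inverse_assoc [simp]:
  "one_param A t ** (one_param A (- t) ** B) = B" "one_param A (- t) ** (one_param A t ** B) = B"
  by (simp_all add: matrix_mul_assoc)

lemma one_param_commute: "A ** B = B ** A \<Longrightarrow> one_param A t ** one_param B s = one_param B s ** one_param A t"
  by (metis one_param_intertwine)

lemma one_param_conj:
  fixes A B P :: "'d::finite cmat"
  assumes "P ** A = B ** P" shows "P ** one_param A t = one_param B t ** P"
  using one_param_intertwine [of B P A t] assms by simp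

lemma one_param_cscale: "one_param (cscale a A) t = one_param A (a * t)"
  by (simp add: one_param_def cscale_cscale mult.commute)

text \<open>Scalar shifts arise from moving an exponential past a weight vector, since h E = E (h +
  a) when [h, E] = a E.\<close>

lemma one_param_shift: "one_param (A + cscale c (mat 1)) t = cscale (exp (c * t)) (one_param A t)"
proof -
  have "has_mderiv (\<lambda>t. cscale (exp (c * t)) (mat 1) ** one_param A t)
     ((A + cscale c (mat 1)) ** (cscale (exp (c * t)) (mat 1) ** one_param A t)) t" for t
  proof -
    have "((\<lambda>t. exp (c * t)) has_field_derivative exp (c * t) * c) (at t)"
      by (auto intro!: derivative_eq_intros)
    from has_mderiv_mult [OF has_mderiv_cscale [OF this, of "mat 1"] one_param_mderiv_left [of A]]
    show ?thesis by (simp add: mat_algebra add.commute)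
  qed
  from one_param_ode_left [OF this, of t] show ?thesis by (simp add: mat_algebra)
qed

lemma continuous_one_param: "continuous_on UNIV (one_param A)"
proof -
  have "isCont (\<lambda>t. one_param A t $ r $ s) t" for r s t
    using one_param_mderiv_left [of A t] unfolding has_mderiv_def by (blast intro: DERIV_isCont)
  then have "continuous_on UNIV (\<lambda>t. \<chi> r s. one_param A t $ r $ s)"
    by (intro continuous_on_vec_lambda) (simp add: continuous_at_imp_continuous_on)
  then show ?thesis by (simp only: vec_nth_inverse vec_lambda_eta)
qed

subsection \<open>Rank one\<close>

text \<open>The second hypothesis reads G' = [E, G], so G(t) is Ad(exp(tE)) G(0). The adjoint
  actions below are obtained by writing down the polynomial curve G and checking this
  equation.\<close>

lemma one_param_conj_ode:
  assumes "\<And>t. has_mderiv G (G' t) t" and "\<And>t. G' t + G t ** E = E ** G t"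
  shows "one_param E t ** G 0 = G t ** one_param E t"
proof -
  have "has_mderiv (\<lambda>t. G t ** one_param E t) (E ** (G t ** one_param E t)) t" for t
    using has_mderiv_mult [OF assms(1) [of t] one_param_mderiv_left [of E t]] assms(2) [of t]
    by (simp add: matrix_mul_assoc flip: matrix_add_rdistrib)
  from one_param_ode_left [OF this, of t] show ?thesis by simp
qed

lemma one_param_cartan_e:
  fixes E H :: "'d::finite cmat"
  assumes "H ** E - E ** H = cscale a E"
  shows "one_param E t ** H = (H - cscale (a * t) E) ** one_param E t"
proof -
  have eq: "E ** H = H ** E - cscale a E" using assms by (simp add: algebra_simps)
  have "has_mderiv (\<lambda>t. H + cscale (- (a * t)) E) (cscale (- a) E) t" for t
  proof -
    have "((\<lambda>t. - (a * t)) has_field_derivative - a) (at t)"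
      by (auto intro!: derivative_eq_intros)
    from has_mderiv_add [OF has_mderiv_const has_mderiv_cscale [OF this]] show ?thesis by simp
  qed
  from one_param_conj_ode [OF this, of E t] show ?thesis
    by (simp add: mat_algebra cscale_neg eq)
qed

locale sl2_triple =
  fixes E F H :: "'d::finite cmat"
  assumes ef: "E ** F - F ** E = H"
    and he: "H ** E - E ** H = cscale 2 E"
    and hf: "H ** F - F ** H = - cscale 2 F"
begin

lemma swapped: "sl2_triple F E (- H)"
  using ef he hf by unfold_locales (simp_all add: mat_algebra algebra_simps)

lemma negated: "sl2_triple (- E) (- F) H"
  using ef he hf by unfold_locales (simp_all add: mat_algebra algebra_simps)

lemma EF: "E ** F = F ** E + H"
  using ef by (simp add: algebra_simps)

lemma EH: "E ** H = H ** E - cscale 2 E"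
  using he by (simp add: algebra_simps)

lemma x_f: "one_param E t ** F = (F + cscale t H - cscale (t\<^sup>2) E) ** one_param E t"
proof -
  define G where "G t = F + cscale t H + cscale (- (t\<^sup>2)) E" for t
  have "has_mderiv G (H + cscale (- (2 * t)) E) t" for t
  proof -
    have "((\<lambda>t. - (t\<^sup>2)) has_field_derivative - (2 * t)) (at t)"
      by (auto intro!: derivative_eq_intros)
    from has_mderiv_add [OF has_mderiv_add [OF has_mderiv_const [of F] has_mderiv_cscale [OF DERIV_ident, of H]]
      has_mderiv_cscale [OF this, of E]] show ?thesis unfolding G_def by simp
  qed
  moreover have "H + cscale (- (2 * t)) E + G t ** E = E ** G t" for t
    by (simp add: G_def mat_algebra cscale_neg EF EH vec_eq_iff algebra_simps)
  ultimately have "one_param E t ** G 0 = G t ** one_param E t" by (rule one_param_conj_ode)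
  then show ?thesis by (simp add: G_def cscale_neg)
qed

lemma x_h: "one_param E t ** H = (H - cscale (2 * t) E) ** one_param E t"
  by (rule one_param_cartan_e [OF he])

lemma x_e: "one_param E t ** E = E ** one_param E t"
  by (rule one_param_intertwine) simp

end

context sl2_triple begin

lemma y_e: "one_param F t ** E = (E - cscale t H - cscale (t\<^sup>2) F) ** one_param F t"
  using sl2_triple.x_f [OF swapped, of t] by (simp add: cscale_minus)

lemma y_h: "one_param F t ** H = (H + cscale (2 * t) F) ** one_param F t"
  using one_param_cartan_e [of H F "-2" t] hf by (simp add: cscale_neg)

lemma y_f: "one_param F t ** F = F ** one_param F t"
  by (rule one_param_intertwine) simp

text \<open>A one-parameter family of lifts of the reflection: \<open>refl (- 1)\<close> is
  \<open>sbar\<close> and \<open>refl 1\<close> is its inverse. Keeping t free lets torus elements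
  appear as \<open>refl c ** refl (- 1)\<close>.\<close>

definition refl :: "complex \<Rightarrow> 'd cmat" where
  "refl t = one_param E t ** one_param F (- (1 / t)) ** one_param E t"

lemma refl_inverse [simp]: "refl t ** refl (- t) = mat 1" "refl (- t) ** refl t = mat 1"
  by (simp_all add: refl_def flip: matrix_mul_assoc)

lemma refl_e: assumes "t \<noteq> 0" shows "refl t ** E = cscale (- (1 / t\<^sup>2)) F ** refl t"
proof -
  let ?X = "one_param E t" and ?Y = "one_param F (- (1 / t))"
  have "refl t ** E = ?X ** (?Y ** E) ** ?X" by (simp add: refl_def x_e flip: matrix_mul_assoc)
  also have "\<dots> = (?X ** (E + cscale (1 / t) H - cscale (1 / t\<^sup>2) F)) ** ?Y ** ?X"
    by (simp add: y_e cscale_neg power_divide flip: matrix_mul_assoc)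
  also have "?X ** (E + cscale (1 / t) H - cscale (1 / t\<^sup>2) F) = cscale (- (1 / t\<^sup>2)) F ** ?X"
    unfolding matrix_add_ldistrib matrix_sub_ldistrib cscale_mul_right x_e x_h x_f
    using assms by (simp add: vec_eq_iff mat_algebra power2_eq_square field_simps)
  finally show ?thesis by (simp add: refl_def flip: matrix_mul_assoc)
qed

lemma refl_f: assumes "t \<noteq> 0" shows "refl t ** F = cscale (- (t\<^sup>2)) E ** refl t"
proof -
  let ?X = "one_param E t" and ?Y = "one_param F (- (1 / t))"
  have "refl t ** F = ?X ** (?Y ** (F + cscale t H - cscale (t\<^sup>2) E)) ** ?X"
    by (simp add: refl_def x_f flip: matrix_mul_assoc)
  also have "?Y ** (F + cscale t H - cscale (t\<^sup>2) E) = cscale (- (t\<^sup>2)) E ** ?Y"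
    unfolding matrix_add_ldistrib matrix_sub_ldistrib cscale_mul_right y_e y_h y_f
    using assms by (simp add: vec_eq_iff mat_algebra power2_eq_square field_simps)
  finally show ?thesis by (simp add: refl_def mat_algebra x_e) (simp add: matrix_mul_assoc x_e)
qed

lemma refl_cartan:
  assumes "h ** E - E ** h = cscale a E" "h ** F - F ** h = - cscale a F" and "t \<noteq> 0"
  shows "refl t ** h = (h - cscale a H) ** refl t"
proof -
  let ?X = "one_param E t" and ?Y = "one_param F (- (1 / t))"
  have yh: "?Y ** h = (h + cscale (- (a / t)) F) ** ?Y"
    using one_param_cartan_e [of h F "- a" "- (1 / t)"] assms(2) by (simp add: cscale_neg)
  have xh: "?X ** h = (h - cscale (a * t) E) ** ?X" by (rule one_param_cartan_e [OF assms(1)])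
  have "refl t ** h = ?X ** (?Y ** (h - cscale (a * t) E)) ** ?X"
    by (simp add: refl_def xh flip: matrix_mul_assoc)
  also have "?Y ** (h - cscale (a * t) E) = (h - cscale (a * t) E - cscale a H) ** ?Y"
    unfolding matrix_sub_ldistrib cscale_mul_right yh y_e
    using assms(3) by (simp add: vec_eq_iff mat_algebra power2_eq_square field_simps)
  also have "?X ** ((h - cscale (a * t) E - cscale a H) ** ?Y) =
     (?X ** (h - cscale (a * t) E - cscale a H)) ** ?Y" by (simp add: matrix_mul_assoc)
  also have "?X ** (h - cscale (a * t) E - cscale a H) = (h - cscale a H) ** ?X"
    unfolding matrix_sub_ldistrib cscale_mul_right xh x_e x_h
    by (simp add: vec_eq_iff mat_algebra algebra_simps)
  finally show ?thesis by (simp add: refl_def flip: matrix_mul_assoc)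
qed

text \<open>Both sides solve F' = H F. As a consequence exp(zH) depends on z only through exp z, so
  the branch of \<open>ln\<close> in \<open>coroot\<close> is immaterial; this is obtained without
  knowing the eigenvalues of H.\<close>

lemma refl_ode: "refl (exp z) = one_param H z ** refl 1"
proof -
  have dx: "has_mderiv (\<lambda>z. one_param E (exp z)) (cscale (exp z) (E ** one_param E (exp z))) z" for z
    by (rule has_mderiv_chain [where F = "one_param E", OF one_param_mderiv_left DERIV_exp])
  have "((\<lambda>z. - (exp (- z) :: complex)) has_field_derivative exp (- z)) (at z)" for z
    by (auto intro!: derivative_eq_intros)
  from has_mderiv_chain [where F = "one_param F", OF one_param_mderiv_left this]
  have dy: "has_mderiv (\<lambda>z. one_param F (- exp (- z))) (cscale (exp (- z)) (F ** one_param F (- exp (- z)))) z" for z .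
  have inv: "1 / exp z = exp (- z)" for z :: complex by (simp add: exp_minus field_simps)
  have "has_mderiv (\<lambda>z. refl (exp z)) (H ** refl (exp z)) z" for z
  proof -
    define \<tau> where "\<tau> = exp z"
    let ?X = "one_param E \<tau>" and ?Y = "one_param F (- (1 / \<tau>))"
    have t: "\<tau> \<noteq> 0" by (simp add: \<tau>_def)
    have "has_mderiv (\<lambda>z. refl (exp z))
      ((cscale \<tau> (E ** ?X) ** ?Y + ?X ** cscale (1 / \<tau>) (F ** ?Y)) ** ?X + ?X ** ?Y ** cscale \<tau> (E ** ?X)) z"
      unfolding refl_def \<tau>_def inv by (rule has_mderiv_mult [OF has_mderiv_mult [OF dx dy] dx])
    moreover have "?X ** ?Y ** cscale \<tau> (E ** ?X) = cscale \<tau> (refl \<tau> ** E)"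
      by (simp add: refl_def mat_algebra x_e)
    moreover have "?X ** cscale (1 / \<tau>) (F ** ?Y) ** ?X = cscale (1 / \<tau>) ((?X ** F) ** ?Y ** ?X)"
      by (simp add: mat_algebra)
    moreover have "cscale \<tau> (E ** ?X) ** ?Y ** ?X + cscale (1 / \<tau>) ((?X ** F) ** ?Y ** ?X) + cscale \<tau> (refl \<tau> ** E)
       = H ** refl \<tau>"
      unfolding refl_e [OF t] x_f using t
      by (simp add: vec_eq_iff refl_def mat_algebra power2_eq_square field_simps)
    ultimately show ?thesis by (simp add: matrix_add_rdistrib \<tau>_def)
  qed
  from one_param_ode_left [OF this, of z] show ?thesis by simp
qed

lemma one_param_cartan: "exp z = c \<Longrightarrow> one_param H z = refl c ** refl (- 1)"
  using refl_ode [of z] by (simp add: matrix_mul_assoc [symmetric])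

lemma coroot_refl: "c \<noteq> 0 \<Longrightarrow> coroot H c = refl c ** refl (- 1)"
  using one_param_cartan [of "ln c"] by (simp add: coroot_def one_param_def)

text \<open>\<open>- ln c\<close> may differ from \<open>ln (1 / c)\<close> by a period;
  \<open>one_param_cartan\<close> accepts any logarithm.\<close>

lemma coroot_inverse: "c \<noteq> 0 \<Longrightarrow> coroot H c ** coroot H (1 / c) = mat 1"
  using one_param_cartan [of "- ln c" "1 / c"] one_param_inverse(1) [of H "ln c"]
  by (simp add: coroot_refl exp_minus inverse_eq_divide) (simp add: coroot_def one_param_def flip: coroot_refl)

lemma refl_x: "t \<noteq> 0 \<Longrightarrow> refl t ** one_param E s = one_param F (- (s / t\<^sup>2)) ** refl t"
  using one_param_conj [OF refl_e, of t s] by (simp add: one_param_cscale)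

lemma refl_y: "t \<noteq> 0 \<Longrightarrow> refl t ** one_param F s = one_param E (- (s * t\<^sup>2)) ** refl t"
  using one_param_conj [OF refl_f, of t s] by (simp add: one_param_cscale mult.commute)

text \<open>In \<open>refl t ** refl t\<close> one factor is expanded and its letters are carried
  across the other, which exchanges x(t) with y(-1/t); cancelling \<open>refl t\<close> leaves the y
  x y form.\<close>

lemma refl_alt:
  assumes "t \<noteq> 0"
  shows "refl t = one_param F (- (1 / t)) ** one_param E t ** one_param F (- (1 / t))"
proof -
  let ?Y = "one_param F (- (1 / t))" and ?X = "one_param E t"
  have x: "refl t ** ?X = ?Y ** refl t" and y: "refl t ** ?Y = ?X ** refl t"
    using refl_x [OF assms, of t] refl_y [OF assms, of "- (1 / t)"] assms
    by (simp_all add: power2_eq_square)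
  have "refl t ** refl t = ((refl t ** ?X) ** ?Y) ** ?X"
    by (subst (2) refl_def) (simp add: matrix_mul_assoc)
  also have "\<dots> = ?Y ** (refl t ** ?Y) ** ?X" by (simp add: x matrix_mul_assoc)
  also have "\<dots> = ?Y ** ?X ** (refl t ** ?X)" by (simp add: y matrix_mul_assoc)
  also have "\<dots> = ?Y ** ?X ** ?Y ** refl t" by (simp add: x matrix_mul_assoc)
  finally have "(refl t ** refl t) ** refl (- t) = (?Y ** ?X ** ?Y ** refl t) ** refl (- t)" by simp
  then show ?thesis by (simp flip: matrix_mul_assoc)
qed

lemma refl_1_x: "refl (- 1) ** one_param E s = one_param F (- s) ** refl (- 1)"
  using refl_x [of "-1" s] by simp

text \<open>With \<open>coroot H t\<close> written as \<open>refl t ** refl (- 1)\<close> and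
  \<open>refl t\<close> in its y x y form, the right-hand side collapses.\<close>

lemma x_refl:
  assumes "t \<noteq> 0"
  shows "one_param E t ** refl (- 1) = one_param F (1 / t) ** coroot H t ** one_param E (- (1 / t))"
proof -
  have "one_param F (1 / t) ** coroot H t ** one_param E (- (1 / t))
     = one_param F (1 / t) ** refl t ** (refl (- 1) ** one_param E (- (1 / t)))"
    by (simp add: coroot_refl assms matrix_mul_assoc)
  also have "\<dots> = one_param F (1 / t) ** refl t ** one_param F (1 / t) ** refl (- 1)"
    by (simp add: refl_1_x matrix_mul_assoc)
  also have "\<dots> = one_param E t ** refl (- 1)"
    unfolding refl_alt [OF assms] by (simp flip: matrix_mul_assoc)
  finally show ?thesis by simp
qed

end

context sl2_triple begin

text \<open>Passing to the triple (-E, -F, H) turns identities for \<open>sbar\<close> into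
  identities for its inverse.\<close>

lemma neg_refl: "sl2_triple.refl (- E) (- F) t = refl (- t)"
  by (simp add: sl2_triple.refl_def [OF negated] refl_def one_param_uminus)

lemma x_refl':
  assumes "t \<noteq> 0"
  shows "one_param E t ** refl 1 = one_param F (1 / t) ** coroot H (- t) ** one_param E (- (1 / t))"
  using sl2_triple.x_refl [OF negated, of "- t"] assms by (simp add: neg_refl one_param_uminus)

lemma y_coroot:
  assumes "c \<noteq> 0"
  shows "one_param F c ** coroot H (1 / c) = one_param E (1 / c) ** refl (- 1) ** one_param E c"
proof -
  have "one_param F c ** coroot H (1 / c) = one_param F c ** refl (1 / c) ** refl (- 1)"
    using assms by (simp add: coroot_refl matrix_mul_assoc)
  also have "\<dots> = one_param E (1 / c) ** (one_param F (- c) ** refl (- 1))"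
    using assms by (subst refl_alt) (simp_all flip: matrix_mul_assoc)
  finally show ?thesis by (simp add: refl_1_x flip: matrix_mul_assoc)
qed

end

lemma coroot_shift:
  fixes h E :: "'d::finite cmat"
  assumes "h ** E - E ** h = cscale a E"
  shows "coroot h c ** one_param E t = one_param E (exp (a * ln c) * t) ** coroot h c"
proof -
  have "h ** E = E ** (h + cscale a (mat 1))"
    using assms by (simp add: mat_algebra algebra_simps)
  from one_param_intertwine [OF this, of "ln c"]
  have "coroot h c ** E = cscale (exp (a * ln c)) E ** coroot h c"
    by (simp add: coroot_def one_param_shift mat_algebra flip: one_param_def)
  from one_param_conj [OF this, of t] show ?thesis by (simp add: one_param_cscale mult.commute)
qed

section \<open>Unipotent closures and the splitting off of one simple root subgroup\<close>

lemma closure_map: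
  assumes "continuous_on UNIV f" "\<And>u. u \<in> A \<Longrightarrow> f u \<in> closure B" "u \<in> closure A"
  shows "f u \<in> closure B"
proof -
  have "f ` closure A \<subseteq> closure B"
    using assms(1,2) by (intro image_closure_subset) (auto intro: continuous_on_subset)
  then show ?thesis using assms(3) by blast
qed

text \<open>The abstract setting to be instantiated with pairs of matrices. \<open>chi i\<close>
  measures the total amount of x_i in a product of root elements. \<open>T\<close> is a closed
  multiplicative set on which \<open>chi i\<close> is additive, so that additivity is available for
  limits as well.\<close>

locale rank_one_system =
  fixes mul :: "'a::topological_space \<Rightarrow> 'a \<Rightarrow> 'a" (infixl "\<odot>" 70)
    and one :: 'a ("\<e>")
    and I :: "nat set"
    and x y h :: "nat \<Rightarrow> complex \<Rightarrow> 'a"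
    and s s' :: "nat \<Rightarrow> 'a"
    and T :: "'a set"
    and chi :: "nat \<Rightarrow> 'a \<Rightarrow> complex"
  assumes assoc: "u \<odot> v \<odot> w = u \<odot> (v \<odot> w)"
    and left_one [simp]: "\<e> \<odot> u = u"
    and right_one [simp]: "u \<odot> \<e> = u"
    and continuous_mul: "continuous_on UNIV (\<lambda>p. fst p \<odot> snd p)"
    and continuous_x: "i \<in> I \<Longrightarrow> continuous_on UNIV (x i)"
    and x_add: "i \<in> I \<Longrightarrow> x i (t + t') = x i t \<odot> x i t'"
    and x_0 [simp]: "i \<in> I \<Longrightarrow> x i 0 = \<e>"
    and y_inverse: "i \<in> I \<Longrightarrow> y i t \<odot> y i (- t) = \<e>"
    and y_x: "i \<in> I \<Longrightarrow> j \<in> I \<Longrightarrow> i \<noteq> j \<Longrightarrow> y i t' \<odot> x j t = x j t \<odot> y i t'"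
    and h_x: "i \<in> I \<Longrightarrow> j \<in> I \<Longrightarrow> c \<noteq> 0 \<Longrightarrow> \<exists>t'. h i c \<odot> x j t = x j t' \<odot> h i c"
    and h_inverse: "i \<in> I \<Longrightarrow> c \<noteq> 0 \<Longrightarrow> h i c \<odot> h i (1 / c) = \<e>"
    and s_inverse: "i \<in> I \<Longrightarrow> s i \<odot> s' i = \<e>" "i \<in> I \<Longrightarrow> s' i \<odot> s i = \<e>"
    and x_s: "i \<in> I \<Longrightarrow> t \<noteq> 0 \<Longrightarrow> x i t \<odot> s i = y i (1 / t) \<odot> h i t \<odot> x i (- (1 / t))"
    and x_s': "i \<in> I \<Longrightarrow> t \<noteq> 0 \<Longrightarrow> x i t \<odot> s' i = y i (1 / t) \<odot> h i (- t) \<odot> x i (- (1 / t))"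
    and one_T: "\<e> \<in> T"
    and x_T: "i \<in> I \<Longrightarrow> x i t \<in> T"
    and mul_T: "u \<in> T \<Longrightarrow> v \<in> T \<Longrightarrow> u \<odot> v \<in> T"
    and closed_T: "closed T"
    and continuous_chi: "i \<in> I \<Longrightarrow> continuous_on UNIV (chi i)"
    and chi_one: "i \<in> I \<Longrightarrow> chi i \<e> = 0"
    and chi_x: "i \<in> I \<Longrightarrow> j \<in> I \<Longrightarrow> chi i (x j t) = (if i = j then t else 0)"
    and chi_mul: "i \<in> I \<Longrightarrow> u \<in> T \<Longrightarrow> v \<in> T \<Longrightarrow> chi i (u \<odot> v) = chi i u + chi i v"
begin

lemma x_inverse [simp]:
  assumes "i \<in> I"
  shows "x i t \<odot> x i (- t) = \<e>" "x i (- t) \<odot> x i t = \<e>"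
    "x i t \<odot> (x i (- t) \<odot> a) = a" "x i (- t) \<odot> (x i t \<odot> a) = a"
  using assms by (simp_all flip: x_add assoc)

lemma continuous_on_mul:
  assumes "continuous_on S f" "continuous_on S g"
  shows "continuous_on S (\<lambda>u. f u \<odot> g u)"
  using continuous_on_compose2 [OF continuous_mul continuous_on_Pair [OF assms]] by simp

lemma continuous_on_x: "i \<in> I \<Longrightarrow> continuous_on S f \<Longrightarrow> continuous_on S (\<lambda>u. x i (f u))"
  by (rule continuous_on_compose2 [OF continuous_x]) auto

lemma closure_mul:
  assumes "\<And>u v. u \<in> A \<Longrightarrow> v \<in> A \<Longrightarrow> u \<odot> v \<in> A" and "u \<in> closure A" "v \<in> closure A"
  shows "u \<odot> v \<in> closure A"
proof -
  have "(\<lambda>p. fst p \<odot> snd p) ` closure (A \<times> A) \<subseteq> closure A"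
    by (rule image_closure_subset [OF continuous_on_subset [OF continuous_mul]])
      (use assms(1) closure_subset in fastforce)+
  then show ?thesis using assms(2,3) by (force simp: closure_Times)
qed

inductive_set U0 :: "'a set" where
  one: "\<e> \<in> U0"
| step: "i \<in> I \<Longrightarrow> u \<in> U0 \<Longrightarrow> x i t \<odot> u \<in> U0"

definition U :: "'a set" where "U = closure U0"

text \<open>Modelled on the unipotent radical of the i-th minimal parabolic, the kernel of
  \<open>chi i\<close> in the unipotent group. Taking all conjugates of the other x_j by x_i as
  generators avoids commutator formulas.\<close>

inductive_set R0 :: "nat \<Rightarrow> 'a set" for i where
  one: "\<e> \<in> R0 i"
| step: "j \<in> I \<Longrightarrow> j \<noteq> i \<Longrightarrow> u \<in> R0 i \<Longrightarrow> x i a \<odot> x j t \<odot> x i (- a) \<odot> u \<in> R0 i"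

definition R :: "nat \<Rightarrow> 'a set" where "R i = closure (R0 i)"

lemma U0_mul: "u \<in> U0 \<Longrightarrow> v \<in> U0 \<Longrightarrow> u \<odot> v \<in> U0"
  by (induction rule: U0.induct) (auto simp: assoc intro: U0.intros)

lemma U_mul: "u \<in> U \<Longrightarrow> v \<in> U \<Longrightarrow> u \<odot> v \<in> U"
  unfolding U_def by (rule closure_mul [OF U0_mul])

lemma U_one: "\<e> \<in> U"
  using closure_subset U0.one by (auto simp: U_def)

lemma x_U0: "i \<in> I \<Longrightarrow> x i t \<in> U0"
  using U0.step [OF _ U0.one, of i t] by simp

lemma x_U: "i \<in> I \<Longrightarrow> x i t \<in> U"
  using x_U0 closure_subset by (auto simp: U_def)

lemma U0_T: "u \<in> U0 \<Longrightarrow> u \<in> T"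
  by (induction rule: U0.induct) (auto intro: one_T x_T mul_T)

lemma U_T: "u \<in> U \<Longrightarrow> u \<in> T"
  unfolding U_def using closure_minimal [OF _ closed_T] U0_T by blast

text \<open>The x_i factors are collected on the left; every x_j that is passed on the way turns
  into one of the conjugates generating \<open>R0 i\<close>.\<close>

lemma U0_decomp: "u \<in> U0 \<Longrightarrow> i \<in> I \<Longrightarrow> x i (- chi i u) \<odot> u \<in> R0 i"
proof (induction rule: U0.induct)
  case one
  then show ?case by (simp add: chi_one R0.one)
next
  case (step j u t)
  have chi: "chi i (x j t \<odot> u) = (if i = j then t else 0) + chi i u"
    using step by (simp add: chi_mul x_T U0_T chi_x)
  show ?case
  proof (cases "j = i")
    case True
    have "x i (- t - chi i u) \<odot> (x i t \<odot> u) = x i (- chi i u) \<odot> u"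
      using step by (simp flip: x_add assoc)
    then show ?thesis using step True chi by simp
  next
    case False
    have "x i (- chi i u) \<odot> x j t \<odot> x i (- (- chi i u)) \<odot> (x i (- chi i u) \<odot> u) \<in> R0 i"
      by (rule R0.step) (use step False in auto)
    then show ?thesis using False step by (simp add: chi assoc)
  qed
qed

lemma U_decomp:
  assumes "u \<in> U" "i \<in> I" shows "x i (- chi i u) \<odot> u \<in> R i"
  unfolding R_def
proof (rule closure_map [where A = U0 and u = u and f = "\<lambda>u. x i (- chi i u) \<odot> u"])
  show "continuous_on UNIV (\<lambda>u. x i (- chi i u) \<odot> u)"
    using assms by (intro continuous_on_mul continuous_on_x continuous_on_minus continuous_chi) auto
qed (use assms U0_decomp closure_subset in \<open>auto simp: U_def\<close>)

lemma R0_conj_x: "r \<in> R0 i \<Longrightarrow> i \<in> I \<Longrightarrow> x i a \<odot> r \<odot> x i (- a) \<in> R0 i"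
proof (induction rule: R0.induct)
  case one
  then show ?case by (simp add: R0.one)
next
  case (step j u b t)
  have "x i (a + b) \<odot> x j t \<odot> x i (- (a + b)) \<odot> (x i a \<odot> u \<odot> x i (- a)) \<in> R0 i"
    by (rule R0.step) (use step in auto)
  moreover have "x i (- (a + b)) \<odot> (x i a \<odot> v) = x i (- b) \<odot> v" for v
    using step by (simp flip: x_add assoc)
  ultimately show ?case using step by (simp add: assoc x_add [of i a b])
qed

lemma R_conj_x:
  assumes "r \<in> R i" "i \<in> I" shows "x i a \<odot> r \<odot> x i (- a) \<in> R i"
  unfolding R_def
proof (rule closure_map [where A = "R0 i" and u = r and f = "\<lambda>r. x i a \<odot> r \<odot> x i (- a)"])
  show "continuous_on UNIV (\<lambda>r. x i a \<odot> r \<odot> x i (- a))"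
    by (intro continuous_on_mul continuous_on_const continuous_on_id)
qed (use assms R0_conj_x closure_subset [of "R0 i"] in \<open>auto simp: R_def\<close>)

lemma U_decomp_right:
  assumes "u \<in> U" "i \<in> I" shows "\<exists>r\<in>R i. u = r \<odot> x i (chi i u)"
proof
  let ?r = "x i (chi i u) \<odot> (x i (- chi i u) \<odot> u) \<odot> x i (- chi i u)"
  show "?r \<in> R i" by (rule R_conj_x [OF U_decomp]) fact+
  show "u = ?r \<odot> x i (chi i u)" using assms by (simp add: assoc)
qed

lemma U_decomp_left:
  assumes "u \<in> U" "i \<in> I" shows "\<exists>r\<in>R i. u = x i (chi i u) \<odot> r"
  using assms U_decomp [OF assms] by (intro bexI [of _ "x i (- chi i u) \<odot> u"]) auto

text \<open>For \<open>a \<noteq> 0\<close> the conjugate is computed in rank one; the case \<open>a = 0\<close> is a limit of these, which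
  is why closures are taken.\<close>

lemma conj_generator:
  assumes ij: "i \<in> I" "j \<in> I" "j \<noteq> i"
    and inv: "\<sigma> \<odot> \<sigma>' = \<e>" "\<sigma>' \<odot> \<sigma> = \<e>"
    and rel: "\<And>t. t \<noteq> 0 \<Longrightarrow> \<exists>c. c \<noteq> 0 \<and> x i t \<odot> \<sigma> = y i (1 / t) \<odot> h i c \<odot> x i (- (1 / t))"
  shows "\<sigma>' \<odot> (x i a \<odot> x j t \<odot> x i (- a)) \<odot> \<sigma> \<in> U"
proof -
  let ?f = "\<lambda>a. \<sigma>' \<odot> (x i a \<odot> x j t \<odot> x i (- a)) \<odot> \<sigma>"
  have nz: "?f a \<in> U0" if a: "a \<noteq> 0" for a
  proof -
    obtain c where c: "c \<noteq> 0" and P: "x i (- a) \<odot> \<sigma> = y i (- (1 / a)) \<odot> h i c \<odot> x i (1 / a)"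
      using rel [of "- a"] a by auto
    let ?Q = "x i (- (1 / a)) \<odot> h i (1 / c) \<odot> y i (1 / a)"
    have hh: "h i c \<odot> (h i (1 / c) \<odot> v) = v" "h i (1 / c) \<odot> (h i c \<odot> v) = v" for v
      using h_inverse [of i c] h_inverse [of i "1 / c"] ij c by (simp_all flip: assoc)
    have yy: "y i (- b) \<odot> (y i b \<odot> v) = v" "y i b \<odot> y i (- b) = \<e>" "y i (- b) \<odot> y i b = \<e>" for b v
      using y_inverse [of i b] y_inverse [of i "- b"] ij by (simp_all flip: assoc)
    have PQ: "(x i (- a) \<odot> \<sigma>) \<odot> ?Q = \<e>"
      unfolding P using ij by (simp add: assoc hh yy)
    have "\<sigma>' \<odot> x i a = \<sigma>' \<odot> x i a \<odot> ((x i (- a) \<odot> \<sigma>) \<odot> ?Q)" by (simp only: PQ right_one)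
    also have "\<dots> = \<sigma>' \<odot> (x i a \<odot> (x i (- a) \<odot> (\<sigma> \<odot> ?Q)))" by (simp only: assoc)
    also have "\<dots> = (\<sigma>' \<odot> \<sigma>) \<odot> ?Q" using ij by (simp add: assoc)
    finally have Q: "\<sigma>' \<odot> x i a = ?Q" by (simp add: inv)
    obtain b where b: "h i (1 / c) \<odot> x j t = x j b \<odot> h i (1 / c)"
      using h_x [of i j "1 / c" t] ij c by auto
    \<comment> \<open>The two outer factors are mutually inverse. Their y_i parts cancel because y_i
      commutes with x_j, and the torus part only rescales the parameter of x_j.\<close>
    have "?f a = (\<sigma>' \<odot> x i a) \<odot> x j t \<odot> (x i (- a) \<odot> \<sigma>)" by (simp add: assoc)
    also have "\<dots> = x i (- (1 / a)) \<odot> h i (1 / c) \<odot> (y i (1 / a) \<odot> x j t) \<odot> y i (- (1 / a)) \<odot> h i c \<odot> x i (1 / a)"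
      unfolding P Q by (simp add: assoc)
    also have "\<dots> = x i (- (1 / a)) \<odot> (h i (1 / c) \<odot> x j t) \<odot> (y i (1 / a) \<odot> y i (- (1 / a))) \<odot> h i c \<odot> x i (1 / a)"
      using ij by (simp add: y_x assoc)
    also have "\<dots> = x i (- (1 / a)) \<odot> x j b \<odot> x i (1 / a)"
      by (simp add: b yy assoc hh)
    also have "\<dots> \<in> U0" using ij by (intro U0_mul x_U0)
    finally show ?thesis .
  qed
  have "(0::complex) \<in> closure (- {0})" by (simp add: closure_complement)
  moreover have "continuous_on UNIV ?f"
    using ij by (intro continuous_on_mul continuous_on_const continuous_on_x continuous_on_minus continuous_on_id)
  ultimately have "?f 0 \<in> closure U0"
    by (intro closure_map [where A = "- {0}" and u = 0 and f = ?f])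
      (use nz closure_subset [of U0] in auto)
  then show ?thesis
    using nz [of a] closure_subset by (cases "a = 0") (auto simp: U_def)
qed

text \<open>Stated for an arbitrary lift \<sigma> so that it covers both \<open>s i\<close> and
  \<open>s' i\<close>. The conjugated generators are multiplied inside \<open>U\<close>, and limits
  are taken last.\<close>

lemma R_conj_aux:
  assumes i: "i \<in> I"
    and inv: "\<sigma> \<odot> \<sigma>' = \<e>" "\<sigma>' \<odot> \<sigma> = \<e>"
    and rel: "\<And>t. t \<noteq> 0 \<Longrightarrow> \<exists>c. c \<noteq> 0 \<and> x i t \<odot> \<sigma> = y i (1 / t) \<odot> h i c \<odot> x i (- (1 / t))"
    and r: "r \<in> R i"
  shows "\<sigma>' \<odot> r \<odot> \<sigma> \<in> U"
proof -
  have R0: "\<sigma>' \<odot> r \<odot> \<sigma> \<in> U" if "r \<in> R0 i" for r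
    using that
  proof (induction rule: R0.induct)
    case one
    then show ?case using inv U_one by simp
  next
    case (step j u a t)
    have "(\<sigma>' \<odot> (x i a \<odot> x j t \<odot> x i (- a)) \<odot> \<sigma>) \<odot> (\<sigma>' \<odot> u \<odot> \<sigma>) \<in> U"
      using step by (intro U_mul [OF conj_generator [OF i _ _ inv rel]]) auto
    moreover have "\<sigma> \<odot> (\<sigma>' \<odot> v) = v" for v using inv by (simp flip: assoc)
    ultimately show ?case by (simp add: assoc)
  qed
  show ?thesis unfolding U_def
  proof (rule closure_map [where A = "R0 i" and u = r and f = "\<lambda>r. \<sigma>' \<odot> r \<odot> \<sigma>"])
    show "continuous_on UNIV (\<lambda>r. \<sigma>' \<odot> r \<odot> \<sigma>)"
      by (intro continuous_on_mul continuous_on_const continuous_on_id)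
  qed (use r R0 in \<open>auto simp: R_def U_def\<close>)
qed

lemma R_conj: assumes "i \<in> I" "r \<in> R i" shows "s' i \<odot> r \<odot> s i \<in> U" "s i \<odot> r \<odot> s' i \<in> U"
proof -
  show "s' i \<odot> r \<odot> s i \<in> U"
    by (rule R_conj_aux [OF _ s_inverse]) (use assms x_s in blast)+
  show "s i \<odot> r \<odot> s' i \<in> U"
    by (rule R_conj_aux [OF _ s_inverse(2,1)])
      (use assms x_s' in \<open>auto intro: exI [of _ "- _"]\<close>)
qed

end

subsection \<open>The Weyl group as signed permutations\<close>

text \<open>The indices \<open>1, \<dots>, 2n+1\<close> stand for \<open>\<epsilon>\<^sub>1, \<dots>, \<epsilon>\<^sub>n, 0, -\<epsilon>\<^sub>n, \<dots>, -\<epsilon>\<^sub>1\<close>.\<close>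

definition srefl :: "nat \<Rightarrow> nat \<Rightarrow> nat \<Rightarrow> nat" where
  "srefl n i a =
     (if i < n then
        (if a = i \<or> a + i = 2 * n + 1 then a + 1
         else if a = i + 1 \<or> a + i = 2 * n + 2 then a - 1 else a)
      else if a = n then n + 2 else if a = n + 2 then n else a)"

text \<open>The inverse of the signed permutation belonging to a word: it tells how the word moves the
  coordinates of a weight.\<close>

definition perm_inv :: "nat \<Rightarrow> nat list \<Rightarrow> nat \<Rightarrow> nat" where
  "perm_inv n is = foldl (\<lambda>p i. srefl n i \<circ> p) id is"

lemma foldl_comp:
  fixes g :: "'a \<Rightarrow> 'a"
  shows "foldl (\<lambda>p i. f i \<circ> p) g is = foldl (\<lambda>p i. f i \<circ> p) id is \<circ> g"
proof (induction "is" arbitrary: g)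
  case (Cons i "is")
  show ?case using Cons [of "f i \<circ> g"] Cons [of "f i"] by (simp add: comp_assoc)
qed simp

lemma perm_inv_Nil [simp]: "perm_inv n [] = id"
  by (simp add: perm_inv_def)

lemma perm_inv_Cons: "perm_inv n (i # is) = perm_inv n is \<circ> srefl n i"
  unfolding perm_inv_def by (simp add: foldl_comp [of "srefl n" "srefl n i"])

lemma perm_inv_append: "perm_inv n (xs @ ys) = perm_inv n ys \<circ> perm_inv n xs"
  by (induction xs) (simp_all add: perm_inv_Cons comp_assoc)

lemma srefl_range: "i \<in> {1..n} \<Longrightarrow> a \<in> {1..2*n+1} \<Longrightarrow> srefl n i a \<in> {1..2*n+1}"
  by (auto simp: srefl_def)

lemma srefl_mirror:
  "i \<in> {1..n} \<Longrightarrow> a \<ge> 1 \<Longrightarrow> b \<ge> 1 \<Longrightarrow> a + b = 2*n+2 \<Longrightarrow> srefl n i a + srefl n i b = 2*n+2"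
  by (cases "i < n") (auto simp: srefl_def)

lemma srefl_srefl: "i \<in> {1..n} \<Longrightarrow> srefl n i (srefl n i a) = a"
  by (cases "i < n") (auto simp: srefl_def)

lemma srefl_outside: "i \<in> {1..n} \<Longrightarrow> a \<notin> {1..2*n+1} \<Longrightarrow> srefl n i a = a"
  by (auto simp: srefl_def)

lemma perm_inv_range:
  "set is \<subseteq> {1..n} \<Longrightarrow> a \<in> {1..2*n+1} \<Longrightarrow> perm_inv n is a \<in> {1..2*n+1}"
proof (induction "is" arbitrary: a)
  case (Cons i "is")
  then show ?case using srefl_range [of i n a] by (simp add: perm_inv_Cons)
qed simp

lemma perm_inv_mirror:
  "set is \<subseteq> {1..n} \<Longrightarrow> a \<ge> 1 \<Longrightarrow> b \<ge> 1 \<Longrightarrow> a + b = 2*n+2 \<Longrightarrow>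
   perm_inv n is a + perm_inv n is b = 2*n+2"
proof (induction "is" arbitrary: a b)
  case (Cons i "is")
  have "srefl n i a \<ge> 1" "srefl n i b \<ge> 1"
    using srefl_range [of i n a] srefl_range [of i n b] Cons.prems by auto
  then show ?case using Cons srefl_mirror [of i n a b] by (simp add: perm_inv_Cons)
qed simp

lemma perm_inv_outside:
  "set is \<subseteq> {1..n} \<Longrightarrow> a \<notin> {1..2*n+1} \<Longrightarrow> perm_inv n is a = a"
  by (induction "is") (simp_all add: perm_inv_Cons srefl_outside)

lemma inj_srefl: "i \<in> {1..n} \<Longrightarrow> inj (srefl n i)"
  by (rule inj_on_inverseI) (rule srefl_srefl)

lemma inj_perm_inv: "set is \<subseteq> {1..n} \<Longrightarrow> inj (perm_inv n is)"
  by (induction "is") (simp_all add: perm_inv_Cons inj_compose inj_srefl)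

lemma perm_inv_middle: "set is \<subseteq> {1..n} \<Longrightarrow> perm_inv n is (n + 1) = n + 1"
  by (induction "is") (auto simp: perm_inv_Cons srefl_def)

subsection \<open>Signed permutations and weights\<close>

text \<open>Twice the \<open>\<epsilon>\<close>-coordinates, followed by a zero and by their negatives in reverse order, i.e. the
  weights of the vector representation paired with \<open>l\<close>.\<close>

definition eps_coord :: "nat \<Rightarrow> (nat \<Rightarrow> int) \<Rightarrow> nat \<Rightarrow> int" where
  "eps_coord n l a = (if a \<le> n then 2 * (\<Sum>j\<in>{a..<n}. l j) + l n
     else if a = n + 1 then 0 else - (2 * (\<Sum>j\<in>{2*n+2-a..<n}. l j) + l n))"

lemma eps_coord_n: "eps_coord n l n = l n"
  by (simp add: eps_coord_def)

lemma eps_coord_Suc: "a < n \<Longrightarrow> eps_coord n l a = 2 * l a + eps_coord n l (Suc a)"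
  by (simp add: eps_coord_def sum.atLeast_Suc_lessThan)

lemma eps_coord_mirror:
  assumes "a \<ge> 1" "b \<ge> 1" "a + b = 2*n+2" shows "eps_coord n l b = - eps_coord n l a"
proof -
  have "b = 2*n+2-a" using assms by simp
  then show ?thesis using assms by (auto simp: eps_coord_def)
qed

lemma eps_coord_refl:
  assumes n: "n \<ge> 2" and i: "i \<in> {1..n}" and a: "a \<in> {1..2*n+1}"
  shows "eps_coord n (simple_refl n i l) a = eps_coord n l (srefl n i a)"
proof -
  let ?l = "simple_refl n i l"
  \<comment> \<open>The recursion eps_a = 2 l_a + eps_(a+1) calls for downward induction from n; the
    upper half of the indices then follows by antisymmetry under a -> 2n+2-a.\<close>
  have le: "eps_coord n ?l a = eps_coord n l (srefl n i a)" if "1 \<le> a" "a \<le> n" for a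
    using that(2,1)
  proof (induction a rule: inc_induct)
    case base
    have "eps_coord n l (n + 2) = - l n"
      using eps_coord_mirror [of n "n + 2" n l] n by (simp add: eps_coord_n)
    moreover have "eps_coord n l (n - 1) = 2 * l (n - 1) + l n"
      using eps_coord_Suc [of "n - 1" n l] n by (simp add: eps_coord_n)
    ultimately show ?case
      using i n by (auto simp: eps_coord_n simple_refl_def srefl_def cartan_B_def)
  next
    case (step a)
    have IH: "eps_coord n ?l (Suc a) = eps_coord n l (srefl n i (Suc a))" using step by simp
    have "eps_coord n l (srefl n i a) = 2 * ?l a + eps_coord n l (srefl n i (Suc a))"
    proof (cases "i = n")
      case True
      have "eps_coord n l (n + 2) = - l n"
        using eps_coord_mirror [of n "n + 2" n l] n by (simp add: eps_coord_n)
      then show ?thesis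
        using step True n eps_coord_Suc [of a n l]
        by (auto simp: srefl_def simple_refl_def cartan_B_def eps_coord_n)
    next
      case False
      consider "a = i" | "Suc a = i" | "a = Suc i" | "a \<noteq> i \<and> Suc a \<noteq> i \<and> a \<noteq> Suc i" by blast
      then show ?thesis
      proof cases
        case 1
        then show ?thesis using False i step eps_coord_Suc [of i n l]
          by (auto simp: srefl_def simple_refl_def cartan_B_def)
      next
        case 2
        then show ?thesis using False i step eps_coord_Suc [of i n l] eps_coord_Suc [of a n l]
          by (auto simp: srefl_def simple_refl_def cartan_B_def)
      next
        case 3
        then show ?thesis using False i step eps_coord_Suc [of i n l] eps_coord_Suc [of a n l]
          by (auto simp: srefl_def simple_refl_def cartan_B_def)
      next
        case 4
        then show ?thesis using False i step eps_coord_Suc [of a n l]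
          by (auto simp: srefl_def simple_refl_def cartan_B_def)
      qed
    qed
    then show ?case using step IH eps_coord_Suc [of a n ?l] by simp
  qed
  consider "a \<le> n" | "a = n + 1" | "a \<ge> n + 2" by linarith
  then show ?thesis
  proof cases
    case 1
    then show ?thesis using le a by simp
  next
    case 2
    then have "srefl n i a = n + 1" using i by (auto simp: srefl_def)
    with 2 show ?thesis by (simp add: eps_coord_def)
  next
    case 3
    define b where "b = 2*n+2-a"
    have b: "1 \<le> b" "b \<le> n" "b + a = 2*n+2" "1 \<le> a" "b \<in> {1..2*n+1}" using 3 a by (auto simp: b_def)
    have "eps_coord n ?l a = - eps_coord n l (srefl n i b)"
      using eps_coord_mirror [OF b(1,4,3), of ?l] le [OF b(1,2)] by simp
    also have "\<dots> = eps_coord n l (srefl n i a)"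
      by (rule eps_coord_mirror [symmetric])
        (use srefl_range [OF i b(5)] srefl_range [OF i a] srefl_mirror [OF i b(1,4,3)] in auto)
    finally show ?thesis .
  qed
qed

lemma weyl_word_Cons: "weyl_word n (i # is) = simple_refl n i \<circ> weyl_word n is"
  by (simp add: weyl_word_def)

lemma eps_coord_weyl_word:
  assumes "n \<ge> 2"
  shows "set is \<subseteq> {1..n} \<Longrightarrow> a \<in> {1..2*n+1} \<Longrightarrow>
    eps_coord n (weyl_word n is l) a = eps_coord n l (perm_inv n is a)"
proof (induction "is" arbitrary: a)
  case Nil
  then show ?case by (simp add: weyl_word_def)
next
  case (Cons i "is")
  then show ?case
    using srefl_range [of i n a] assms
    by (simp add: weyl_word_Cons eps_coord_refl perm_inv_Cons)
qed

lemma weyl_word_outside: "j \<notin> {1..n} \<Longrightarrow> weyl_word n is l j = l j"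
proof (induction "is")
  case Nil
  then show ?case by (simp add: weyl_word_def)
next
  case (Cons i "is")
  then show ?case by (auto simp: weyl_word_Cons simple_refl_def)
qed

lemma eps_coord_inj:
  assumes "n \<ge> 1" "\<And>a. a \<in> {1..n} \<Longrightarrow> eps_coord n l a = eps_coord n l' a" "j \<in> {1..n}"
  shows "l j = l' j"
proof (cases "j = n")
  case True
  then show ?thesis using assms(2) [of n] assms(1) by (simp add: eps_coord_n)
next
  case False
  then show ?thesis
    using assms(2) [of j] assms(2) [of "Suc j"] eps_coord_Suc [of j n l] eps_coord_Suc [of j n l'] assms(3)
    by simp
qed

text \<open>The weight rho is regular: these values are pairwise distinct, so the image of rho under
  a Weyl group element determines its signed permutation.\<close>

lemma eps_coord_rho: "a \<in> {1..2*n+1} \<Longrightarrow> eps_coord n (\<lambda>_. 1) a =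
    (if a \<le> n then 2 * int n + 1 - 2 * int a else if a = n + 1 then 0 else 2 * int n + 3 - 2 * int a)"
  by (auto simp: eps_coord_def)

lemma weyl_word_eq_iff:
  assumes n: "n \<ge> 2" and "is": "set is \<subseteq> {1..n}" and js: "set js \<subseteq> {1..n}"
  shows "weyl_word n is = weyl_word n js \<longleftrightarrow> perm_inv n is = perm_inv n js"
proof
  assume eq: "weyl_word n is = weyl_word n js"
  show "perm_inv n is = perm_inv n js"
  proof
    fix a
    show "perm_inv n is a = perm_inv n js a"
    proof (cases "a \<in> {1..2*n+1}")
      case True
      have "eps_coord n (\<lambda>_. 1) (perm_inv n is a) = eps_coord n (\<lambda>_. 1) (perm_inv n js a)"
        using eps_coord_weyl_word [OF n "is" True] eps_coord_weyl_word [OF n js True] eq by metis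
      then show ?thesis
        using perm_inv_range [OF "is" True] perm_inv_range [OF js True]
        unfolding eps_coord_rho [OF perm_inv_range [OF "is" True]] eps_coord_rho [OF perm_inv_range [OF js True]]
        by (simp split: if_splits; presburger)
    next
      case False
      then show ?thesis using perm_inv_outside "is" js by simp
    qed
  qed
next
  assume eq: "perm_inv n is = perm_inv n js"
  have "weyl_word n is l j = weyl_word n js l j" for l j
  proof (cases "j \<in> {1..n}")
    case True
    show ?thesis
      by (rule eps_coord_inj [OF _ _ True]) (use n eps_coord_weyl_word [OF n] "is" js eq in auto)
  next
    case False
    then show ?thesis by (simp add: weyl_word_outside)
  qed
  then show "weyl_word n is = weyl_word n js" by blast
qed

subsection \<open>Exchange and reduced words\<close>

text \<open>\<open>root_match n v j i\<close> says that \<open>v\<close> maps the root \<open>\<alpha>\<^sub>j\<close> to \<open>\<alpha>\<^sub>i\<close>, either directly or as \<open>-\<epsilon>\<^sub>i\<^sub>+\<^sub>1\<close>, \<open>-\<epsilon>\<^sub>i\<close>.\<close>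

definition root_match :: "nat \<Rightarrow> (nat \<Rightarrow> nat) \<Rightarrow> nat \<Rightarrow> nat \<Rightarrow> bool" where
  "root_match n v j i \<longleftrightarrow> v j = i \<and> v (j + 1) = i + 1 \<or> v j + i = 2 * n + 1 \<and> v (j + 1) + i = 2 * n + 2"

text \<open>A simple reflection reverses the order of the pair (i, i+1) and of its mirror image. For
  i = n it also reverses (n, n+2), which the last hypothesis excludes.\<close>

lemma srefl_flip:
  assumes "i \<in> {1..n}" "a < b" "srefl n i b < srefl n i a" "a + b \<noteq> 2*n+2"
  shows "a = i \<and> b = i + 1 \<or> a + i = 2 * n + 1 \<and> b + i = 2 * n + 2"
  using assms by (cases "i < n") (auto simp: srefl_def split: if_splits)

lemma perm_inv_neq_mirror:
  assumes "set is \<subseteq> {1..n}" "j \<in> {1..n}"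
  shows "perm_inv n is j + perm_inv n is (j + 1) \<noteq> 2*n+2"
proof
  assume "perm_inv n is j + perm_inv n is (j + 1) = 2*n+2"
  moreover have "perm_inv n is j + perm_inv n is (2*n+2-j) = 2*n+2"
    using assms by (intro perm_inv_mirror) auto
  ultimately have "perm_inv n is (j + 1) = perm_inv n is (2*n+2-j)" by simp
  then have "j + 1 = 2*n+2-j" using inj_perm_inv [OF assms(1)] by (simp add: inj_def)
  then have "2 * j + 1 = 2*n+2" using assms(2) by auto
  then show False by presburger
qed

lemma perm_inv_neq: "set is \<subseteq> {1..n} \<Longrightarrow> perm_inv n is j \<noteq> perm_inv n is (j + 1)"
  using injD [OF inj_perm_inv, of "is" n j "j + 1"] by auto

text \<open>When the word is read from the left, the images of j and j+1 start in ascending order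
  and end in descending order; i is the letter at which they cross.\<close>

lemma exchange_position:
  assumes "set is \<subseteq> {1..n}" "j \<in> {1..n}" "perm_inv n is (j + 1) < perm_inv n is j"
  shows "\<exists>xs i ys. is = xs @ i # ys \<and> root_match n (perm_inv n xs) j i"
  using assms(1,3)
proof (induction "is" rule: rev_induct)
  case (snoc i "is")
  show ?case
  proof (cases "perm_inv n is (j + 1) < perm_inv n is j")
    case True
    with snoc obtain xs k ys where "is = xs @ k # ys" "root_match n (perm_inv n xs) j k" by auto
    then show ?thesis by (intro exI [of _ xs] exI [of _ k] exI [of _ "ys @ [i]"]) simp
  next
    case False
    let ?a = "perm_inv n is j" and ?b = "perm_inv n is (j + 1)"
    have "?a < ?b" using False perm_inv_neq [of "is" n j] snoc by auto
    moreover have "srefl n i ?b < srefl n i ?a" using snoc by (simp add: perm_inv_append perm_inv_Cons)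
    ultimately have "root_match n (perm_inv n is) j i"
      unfolding root_match_def using srefl_flip [of i n ?a ?b] perm_inv_neq_mirror [of "is" n j] snoc assms(2)
      by auto
    then show ?thesis by blast
  qed
qed simp

text \<open>The permutation form of the rule that conjugating a reflection by v gives the reflection
  in the image of its root under v.\<close>

lemma root_match_srefl:
  assumes xs: "set xs \<subseteq> {1..n}" and i: "i \<in> {1..n}" and j: "j \<in> {1..n}"
    and m: "root_match n (perm_inv n xs) j i"
  shows "srefl n i \<circ> perm_inv n xs = perm_inv n xs \<circ> srefl n j"
proof
  fix a
  let ?v = "perm_inv n xs"
  have inj: "?v b = ?v b' \<longleftrightarrow> b = b'" for b b' using inj_perm_inv [OF xs] by (auto simp: inj_def)
  have mir: "?v j + ?v b = 2*n+2" if "j + b = 2*n+2" for b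
    using j that by (intro perm_inv_mirror [OF xs]) auto
  have mir': "?v (j + 1) + ?v b = 2*n+2" if "j + b = 2*n+1" for b
    using j that by (intro perm_inv_mirror [OF xs]) auto
  have mid: "?v (n + 1) = n + 1" by (rule perm_inv_middle [OF xs])
  \<comment> \<open>Short and long simple roots are not mixed, because the middle index n+1 is
    fixed.\<close>
  have ji: "i = n \<longleftrightarrow> j = n"
  proof
    assume "i = n"
    with m have "?v (j + 1) = ?v (n + 1) \<or> ?v j = ?v (n + 1)" using mid by (auto simp: root_match_def)
    then show "j = n" using inj j by auto
  next
    assume "j = n"
    with m mid i show "i = n" by (auto simp: root_match_def)
  qed
  show "(srefl n i \<circ> ?v) a = (?v \<circ> srefl n j) a"
  proof (cases "i = n")
    case True
    then have jn: "j = n" using ji by simp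
    have vn: "?v n = n" "?v (n + 2) = n + 2"
      using m mir [of "n + 2"] mid True jn by (auto simp: root_match_def)
    have "?v a = n \<longleftrightarrow> a = n" "?v a = n + 2 \<longleftrightarrow> a = n + 2" using inj [of a n] inj [of a "n+2"] vn by auto
    then show ?thesis using True jn vn by (auto simp: srefl_def)
  next
    case False
    then have lt: "i < n" "j < n" using ji i j by auto
    define b b' where "b = 2*n+1-j" and "b' = 2*n+2-j"
    have b: "j + b = 2*n+1" "j + b' = 2*n+2" using lt by (auto simp: b_def b'_def)
    have eqs: "?v j = i \<and> ?v (j + 1) = i + 1 \<and> ?v b' + i = 2*n+2 \<and> ?v b + i = 2*n+1
      \<or> ?v j + i = 2*n+1 \<and> ?v (j + 1) + i = 2*n+2 \<and> ?v b' = i + 1 \<and> ?v b = i"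
      using m mir [OF b(2)] mir' [OF b(1)] lt unfolding root_match_def by linarith
    have jb: "srefl n j j = j + 1" "srefl n j (j + 1) = j" "srefl n j b = b'" "srefl n j b' = b"
      using lt b by (auto simp: srefl_def)
    have ib: "srefl n i i = i + 1" "srefl n i (i + 1) = i"
        "srefl n i (2*n+1-i) = 2*n+2-i" "srefl n i (2*n+2-i) = 2*n+1-i"
      using lt by (auto simp: srefl_def)
    from eqs consider
        (direct) "?v j = i" "?v (j + 1) = i + 1" "?v b = 2*n+1-i" "?v b' = 2*n+2-i"
      | (mirrored) "?v j = 2*n+1-i" "?v (j + 1) = 2*n+2-i" "?v b = i" "?v b' = i + 1"
      using lt by auto
    then have on: "srefl n i (?v a) = ?v (srefl n j a)" if "a \<in> {j, j + 1, b, b'}"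
    proof cases
      case direct
      show ?thesis using that by (elim insertE) (simp_all only: jb ib direct empty_iff)
    next
      case mirrored
      show ?thesis using that by (elim insertE) (simp_all only: jb ib mirrored empty_iff)
    qed
    consider "a \<in> {j, j + 1, b, b'}" | "a \<notin> {j, j + 1, b, b'}" by blast
    then show ?thesis
    proof cases
      case 1
      then show ?thesis using on by simp
    next
      case 2
      then have "?v a \<noteq> ?v j" "?v a \<noteq> ?v (j+1)" "?v a \<noteq> ?v b" "?v a \<noteq> ?v b'"
        unfolding inj by blast+
      then have "srefl n i (?v a) = ?v a" using eqs lt by (auto simp: srefl_def)
      moreover have "srefl n j a = a" using 2 b lt by (auto simp: srefl_def)
      ultimately show ?thesis by simp
    qed
  qed
qed

lemma perm_inv_exchange:
  assumes "set (xs @ i # ys) \<subseteq> {1..n}" "j \<in> {1..n}" "root_match n (perm_inv n xs) j i"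
  shows "perm_inv n (xs @ i # ys) = perm_inv n (j # xs @ ys)"
  using root_match_srefl [of xs n i j] assms
  by (simp add: perm_inv_append perm_inv_Cons comp_assoc)

lemma perm_inv_Cons_Cons: "j \<in> {1..n} \<Longrightarrow> perm_inv n (j # j # is) = perm_inv n is"
  by (simp add: perm_inv_Cons fun_eq_iff srefl_srefl)

text \<open>Phrased through permutations, where exchange is elementary;
  \<open>reduced_word_iff\<close> translates to reduced words in the Weyl group.\<close>

definition reduced :: "nat \<Rightarrow> nat list \<Rightarrow> bool" where
  "reduced n is \<longleftrightarrow> set is \<subseteq> {1..n} \<and>
     (\<forall>js. set js \<subseteq> {1..n} \<and> perm_inv n js = perm_inv n is \<longrightarrow> length is \<le> length js)"

lemma reducedD:
  "reduced n is \<Longrightarrow> set js \<subseteq> {1..n} \<Longrightarrow> perm_inv n js = perm_inv n is \<Longrightarrow> length is \<le> length js"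
  by (simp add: reduced_def)

lemma reduced_set: "reduced n is \<Longrightarrow> set is \<subseteq> {1..n}"
  by (simp add: reduced_def)

lemma reduced_append:
  assumes "reduced n (xs @ ys)" shows "reduced n xs" "reduced n ys"
proof -
  have sub: "set xs \<subseteq> {1..n}" "set ys \<subseteq> {1..n}" using reduced_set [OF assms] by simp_all
  have "length xs \<le> length js" if "set js \<subseteq> {1..n}" "perm_inv n js = perm_inv n xs" for js
    using reducedD [OF assms, of "js @ ys"] that sub by (simp add: perm_inv_append)
  then show "reduced n xs" using sub by (simp add: reduced_def)
  have "length ys \<le> length js" if "set js \<subseteq> {1..n}" "perm_inv n js = perm_inv n ys" for js
    using reducedD [OF assms, of "xs @ js"] that sub by (simp add: perm_inv_append)
  then show "reduced n ys" using sub by (simp add: reduced_def)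
qed

lemma reduced_Cons: "reduced n (i # is) \<Longrightarrow> reduced n is"
  using reduced_append(2) [of n "[i]" "is"] by simp

text \<open>Otherwise exchange would produce a word for \<open>j # is\<close> that is shorter by two
  letters.\<close>

lemma reduced_Cons_ascent:
  assumes "reduced n (j # is)" shows "perm_inv n is j < perm_inv n is (j + 1)"
proof (rule ccontr)
  have sub: "set is \<subseteq> {1..n}" "j \<in> {1..n}" using assms by (auto simp: reduced_def)
  assume "\<not> ?thesis"
  then have "perm_inv n is (j + 1) < perm_inv n is j" using perm_inv_neq [OF sub(1), of j] by linarith
  then obtain xs i ys where split: "is = xs @ i # ys" "root_match n (perm_inv n xs) j i"
    using exchange_position [OF sub] by blast
  have "perm_inv n is = perm_inv n (j # xs @ ys)"
    using perm_inv_exchange [of xs i ys n j] split sub by simp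
  then have "perm_inv n (j # is) = perm_inv n (xs @ ys)"
    using perm_inv_Cons_Cons [OF sub(2), of "xs @ ys"] by (simp add: perm_inv_Cons)
  then have "length (j # is) \<le> length (xs @ ys)"
    using reducedD [OF assms, of "xs @ ys"] sub split by simp
  then show False by (simp add: split)
qed

lemma perm_inv_Cons_descent:
  assumes "set is \<subseteq> {1..n}" "j \<in> {1..n}" "perm_inv n is j < perm_inv n is (j + 1)"
  shows "perm_inv n (j # is) (j + 1) < perm_inv n (j # is) j"
proof (cases "j = n")
  case True
  have "perm_inv n is n + perm_inv n is (n + 2) = 2*n+2"
    using assms(2) True by (intro perm_inv_mirror [OF assms(1)]) auto
  then show ?thesis
    using True assms perm_inv_middle [OF assms(1)] by (simp add: perm_inv_Cons srefl_def)
qed (use assms in \<open>auto simp: perm_inv_Cons srefl_def\<close>)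

text \<open>Any competitor for \<open>j # is\<close> has a descent at j, so exchange deletes one of
  its letters and yields a word for \<open>is\<close>.\<close>

lemma reduced_ConsI:
  assumes red: "reduced n is" and j: "j \<in> {1..n}" and asc: "perm_inv n is j < perm_inv n is (j + 1)"
  shows "reduced n (j # is)"
  unfolding reduced_def
proof (intro conjI allI impI)
  have sub: "set is \<subseteq> {1..n}" using red by (simp add: reduced_def)
  show "set (j # is) \<subseteq> {1..n}" using sub j by simp
  fix js
  assume js: "set js \<subseteq> {1..n} \<and> perm_inv n js = perm_inv n (j # is)"
  then have "perm_inv n js (j + 1) < perm_inv n js j" using perm_inv_Cons_descent [OF sub j asc] by simp
  then obtain xs i ys where split: "js = xs @ i # ys" "root_match n (perm_inv n xs) j i"
    using exchange_position [of js n j] js j by blast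
  have "perm_inv n (j # is) = perm_inv n (j # xs @ ys)"
    using perm_inv_exchange [of xs i ys n j] split js j by simp
  then have "perm_inv n (j # j # is) = perm_inv n (j # j # xs @ ys)" by (simp add: perm_inv_Cons)
  then have "perm_inv n is = perm_inv n (xs @ ys)" by (simp only: perm_inv_Cons_Cons [OF j])
  then have "length is \<le> length (xs @ ys)" using reducedD [OF red, of "xs @ ys"] split js by simp
  then show "length (j # is) \<le> length js" by (simp add: split)
qed

lemma reduced_exists:
  assumes "set is \<subseteq> {1..n}"
  shows "\<exists>js. reduced n js \<and> perm_inv n js = perm_inv n is"
proof -
  let ?P = "\<lambda>k. \<exists>js. set js \<subseteq> {1..n} \<and> perm_inv n js = perm_inv n is \<and> length js = k"
  have "?P (length is)" using assms by blast
  then have "?P (LEAST k. ?P k)" by (rule LeastI)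
  then obtain js where js: "set js \<subseteq> {1..n}" "perm_inv n js = perm_inv n is" "length js = (LEAST k. ?P k)"
    by blast
  have "length js \<le> length ks" if "set ks \<subseteq> {1..n}" "perm_inv n ks = perm_inv n js" for ks
    unfolding js(3) by (rule Least_le) (use that js in auto)
  then show ?thesis using js by (auto simp: reduced_def)
qed

lemma reduced_length_eq:
  "reduced n is \<Longrightarrow> reduced n js \<Longrightarrow> perm_inv n is = perm_inv n js \<Longrightarrow> length is = length js"
  by (metis le_antisym reducedD reduced_set)

lemma weyl_length_reduced:
  assumes n: "n \<ge> 2" and red: "reduced n is" shows "weyl_length n (weyl_word n is) = length is"
  unfolding weyl_length_def
proof (rule Least_equality)
  show "\<exists>isa. set isa \<subseteq> {1..n} \<and> length isa = length is \<and> weyl_word n isa = weyl_word n is"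
    using red by (auto simp: reduced_def)
  show "length is \<le> k" if "\<exists>isa. set isa \<subseteq> {1..n} \<and> length isa = k \<and> weyl_word n isa = weyl_word n is" for k
    using that red weyl_word_eq_iff [OF n] by (auto simp: reduced_def)
qed

lemma reduced_word_iff:
  assumes n: "n \<ge> 2" and red: "reduced n is"
  shows "reduced_word n (weyl_word n is) js \<longleftrightarrow> reduced n js \<and> perm_inv n js = perm_inv n is"
proof -
  have "set is \<subseteq> {1..n}" using red by (simp add: reduced_def)
  then show ?thesis
    unfolding reduced_word_def weyl_length_reduced [OF assms]
    using red weyl_word_eq_iff [OF n, of js "is"] reduced_length_eq [OF _ red]
    by (metis reduced_def)
qed

text \<open>The values decrease strictly from at most 2n+1 at index 1 to n+1 at index n+1, which
  takes n steps and leaves no slack.\<close>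

lemma all_descents_reversal:
  assumes "is": "set is \<subseteq> {1..n}" and desc: "\<And>j. j \<in> {1..n} \<Longrightarrow> perm_inv n is (j + 1) < perm_inv n is j"
    and a: "a \<in> {1..2*n+1}"
  shows "perm_inv n is a = 2*n+2 - a"
proof -
  let ?v = "perm_inv n is"
  have lower: "?v j \<ge> 2*n+2-j" if "1 \<le> j" "j \<le> n + 1" for j
    using that(2,1)
  proof (induction j rule: inc_induct)
    case base
    then show ?case using perm_inv_middle [OF "is"] by simp
  next
    case (step j)
    then show ?case using desc [of j] by auto
  qed
  have upper: "?v j \<le> 2*n+2-j" if "1 \<le> j" "j \<le> n + 1" for j
    using that
  proof (induction j rule: dec_induct)
    case base
    then show ?case using perm_inv_range [OF "is", of 1] by auto
  next
    case (step j)
    then show ?case using desc [of j] by auto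
  qed
  have eq: "?v j = 2*n+2-j" if "1 \<le> j" "j \<le> n + 1" for j using lower upper that by (simp add: le_antisym)
  show ?thesis
  proof (cases "a \<le> n + 1")
    case True
    then show ?thesis using eq a by simp
  next
    case False
    define b where "b = 2*n+2-a"
    have b: "1 \<le> b" "b \<le> n + 1" "b + a = 2*n+2" "1 \<le> a" using False a by (auto simp: b_def)
    show ?thesis using eq [OF b(1,2)] perm_inv_mirror [OF "is" b(1,4,3)] b by simp
  qed
qed

text \<open>A reduced word that admits no longer left extension has descents everywhere, hence the
  reversal as its permutation; this gives the uniqueness that \<open>THE\<close> asks for.\<close>

lemma longest_elem_reduced:
  assumes n: "n \<ge> 2" and red: "reduced n is"
    and rev: "\<And>a. a \<in> {1..2*n+1} \<Longrightarrow> perm_inv n is a = 2*n+2 - a"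
  shows "longest_elem n = weyl_word n is"
proof -
  have sub: "set is \<subseteq> {1..n}" using red by (simp add: reduced_def)
  have eq_is: "perm_inv n js = perm_inv n is"
    if js: "reduced n js" "\<And>j. j \<in> {1..n} \<Longrightarrow> \<not> reduced n (j # js)" for js
  proof
    fix a
    have sub': "set js \<subseteq> {1..n}" using js by (simp add: reduced_def)
    have "perm_inv n js (j + 1) < perm_inv n js j" if "j \<in> {1..n}" for j
      using reduced_ConsI [OF js(1) that] js(2) [OF that] perm_inv_neq [OF sub', of j] by linarith
    then have "perm_inv n js a = 2*n+2 - a" if "a \<in> {1..2*n+1}"
      by (rule all_descents_reversal [OF sub' _ that])
    then show "perm_inv n js a = perm_inv n is a"
      using rev [of a] perm_inv_outside [OF sub, of a] perm_inv_outside [OF sub', of a]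
      by (cases "a \<in> {1..2*n+1}") simp_all
  qed
  \<comment> \<open>The length of a reduced word is determined by its permutation, and there are
    finitely many permutations; hence the set of lengths is finite and has a maximum.\<close>
  define L where "L = {length js |js. reduced n js}"
  have "L \<subseteq> (\<lambda>p. LEAST k. \<exists>js. reduced n js \<and> perm_inv n js = p \<and> length js = k) `
    {p. p permutes {1..2*n+1}}"
  proof
    fix k assume "k \<in> L"
    then obtain js where js: "reduced n js" "length js = k" by (auto simp: L_def)
    then have sub': "set js \<subseteq> {1..n}" by (simp add: reduced_def)
    have "perm_inv n js permutes {1..2*n+1}"
    proof (rule inj_imp_permutes)
      show "inj_on (perm_inv n js) {1..2*n+1}" using inj_perm_inv [OF sub'] inj_on_subset by blast
    qed (use perm_inv_range [OF sub'] perm_inv_outside [OF sub'] in blast)+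
    moreover have "(LEAST k. \<exists>ks. reduced n ks \<and> perm_inv n ks = perm_inv n js \<and> length ks = k) = k"
      by (rule Least_equality) (use js reduced_length_eq [OF _ js(1)] in \<open>blast, metis order_refl\<close>)
    ultimately show "k \<in> (\<lambda>p. LEAST k. \<exists>js. reduced n js \<and> perm_inv n js = p \<and> length js = k) `
    {p. p permutes {1..2*n+1}}" by (auto intro!: image_eqI [of _ _ "perm_inv n js"])
  qed
  then have finL: "finite L" by (rule finite_subset) (intro finite_imageI finite_permutations finite_atLeastAtMost)
  have max: "length js \<le> length is \<and> (length js = length is \<longrightarrow> perm_inv n js = perm_inv n is)"
    if js: "reduced n js" for js
  proof -
    have "length is \<in> L" using red by (auto simp: L_def)
    then have "Max L \<in> L" using finL by (intro Max_in) auto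
    then obtain ks where ks: "reduced n ks" "length ks = Max L" by (auto simp: L_def)
    have "\<not> reduced n (j # ms)" if "length ms = Max L" for j ms
    proof
      assume "reduced n (j # ms)"
      then have "length (j # ms) \<in> L" unfolding L_def by blast
      from Max_ge [OF finL this] that show False by simp
    qed
    then have *: "perm_inv n ms = perm_inv n is" if "reduced n ms" "length ms = Max L" for ms
      using eq_is that by blast
    have "length is = Max L" using *[OF ks] reduced_length_eq [OF ks(1) red] ks by simp
    moreover have "length js \<le> Max L" using js finL by (intro Max_ge) (auto simp: L_def)
    ultimately show ?thesis using * js by simp
  qed
  have W: "\<exists>js. reduced n js \<and> w = weyl_word n js \<and> weyl_length n w = length js" if mem: "w \<in> weyl_group n" for w
  proof -
    obtain ks where ks: "set ks \<subseteq> {1..n}" "w = weyl_word n ks" using mem unfolding weyl_group_def by blast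
    obtain js where js: "reduced n js" "perm_inv n js = perm_inv n ks" using reduced_exists [OF ks(1)] by blast
    then have "weyl_word n js = w" using weyl_word_eq_iff [OF n] ks by (simp add: reduced_def)
    then show ?thesis using js weyl_length_reduced [OF n js(1)] by auto
  qed
  have "is": "weyl_word n is \<in> weyl_group n" "weyl_length n (weyl_word n is) = length is"
    using sub weyl_length_reduced [OF n red] by (auto simp: weyl_group_def)
  have is_max: "weyl_length n v \<le> length is" if v: "v \<in> weyl_group n" for v
  proof -
    obtain js where "reduced n js" "weyl_length n v = length js" using W [OF v] by blast
    then show ?thesis using max by simp
  qed
  show ?thesis unfolding longest_elem_def
  proof (rule the_equality)
    show "weyl_word n is \<in> weyl_group n \<and> (\<forall>v\<in>weyl_group n. weyl_length n v \<le> weyl_length n (weyl_word n is))"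
      using "is" is_max by simp
    fix w assume w: "w \<in> weyl_group n \<and> (\<forall>v\<in>weyl_group n. weyl_length n v \<le> weyl_length n w)"
    then obtain js where js: "reduced n js" "w = weyl_word n js" "weyl_length n w = length js" using W by blast
    have "length is \<le> length js" using w "is" js(3) by metis
    then have "perm_inv n js = perm_inv n is" using max [OF js(1)] by simp
    then show "w = weyl_word n is" using js sub weyl_word_eq_iff [OF n] by (simp add: reduced_def)
  qed
qed

subsection \<open>The word \<open>(1 2 \<dots> n)\<^sup>n\<close>\<close>

text \<open>Closed form of the permutation of the word j, ..., n: it sends j to the negative index
  n+2, lowers j+1, ..., n by one and acts on the mirrored half accordingly.\<close>

definition cycle_inv :: "nat \<Rightarrow> nat \<Rightarrow> nat \<Rightarrow> nat" where
  "cycle_inv n j a = (if a < j \<or> a = n + 1 \<or> 2*n+2 < a + j then a else if a = j then n + 2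
     else if a \<le> n then a - 1 else if a + j = 2*n+2 then n else a + 1)"

lemma perm_inv_upt: "j \<le> n \<Longrightarrow> 1 \<le> j \<Longrightarrow> perm_inv n [j..<Suc n] = cycle_inv n j"
proof (induction j rule: inc_induct)
  case base
  then show ?case by (auto simp: perm_inv_Cons srefl_def cycle_inv_def fun_eq_iff)
next
  case (step j)
  have "[j..<Suc n] = j # [Suc j..<Suc n]" using step by (simp add: upt_conv_Cons del: upt_Suc)
  then have "perm_inv n [j..<Suc n] = cycle_inv n (Suc j) \<circ> srefl n j"
    using step by (simp add: perm_inv_Cons del: upt_Suc)
  also have "\<dots> = cycle_inv n j"
  proof
    fix a
    consider "a < j" | "a = j" | "a = Suc j" | "Suc j < a" "a \<le> n" | "a = n + 1"
      | "n + 1 < a" "a + j < 2*n+1" | "a + j = 2*n+1" | "a + j = 2*n+2" | "2*n+2 < a + j" by linarith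
    then show "(cycle_inv n (Suc j) \<circ> srefl n j) a = cycle_inv n j a"
      using step(1,2) by cases (auto simp: srefl_def cycle_inv_def)
  qed
  finally show ?case .
qed

definition coxeter_word :: "nat \<Rightarrow> nat \<Rightarrow> nat list" where
  "coxeter_word n m = concat (replicate m [1..<Suc n])"

lemma coxeter_word_Suc: "coxeter_word n (Suc m) = [1..<Suc n] @ coxeter_word n m"
  by (simp add: coxeter_word_def)

text \<open>Each pass of 1, ..., n sends index 1 to n+2, lowers the other positive indices and
  pushes the earlier images further up; after n passes all signs are reversed.\<close>

lemma perm_inv_coxeter_word:
  assumes "n \<ge> 1" "m \<le> n" "1 \<le> a" "a \<le> n"
  shows "perm_inv n (coxeter_word n m) a = (if a \<le> m then n + 2 + (m - a) else a - m)"
  using assms(2-4)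
proof (induction m arbitrary: a)
  case 0
  then show ?case by (simp add: coxeter_word_def)
next
  case (Suc m)
  have sub: "set (coxeter_word n m) \<subseteq> {1..n}" by (auto simp: coxeter_word_def)
  have c: "perm_inv n (coxeter_word n (Suc m)) a = perm_inv n (coxeter_word n m) (cycle_inv n 1 a)"
    using perm_inv_upt [of 1 n] assms(1) by (simp add: coxeter_word_Suc perm_inv_append del: upt_Suc)
  show ?case
  proof (cases "a = 1")
    case True
    have "perm_inv n (coxeter_word n m) n + perm_inv n (coxeter_word n m) (n + 2) = 2*n+2"
      by (rule perm_inv_mirror [OF sub]) (use assms in auto)
    moreover have "perm_inv n (coxeter_word n m) n = n - m" using Suc.IH [of n] Suc.prems assms(1) by auto
    ultimately show ?thesis unfolding c using True Suc.prems assms(1) by (simp add: cycle_inv_def)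
  next
    case False
    then show ?thesis using Suc.prems Suc.IH [of "a - 1"] by (auto simp: c cycle_inv_def)
  qed
qed

text \<open>Letters are prepended one at a time, and the explicit permutations show that each of
  them is an ascent.\<close>

lemma reduced_coxeter_word:
  assumes n: "n \<ge> 1" shows "m \<le> n \<Longrightarrow> reduced n (coxeter_word n m)"
proof (induction m)
  case 0
  then show ?case by (simp add: coxeter_word_def reduced_def)
next
  case (Suc m)
  let ?w = "coxeter_word n m"
  have sub: "set ?w \<subseteq> {1..n}" by (auto simp: coxeter_word_def)
  have "reduced n ([j..<Suc n] @ ?w)" if "j \<le> Suc n" "1 \<le> j" for j
    using that
  proof (induction j rule: inc_induct)
    case base
    then show ?case using Suc by simp
  next
    case (step j)
    let ?u = "[Suc j..<Suc n] @ ?w"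
    have "perm_inv n ?u j < perm_inv n ?u (j + 1)"
    proof (cases "j = n")
      case True
      then show ?thesis
        using perm_inv_coxeter_word [OF n, of m n] perm_inv_middle [OF sub] Suc.prems n by simp
    next
      case False
      have "perm_inv n ?w n + perm_inv n ?w (n + 2) = 2*n+2"
        by (rule perm_inv_mirror [OF sub]) (use n in auto)
      moreover have "perm_inv n ?w n = n - m" using perm_inv_coxeter_word [OF n, of m n] Suc.prems n by auto
      moreover have "perm_inv n ?w j < n + 2 + m"
        using perm_inv_coxeter_word [OF n, of m j] Suc.prems step False by auto
      ultimately show ?thesis
        using False step Suc.prems perm_inv_upt [of "Suc j" n]
        by (simp add: perm_inv_append cycle_inv_def del: upt_Suc)
    qed
    then have "reduced n (j # ?u)" using step by (intro reduced_ConsI) auto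
    then show ?case using step by (simp add: upt_conv_Cons del: upt_Suc)
  qed
  from this [of 1] show ?case by (simp add: coxeter_word_Suc del: upt_Suc)
qed

text \<open>With m = n+1-k passes, index 2n+1 is matched with k. This is why the last row of the
  product of the blocks k, ..., n shows row k of the right unipotent factor.\<close>

lemma perm_inv_coxeter_word_last:
  assumes "m \<ge> 1" "k \<ge> 1" "m + k = n + 1"
  shows "perm_inv n (coxeter_word n m) (2*n+1) = k"
proof -
  have sub: "set (coxeter_word n m) \<subseteq> {1..n}" by (auto simp: coxeter_word_def)
  have "perm_inv n (coxeter_word n m) 1 + perm_inv n (coxeter_word n m) (2*n+1) = 2*n+2"
    by (rule perm_inv_mirror [OF sub]) auto
  moreover have "perm_inv n (coxeter_word n m) 1 = n + 2 + (m - 1)"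
    using perm_inv_coxeter_word [of n m 1] assms by auto
  ultimately show ?thesis using assms by simp
qed

lemma longest_elem_coxeter_word:
  assumes n: "n \<ge> 2" shows "longest_elem n = weyl_word n (coxeter_word n n)"
proof (rule longest_elem_reduced [OF n])
  show "reduced n (coxeter_word n n)" using reduced_coxeter_word n by simp
  have sub: "set (coxeter_word n n) \<subseteq> {1..n}" by (auto simp: coxeter_word_def)
  show "perm_inv n (coxeter_word n n) a = 2*n+2-a" if "a \<in> {1..2*n+1}" for a
  proof (rule all_descents_reversal [OF sub _ that])
    fix j assume "j \<in> {1..n}"
    then show "perm_inv n (coxeter_word n n) (j + 1) < perm_inv n (coxeter_word n n) j"
      using perm_inv_coxeter_word [of n n j] perm_inv_coxeter_word [of n n "j + 1"]
        perm_inv_middle [OF sub] by (cases "j = n") auto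
  qed
qed

section \<open>Chevalley generators and the opposite system\<close>

text \<open>The Serre relations are left out: in finite dimension they follow from the others.\<close>

locale chevalley_system =
  fixes n :: nat and e f h :: "nat \<Rightarrow> 'd::finite cmat"
  assumes hh: "i \<in> {1..n} \<Longrightarrow> j \<in> {1..n} \<Longrightarrow> h i ** h j = h j ** h i"
    and ef: "i \<in> {1..n} \<Longrightarrow> j \<in> {1..n} \<Longrightarrow> e i ** f j - f j ** e i = (if i = j then h i else 0)"
    and he: "i \<in> {1..n} \<Longrightarrow> j \<in> {1..n} \<Longrightarrow>
      h i ** e j - e j ** h i = cscale (of_int (cartan_B n i j)) (e j)"
    and hf: "i \<in> {1..n} \<Longrightarrow> j \<in> {1..n} \<Longrightarrow>
      h i ** f j - f j ** h i = - cscale (of_int (cartan_B n i j)) (f j)"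
begin

lemma sl2: "i \<in> {1..n} \<Longrightarrow> sl2_triple (e i) (f i) (h i)"
  using ef [of i i] he [of i i] hf [of i i] by unfold_locales (simp_all add: cartan_B_def)

lemma sbar_refl: "i \<in> {1..n} \<Longrightarrow> sbar e f i = sl2_triple.refl (e i) (f i) (- 1)"
  by (simp add: sbar_def sl2_triple.refl_def [OF sl2])

text \<open>The Chevalley involution composed with \<open>-1\<close> on root vectors fixes every \<open>sbar\<close>; it turns
  statements about positive root subgroups into statements about negative ones.\<close>

lemma opposite: "chevalley_system n (\<lambda>i. - f i) (\<lambda>i. - e i) (\<lambda>i. - h i)"
proof
  fix i j assume ij: "i \<in> {1..n}" "j \<in> {1..n}"
  show "- h i ** - h j = - h j ** - h i" using hh [OF ij] by (simp add: mat_algebra)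
  show "- f i ** - e j - - e j ** - f i = (if i = j then - h i else 0)"
    using ef [OF ij(2,1)] by (auto simp: mat_algebra algebra_simps)
  show "- h i ** - f j - - f j ** - h i = cscale (of_int (cartan_B n i j)) (- f j)"
    using hf [OF ij] by (simp add: mat_algebra)
  show "- h i ** - e j - - e j ** - h i = - cscale (of_int (cartan_B n i j)) (- e j)"
    using he [OF ij] by (simp add: mat_algebra)
qed

lemma sbar_opposite:
  assumes "i \<in> {1..n}" shows "sbar (\<lambda>i. - f i) (\<lambda>i. - e i) i = sbar e f i"
proof -
  interpret sl2_triple "e i" "f i" "h i" by (rule sl2 [OF assms])
  show ?thesis using refl_alt [of "-1"] sbar_refl [OF assms] by (simp add: sbar_def one_param_uminus)
qed

end

subsection \<open>The vector representation\<close>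

text \<open>Since n is not fixed by a type, the matrices are indexed by any sufficiently large
  finite type, enumerated by \<open>\<iota>\<close>; the indices beyond 2n+1 span a trivial
  summand.\<close>

locale vector_rep =
  fixes n :: nat and \<iota> :: "nat \<Rightarrow> 'm::finite"
  assumes bij: "bij_betw \<iota> {1..CARD('m)} UNIV" and size: "2 * n + 1 \<le> CARD('m)" and n_pos: "n \<ge> 1"
begin

definition idx :: "'m \<Rightarrow> nat" where "idx = the_inv_into {1..CARD('m)} \<iota>"

lemma idx_\<iota> [simp]: "a \<in> {1..CARD('m)} \<Longrightarrow> idx (\<iota> a) = a"
  using bij unfolding idx_def bij_betw_def by (auto intro: the_inv_into_f_f)

lemma \<iota>_idx [simp]: "\<iota> (idx r) = r"
  using bij unfolding idx_def bij_betw_def by (auto intro: f_the_inv_into_f)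

lemma idx_range: "idx r \<in> {1..CARD('m)}"
  using bij the_inv_into_into [of \<iota> "{1..CARD('m)}" r, OF _ _ order_refl]
  unfolding idx_def bij_betw_def by auto

lemma \<iota>_eq_iff: "a \<in> {1..CARD('m)} \<Longrightarrow> b \<in> {1..CARD('m)} \<Longrightarrow> \<iota> a = \<iota> b \<longleftrightarrow> a = b"
  by (metis idx_\<iota>)

lemma idx_inj: "idx r = idx s \<longleftrightarrow> r = s"
  by (metis \<iota>_idx)

lemma idx_eq_iff: "a \<in> {1..CARD('m)} \<Longrightarrow> idx r = a \<longleftrightarrow> r = \<iota> a"
  by auto

definition el :: "nat \<Rightarrow> nat \<Rightarrow> 'm cmat" where
  "el a b = (\<chi> r s. if r = \<iota> a \<and> s = \<iota> b then 1 else 0)"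

lemma el_nth: "el a b $ r $ s = (if r = \<iota> a \<and> s = \<iota> b then 1 else 0)"
  by (simp add: el_def)

lemma mul_el_nth: "(A ** el a b) $ r $ s = (if s = \<iota> b then A $ r $ \<iota> a else 0)"
  by (auto simp: mmul_nth el_nth if_distrib [of "\<lambda>z. _ * z"] cong: if_cong)

lemma el_mul_nth: "(el a b ** A) $ r $ s = (if r = \<iota> a then A $ \<iota> b $ s else 0)"
  by (auto simp: mmul_nth el_nth if_distrib [of "\<lambda>z. z * _"] cong: if_cong)

lemma el_mul: "b \<in> {1..CARD('m)} \<Longrightarrow> c \<in> {1..CARD('m)} \<Longrightarrow> el a b ** el c d = (if b = c then el a d else 0)"
  by (auto simp: vec_eq_iff mul_el_nth el_nth \<iota>_eq_iff)

definition diagm :: "(nat \<Rightarrow> complex) \<Rightarrow> 'm cmat" where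
  "diagm d = (\<chi> r s. if r = s then d (idx r) else 0)"

lemma diagm_nth: "diagm d $ r $ s = (if r = s then d (idx r) else 0)"
  by (simp add: diagm_def)

lemma diagm_mul_nth: "(diagm d ** A) $ r $ s = d (idx r) * A $ r $ s"
  by (simp add: mmul_nth diagm_nth if_distrib [of "\<lambda>z. z * _"] cong: if_cong)

lemma mul_diagm_nth: "(A ** diagm d) $ r $ s = A $ r $ s * d (idx s)"
  by (simp add: mmul_nth diagm_nth if_distrib [of "\<lambda>z. _ * z"] cong: if_cong)

lemma diagm_el:
  "a \<in> {1..CARD('m)} \<Longrightarrow> diagm d ** el a b = cscale (d a) (el a b)"
  "b \<in> {1..CARD('m)} \<Longrightarrow> el a b ** diagm d = cscale (d b) (el a b)"
  by (auto simp: vec_eq_iff diagm_mul_nth mul_diagm_nth el_nth)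

text \<open>The factor 2 reflects that the short simple coroot takes the values 2, 0, -2. It is
  split unevenly between \<open>E n\<close> and \<open>F n\<close> so that the entry (i, i+1) of
  every \<open>E i\<close> is 1 and x_i(t) shows exactly t there.\<close>

definition kap :: "nat \<Rightarrow> complex" where "kap i = (if i = n then 2 else 1)"

definition wt :: "nat \<Rightarrow> nat \<Rightarrow> int" where
  "wt i a = (if i = n then 2 else 1) * ((if a = i then 1 else 0) - (if a = i + 1 then 1 else 0)
     + (if a + i = 2*n+1 then 1 else 0) - (if a + i = 2*n+2 then 1 else 0))"

definition E :: "nat \<Rightarrow> 'm cmat" where
  "E i = el i (i + 1) + cscale (kap i) (el (2*n+1-i) (2*n+2-i))"

definition F :: "nat \<Rightarrow> 'm cmat" where
  "F i = cscale (kap i) (el (i + 1) i) + el (2*n+2-i) (2*n+1-i)"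

definition H :: "nat \<Rightarrow> 'm cmat" where
  "H i = diagm (\<lambda>a. of_int (wt i a))"

lemma range: "a \<ge> 1 \<Longrightarrow> a \<le> 2*n+1 \<Longrightarrow> a \<in> {1..CARD('m)}"
  using size by auto

lemma index_range:
  assumes "i \<in> {1..n}"
  shows "i \<in> {1..CARD('m)}" "i + 1 \<in> {1..CARD('m)}" "2*n+1-i \<in> {1..CARD('m)}" "2*n+2-i \<in> {1..CARD('m)}"
  using assms size by auto

lemma wt_diff:
  assumes "i \<in> {1..n}" "j \<in> {1..n}"
  shows "wt i j - wt i (j + 1) = cartan_B n i j" "wt i (2*n+1-j) - wt i (2*n+2-j) = cartan_B n i j"
proof -
  show "wt i j - wt i (j + 1) = cartan_B n i j" using assms by (auto simp: wt_def cartan_B_def)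
  define a b where "a = 2*n+1-j" and "b = 2*n+2-j"
  have "a + j = 2*n+1" "b + j = 2*n+2" "b = a + 1" using assms by (auto simp: a_def b_def)
  then show "wt i (2*n+1-j) - wt i (2*n+2-j) = cartan_B n i j"
    unfolding a_def [symmetric] b_def [symmetric] using assms by (auto simp: wt_def cartan_B_def)
qed

lemma chevalley: "chevalley_system n E F H"
proof
  fix i j assume ij: "i \<in> {1..n}" "j \<in> {1..n}"
  have r: "i \<in> {1..CARD('m)}" "j \<in> {1..CARD('m)}" "i + 1 \<in> {1..CARD('m)}" "j + 1 \<in> {1..CARD('m)}"
     "2*n+1-i \<in> {1..CARD('m)}" "2*n+2-i \<in> {1..CARD('m)}" "2*n+1-j \<in> {1..CARD('m)}" "2*n+2-j \<in> {1..CARD('m)}"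
    using index_range ij by blast+
  show "H i ** H j = H j ** H i" by (simp add: H_def vec_eq_iff diagm_mul_nth diagm_nth)
  define j1 a b where "j1 = j + 1" and "a = 2*n+1-j" and "b = 2*n+2-j"
  have rab: "j1 \<in> {1..CARD('m)}" "a \<in> {1..CARD('m)}" "b \<in> {1..CARD('m)}"
    using r unfolding j1_def a_def b_def by blast+
  have w0: "wt i j = cartan_B n i j + wt i j1" "wt i a = cartan_B n i j + wt i b"
    using wt_diff [OF ij] unfolding j1_def a_def b_def by linarith+
  have w: "of_int (wt i j) = of_int (cartan_B n i j) + (of_int (wt i j1) :: complex)"
    "of_int (wt i a) = of_int (cartan_B n i j) + (of_int (wt i b) :: complex)"
    using w0 by simp_all
  have Ej: "E j = el j j1 + cscale (kap j) (el a b)" and Fj: "F j = cscale (kap j) (el j1 j) + el b a"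
    by (simp_all add: E_def F_def j1_def a_def b_def)
  show "H i ** E j - E j ** H i = cscale (of_int (cartan_B n i j)) (E j)"
    using r(2) rab by (simp add: H_def Ej mat_algebra diagm_el w) (simp add: vec_eq_iff algebra_simps)
  show "H i ** F j - F j ** H i = - cscale (of_int (cartan_B n i j)) (F j)"
    using r(2) rab by (simp add: H_def Fj mat_algebra diagm_el w) (simp add: vec_eq_iff algebra_simps)
  show "E i ** F j - F j ** E i = (if i = j then H i else 0)"
  proof (cases "i = j")
    case False
    have "i + 1 \<noteq> 2*n+2-j" "2*n+2-i \<noteq> j + 1" "2*n+2-i \<noteq> 2*n+2-j" "j \<noteq> 2*n+1-i" "2*n+1-j \<noteq> i"
      "2*n+1-j \<noteq> 2*n+1-i"
      using ij False by auto
    then show ?thesis using False r by (simp add: E_def F_def mat_algebra el_mul)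
  next
    case True
    have "i + 1 \<noteq> 2*n+2-i" "2*n+2-i \<noteq> i + 1" "i \<noteq> 2*n+1-i" "2*n+1-i \<noteq> i" using ij by auto
    then have "E i ** F i - F i ** E i = cscale (kap i) (el i i - el (i + 1) (i + 1)
        + el (2*n+1-i) (2*n+1-i) - el (2*n+2-i) (2*n+2-i))"
      using r by (simp add: E_def F_def mat_algebra el_mul)
    also have "\<dots> = H i"
    proof -
      define a b where "a = 2*n+1-i" and "b = 2*n+2-i"
      have ab: "a \<in> {1..CARD('m)}" "b \<in> {1..CARD('m)}" using r by (simp_all add: a_def b_def)
      have ab': "idx p + i = 2*n+1 \<longleftrightarrow> p = \<iota> a" "idx p + i = 2*n+2 \<longleftrightarrow> p = \<iota> b" for p
      proof -
        have "idx p + i = 2*n+1 \<longleftrightarrow> idx p = a" "idx p + i = 2*n+2 \<longleftrightarrow> idx p = b"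
          using ij unfolding a_def b_def by auto
        then show "idx p + i = 2*n+1 \<longleftrightarrow> p = \<iota> a" "idx p + i = 2*n+2 \<longleftrightarrow> p = \<iota> b"
          by (simp_all only: idx_eq_iff ab)
      qed
      have i': "idx p = i \<longleftrightarrow> p = \<iota> i" "idx p = i + 1 \<longleftrightarrow> p = \<iota> (i + 1)" for p
        using r by (simp_all only: idx_eq_iff)
      have "(el i i - el (i + 1) (i + 1) + el a a - el b b) $ p $ q
          = (if p = q then of_int ((if idx p = i then 1 else 0) - (if idx p = i + 1 then 1 else 0)
             + (if idx p + i = 2*n+1 then 1 else 0) - (if idx p + i = 2*n+2 then 1 else 0)) else 0)" for p q
        unfolding ab' i' by (simp add: el_nth)
      then show ?thesis unfolding a_def [symmetric] b_def [symmetric] vec_eq_iff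
        by (simp add: H_def diagm_nth wt_def kap_def)
    qed
    finally show ?thesis using True by simp
  qed
qed

lemma E_sq: "i \<in> {1..n} \<Longrightarrow> E i ** E i = (if i = n then cscale 2 (el n (n + 2)) else 0)"
proof -
  assume i: "i \<in> {1..n}"
  have r: "i \<in> {1..CARD('m)}" "i + 1 \<in> {1..CARD('m)}" "2*n+1-i \<in> {1..CARD('m)}" "2*n+2-i \<in> {1..CARD('m)}"
    using index_range [OF i] by blast+
  have "i + 1 = 2*n+1-i \<longleftrightarrow> i = n" "i + 1 \<noteq> i" "2*n+2-i \<noteq> i" "2*n+2-i \<noteq> 2*n+1-i" using i by auto
  then show ?thesis using r by (auto simp: E_def mat_algebra el_mul kap_def)
qed

lemma F_sq: "i \<in> {1..n} \<Longrightarrow> F i ** F i = (if i = n then cscale 2 (el (n + 2) n) else 0)"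
proof -
  assume i: "i \<in> {1..n}"
  have r: "i \<in> {1..CARD('m)}" "i + 1 \<in> {1..CARD('m)}" "2*n+1-i \<in> {1..CARD('m)}" "2*n+2-i \<in> {1..CARD('m)}"
    using index_range [OF i] by blast+
  have "2*n+1-i = i + 1 \<longleftrightarrow> i = n" "i + 1 \<noteq> i" "i \<noteq> 2*n+2-i" "2*n+2-i \<noteq> 2*n+1-i" "2*n+1-i \<noteq> 2*n+2-i" using i by auto
  then show ?thesis using r by (auto simp: F_def mat_algebra el_mul kap_def)
qed

lemma E_cube: assumes "i \<in> {1..n}" shows "E i ** (E i ** E i) = 0"
proof (cases "i = n")
  case True
  have "n \<in> {1..CARD('m)}" "n + 1 \<in> {1..CARD('m)}" "n + 2 \<in> {1..CARD('m)}" "2*n+1-n = n+1" "2*n+2-n = n+2"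
    using size n_pos by auto
  then show ?thesis unfolding E_sq [OF assms] using True by (simp add: E_def mat_algebra el_mul)
qed (use assms in \<open>simp add: E_sq\<close>)

lemma F_cube: assumes "i \<in> {1..n}" shows "F i ** (F i ** F i) = 0"
proof (cases "i = n")
  case True
  have "n \<in> {1..CARD('m)}" "n + 1 \<in> {1..CARD('m)}" "n + 2 \<in> {1..CARD('m)}" "2*n+1-n = n+1" "2*n+2-n = n+2"
    using size n_pos by auto
  then show ?thesis unfolding F_sq [OF assms] using True by (simp add: F_def mat_algebra el_mul)
qed (use assms in \<open>simp add: F_sq\<close>)

end

section \<open>Simple reflections as signed permutation matrices of the vector
  representation\<close>

lemma one_param_nilpotent:
  fixes A :: "'d::finite cmat"
  assumes "A ** (A ** A) = 0"
  shows "one_param A t = mat 1 + cscale t A + cscale (t\<^sup>2 / 2) (A ** A)"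
proof -
  define G where "G t = mat 1 + cscale t A + cscale (t\<^sup>2 / 2) (A ** A)" for t
  have "has_mderiv G (A + cscale t (A ** A)) t" for t
  proof -
    have "((\<lambda>t. t\<^sup>2 / 2) has_field_derivative t) (at t)"
      by (auto intro!: derivative_eq_intros)
    from has_mderiv_add [OF has_mderiv_add [OF has_mderiv_const [of "mat 1"] has_mderiv_cscale [OF DERIV_ident, of A]]
      has_mderiv_cscale [OF this, of "A ** A"]] show ?thesis unfolding G_def by simp
  qed
  moreover have "A + cscale t (A ** A) = A ** G t" for t
    using assms by (simp add: G_def mat_algebra)
  ultimately have "has_mderiv G (A ** G t) t" for t by metis
  from one_param_ode_left [OF this, of t] show ?thesis by (simp add: G_def)
qed

text \<open>For \<open>v = w\<^sup>-\<^sup>1\<close>, the sign with which the inverse of the lift of \<open>w\<close> maps the \<open>a\<close>-th basis vector of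
  the vector representation to a multiple of the \<open>v a\<close>-th one.\<close>

definition inv_sign :: "nat \<Rightarrow> (nat \<Rightarrow> nat) \<Rightarrow> nat \<Rightarrow> complex" where
  "inv_sign n v a = (\<Prod>d\<in>{a<..2*n+1}. if v d < v a then - 1 else 1)"

text \<open>The signs of the columns of the matrix of \<open>sbar_inv\<close> in the vector
  representation, see \<open>sbar_inv_smat\<close>.\<close>

definition refl_sign :: "nat \<Rightarrow> nat \<Rightarrow> nat \<Rightarrow> complex" where
  "refl_sign n i a = (if (if i < n then a = i \<or> a + i = 2*n+1 else a = n + 1) then - 1 else 1)"

lemma inv_sign_sq: "inv_sign n v a * inv_sign n v a = 1"
  unfolding inv_sign_def prod.distrib [symmetric] by (rule prod.neutral) auto

text \<open>The reflection permutes the indices above a unless a separates a pair that it swaps; the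
  hypothesis rules out exactly these a.\<close>

lemma prod_srefl:
  assumes i: "i \<in> {1..n}" and a: "if i < n then a \<noteq> i \<and> a + i \<noteq> 2*n+1 else a \<noteq> n \<and> a \<noteq> n + 1"
  shows "(\<Prod>d\<in>{a<..2*n+1}. g (srefl n i d)) = (\<Prod>d\<in>{a<..2*n+1}. g d :: complex)"
proof -
  have "srefl n i d \<in> {a<..2*n+1}" if "d \<in> {a<..2*n+1}" for d
    using that i a by (cases "i < n") (auto simp: srefl_def)
  then show ?thesis
    by (intro prod.reindex_bij_witness [where i = "srefl n i" and j = "srefl n i"])
      (simp_all add: srefl_srefl [OF i])
qed

text \<open>\<open>inv_sign\<close> is the parity of the inversions of v that start at a. By the
  ascent, the new letter creates inversions only among the swapped indices and their neighbours in
  the middle, and their parity is \<open>refl_sign\<close>.\<close>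

lemma inv_sign_Cons:
  assumes "is": "set is \<subseteq> {1..n}" and i: "i \<in> {1..n}"
    and asc: "perm_inv n is i < perm_inv n is (i + 1)"
  shows "inv_sign n (perm_inv n (i # is)) a = refl_sign n i a * inv_sign n (perm_inv n is) (srefl n i a)"
proof -
  let ?v = "perm_inv n is" and ?s = "srefl n i"
  let ?g = "\<lambda>x d. if ?v d < ?v x then - 1 else (1::complex)"
  have v': "inv_sign n (perm_inv n (i # is)) a = (\<Prod>d\<in>{a<..2*n+1}. ?g (?s a) (?s d))"
    by (simp add: inv_sign_def perm_inv_Cons)
  have insert: "(\<Prod>d\<in>{b<..2*n+1}. p d) = p (b + 1) * (\<Prod>d\<in>{b + 1<..2*n+1}. p d)"
    if "b + 1 \<le> 2*n+1" for b and p :: "nat \<Rightarrow> complex"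
  proof -
    have "{b<..2*n+1} = insert (b + 1) {b + 1<..2*n+1}" using that by auto
    then show ?thesis by simp
  qed
  show ?thesis
  proof (cases "i < n")
    case lt: True
    define b where "b = 2*n+1-i"
    have b: "b + i = 2*n+1" "b > i + 1" using lt by (auto simp: b_def)
    have s: "?s i = i + 1" "?s (i + 1) = i" "?s b = b + 1" "?s (b + 1) = b"
      using lt b by (auto simp: srefl_def)
    have "?v i + ?v (b + 1) = 2*n+2" "?v (i + 1) + ?v b = 2*n+2"
      by (rule perm_inv_mirror [OF "is"]; use b i in force)+
    then have asc': "?v b < ?v (b + 1)" using asc by linarith
    consider (1) "a = i" | (2) "a = b" | (3) "a = i + 1 \<or> a = b + 1" | (4) "a \<notin> {i, i + 1, b, b + 1}"
      by blast
    then show ?thesis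
    proof cases
      case 1
      have "(\<Prod>d\<in>{i<..2*n+1}. ?g (i + 1) (?s d)) = - 1 * (\<Prod>d\<in>{i + 1<..2*n+1}. ?g (i + 1) (?s d))"
        using insert [of i] lt asc s by simp
      also have "(\<Prod>d\<in>{i + 1<..2*n+1}. ?g (i + 1) (?s d)) = (\<Prod>d\<in>{i + 1<..2*n+1}. ?g (i + 1) d)"
        by (rule prod_srefl [OF i]) (use lt b in auto)
      finally show ?thesis unfolding v' using 1 s lt by (simp add: refl_sign_def inv_sign_def)
    next
      case 2
      have "(\<Prod>d\<in>{b<..2*n+1}. ?g (b + 1) (?s d)) = - 1 * (\<Prod>d\<in>{b + 1<..2*n+1}. ?g (b + 1) (?s d))"
        using insert [of b] b i asc' s by simp
      also have "(\<Prod>d\<in>{b + 1<..2*n+1}. ?g (b + 1) (?s d)) = (\<Prod>d\<in>{b + 1<..2*n+1}. ?g (b + 1) d)"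
        by (rule prod_srefl [OF i]) (use lt b in auto)
      finally show ?thesis unfolding v' using 2 s lt b by (simp add: refl_sign_def inv_sign_def)
    next
      case 3
      define c where "c = a - 1"
      have c: "a = c + 1" "c = i \<or> c = b" using 3 by (auto simp: c_def)
      have "(\<Prod>d\<in>{a<..2*n+1}. ?g c (?s d)) = (\<Prod>d\<in>{a<..2*n+1}. ?g c d)"
        by (rule prod_srefl [OF i]) (use lt b c in auto)
      also have "\<dots> = inv_sign n ?v c"
        using insert [of c "?g c"] c b i lt asc asc' unfolding inv_sign_def by auto
      finally show ?thesis unfolding v' using c s lt b by (auto simp: refl_sign_def)
    next
      case 4
      have "?s a = a" using 4 lt b by (auto simp: srefl_def)
      moreover have "(\<Prod>d\<in>{a<..2*n+1}. ?g a (?s d)) = (\<Prod>d\<in>{a<..2*n+1}. ?g a d)"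
        by (rule prod_srefl [OF i]) (use lt b 4 in auto)
      ultimately show ?thesis unfolding v' using 4 lt b by (auto simp: refl_sign_def inv_sign_def)
    qed
  next
    case False
    then have n: "i = n" using i by simp
    have s: "?s n = n + 2" "?s (n + 1) = n + 1" "?s (n + 2) = n" using n by (auto simp: srefl_def)
    have mid: "?v (n + 1) = n + 1" by (rule perm_inv_middle [OF "is"])
    have "?v n + ?v (n + 2) = 2*n+2" using i by (intro perm_inv_mirror [OF "is"]) auto
    then have asc': "?v n < n + 1" "n + 1 < ?v (n + 2)" using asc mid n by auto
    have rest: "(\<Prod>d\<in>{n + 2<..2*n+1}. ?g x (?s d)) = (\<Prod>d\<in>{n + 2<..2*n+1}. ?g x d)" for x
      by (rule prod_srefl [OF i]) (use n in auto)
    have n1: "n \<ge> 1" using i by auto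
    \<comment> \<open>After prepending n, index n gains two inversions, with n+1 and n+2, while n+1
      gains one; hence only the middle index changes sign.\<close>
    consider (1) "a = n" | (2) "a = n + 1" | (3) "a = n + 2" | (4) "a \<notin> {n, n + 1, n + 2}" by blast
    then show ?thesis
    proof cases
      case 1
      have "(\<Prod>d\<in>{n<..2*n+1}. ?g (n + 2) (?s d)) = (\<Prod>d\<in>{n + 2<..2*n+1}. ?g (n + 2) (?s d))"
        using insert [of n "\<lambda>d. ?g (n + 2) (?s d)"] insert [of "n + 1" "\<lambda>d. ?g (n + 2) (?s d)"] n1 asc' s mid
        by (simp add: numeral_2_eq_2)
      then show ?thesis unfolding v' rest using 1 s n by (simp add: refl_sign_def inv_sign_def)
    next
      case 2
      have "(\<Prod>d\<in>{n + 1<..2*n+1}. ?g (n + 1) (?s d)) = - (\<Prod>d\<in>{n + 1<..2*n+1}. ?g (n + 1) d)"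
        using insert [of "n + 1" "\<lambda>d. ?g (n + 1) (?s d)"] insert [of "n + 1" "?g (n + 1)"]
          rest [of "n + 1"] n1 asc' s mid
        by (simp add: numeral_2_eq_2)
      then show ?thesis unfolding v' using 2 s n by (simp add: refl_sign_def inv_sign_def)
    next
      case 3
      have "(\<Prod>d\<in>{n<..2*n+1}. ?g n d) = (\<Prod>d\<in>{n + 2<..2*n+1}. ?g n d)"
        using insert [of n "?g n"] insert [of "n + 1" "?g n"] n1 asc' mid
        by (simp add: numeral_2_eq_2)
      then show ?thesis unfolding v' using 3 s n rest [of n] by (simp add: refl_sign_def inv_sign_def)
    next
      case 4
      have "?s a = a" using 4 n by (auto simp: srefl_def)
      moreover have "(\<Prod>d\<in>{a<..2*n+1}. ?g a (?s d)) = (\<Prod>d\<in>{a<..2*n+1}. ?g a d)"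
        by (rule prod_srefl [OF i]) (use n 4 in auto)
      ultimately show ?thesis unfolding v' using 4 n by (auto simp: refl_sign_def inv_sign_def)
    qed
  qed
qed

text \<open>No value lies between v(a) and v(a)+1, so both indices see the same inversions. Hence
  the two signs cancel on the matrix unit at (a, a+1).\<close>

lemma inv_sign_adjacent:
  assumes "is": "set is \<subseteq> {1..n}" and a: "a + 1 \<le> 2*n+1"
    and v: "perm_inv n is (a + 1) = perm_inv n is a + 1"
  shows "inv_sign n (perm_inv n is) a = inv_sign n (perm_inv n is) (a + 1)"
proof -
  let ?v = "perm_inv n is"
  have "{a<..2*n+1} = insert (a + 1) {a + 1<..2*n+1}" using a by auto
  then have "inv_sign n ?v a = (\<Prod>d\<in>{a + 1<..2*n+1}. if ?v d < ?v a then - 1 else 1)"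
    using v by (simp add: inv_sign_def)
  also have "\<dots> = inv_sign n ?v (a + 1)"
    unfolding inv_sign_def
  proof (rule prod.cong)
    fix d assume "d \<in> {a + 1<..2*n+1}"
    then have "?v d \<noteq> ?v a" using injD [OF inj_perm_inv [OF "is"], of d a] by auto
    then show "(if ?v d < ?v a then - 1 else 1) = (if ?v d < ?v (a + 1) then - 1 else (1::complex))"
      using v by auto
  qed simp
  finally show ?thesis .
qed

definition sbar_inv :: "(nat \<Rightarrow> 'd::finite cmat) \<Rightarrow> (nat \<Rightarrow> 'd cmat) \<Rightarrow> nat \<Rightarrow> 'd cmat" where
  "sbar_inv e f i = one_param (e i) 1 ** one_param (f i) (- 1) ** one_param (e i) 1"

lemma sbar_sbar_inv: "sbar e f i ** sbar_inv e f i = mat 1" "sbar_inv e f i ** sbar e f i = mat 1"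
  using one_param_inverse_assoc [of "e i" 1] one_param_inverse_assoc [of "f i" 1]
  by (simp_all add: sbar_def sbar_inv_def flip: matrix_mul_assoc)

context vector_rep begin

definition smat :: "(nat \<Rightarrow> complex) \<Rightarrow> (nat \<Rightarrow> nat) \<Rightarrow> 'm cmat" where
  "smat \<sigma> v = (\<chi> r s. if r = \<iota> (v (idx s)) then \<sigma> (idx s) else 0)"

lemma smat_nth: "smat \<sigma> v $ r $ s = (if r = \<iota> (v (idx s)) then \<sigma> (idx s) else 0)"
  by (simp add: smat_def)

lemma smat_mul:
  assumes "\<And>a. a \<in> {1..CARD('m)} \<Longrightarrow> v' a \<in> {1..CARD('m)}"
  shows "smat \<sigma> v ** smat \<sigma>' v' = smat (\<lambda>a. \<sigma>' a * \<sigma> (v' a)) (v \<circ> v')"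
proof -
  have "(smat \<sigma> v ** smat \<sigma>' v') $ r $ s = smat \<sigma> v $ r $ \<iota> (v' (idx s)) * \<sigma>' (idx s)" for r s
    by (simp add: mmul_nth smat_nth [of \<sigma>'] if_distrib [of "\<lambda>z. _ * z"] cong: if_cong)
  then show ?thesis using assms idx_range by (simp add: vec_eq_iff smat_nth)
qed

lemma smat_el: "a \<in> {1..CARD('m)} \<Longrightarrow> smat \<sigma> v ** el a b = cscale (\<sigma> a) (el (v a) b)"
  by (auto simp: vec_eq_iff mul_el_nth smat_nth el_nth)

lemma el_smat:
  assumes "b \<in> {1..CARD('m)}" "v b \<in> {1..CARD('m)}" "inj v" "\<And>a. a \<in> {1..CARD('m)} \<Longrightarrow> v a \<in> {1..CARD('m)}"
  shows "el c (v b) ** smat \<sigma> v = cscale (\<sigma> b) (el c b)"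
proof -
  have "\<iota> (v b) = \<iota> (v (idx s)) \<longleftrightarrow> s = \<iota> b" for s
  proof -
    have "\<iota> (v b) = \<iota> (v (idx s)) \<longleftrightarrow> v b = v (idx s)" by (rule \<iota>_eq_iff [OF assms(2) assms(4) [OF idx_range]])
    also have "\<dots> \<longleftrightarrow> idx s = b" using assms(3) by (auto simp: inj_eq)
    finally show ?thesis by (simp only: idx_eq_iff [OF assms(1)])
  qed
  then show ?thesis using assms(1) by (auto simp: vec_eq_iff el_mul_nth smat_nth el_nth)
qed

lemma srefl_card: "i \<in> {1..n} \<Longrightarrow> a \<in> {1..CARD('m)} \<Longrightarrow> srefl n i a \<in> {1..CARD('m)}"
  using srefl_range [of i n a] srefl_outside [of i n a] size by (cases "a \<in> {1..2*n+1}") auto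

lemma perm_inv_card: "set is \<subseteq> {1..n} \<Longrightarrow> a \<in> {1..CARD('m)} \<Longrightarrow> perm_inv n is a \<in> {1..CARD('m)}"
  using perm_inv_range [of "is" n a] perm_inv_outside [of "is" n a] size by (cases "a \<in> {1..2*n+1}") auto

lemma x_eq: "i \<in> {1..n} \<Longrightarrow> one_param (E i) t = mat 1 + cscale t (E i) + (if i = n then cscale (t\<^sup>2) (el n (n + 2)) else 0)"
  by (simp add: one_param_nilpotent [OF E_cube] E_sq cscale_cscale)

lemma y_eq: "i \<in> {1..n} \<Longrightarrow> one_param (F i) t = mat 1 + cscale t (F i) + (if i = n then cscale (t\<^sup>2) (el (n + 2) n) else 0)"
  by (simp add: one_param_nilpotent [OF F_cube] F_sq cscale_cscale)

lemma el_\<iota>: "a \<in> {1..CARD('m)} \<Longrightarrow> b \<in> {1..CARD('m)} \<Longrightarrow> c \<in> {1..CARD('m)} \<Longrightarrow> d \<in> {1..CARD('m)} \<Longrightarrow>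
    el a b $ \<iota> c $ \<iota> d = (if c = a \<and> d = b then 1 else 0)"
  by (simp only: el_nth \<iota>_eq_iff)

lemma mat_\<iota>: "c \<in> {1..CARD('m)} \<Longrightarrow> d \<in> {1..CARD('m)} \<Longrightarrow> mat 1 $ \<iota> c $ \<iota> d = (if c = d then 1 else 0 :: complex)"
  by (simp only: mat_def vec_lambda_beta \<iota>_eq_iff)

lemma eq_by_columns:
  assumes "\<And>c d. c \<in> {1..CARD('m)} \<Longrightarrow> d \<in> {1..CARD('m)} \<Longrightarrow> A $ \<iota> c $ \<iota> d = B $ \<iota> c $ \<iota> d"
  shows "A = (B :: 'm cmat)"
proof -
  have "A $ p $ q = B $ p $ q" for p q using assms [OF idx_range idx_range, of p q] by simp
  then show ?thesis by (simp add: vec_eq_iff)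
qed

lemma smat_\<iota>:
  assumes "c \<in> {1..CARD('m)}" "d \<in> {1..CARD('m)}" "v d \<in> {1..CARD('m)}"
  shows "smat \<sigma> v $ \<iota> c $ \<iota> d = (if c = v d then \<sigma> d else 0)"
  using assms by (simp only: smat_nth idx_\<iota> \<iota>_eq_iff)

lemma sbar_inv_last: "sbar_inv E F n = smat (refl_sign n n) (srefl n n)"
proof -
  define q r where "q = n + 1" and "r = n + 2"
  have ran: "n \<in> {1..CARD('m)}" "q \<in> {1..CARD('m)}" "r \<in> {1..CARD('m)}"
    using size n_pos by (auto simp: q_def r_def)
  have neq: "n \<noteq> q" "q \<noteq> n" "n \<noteq> r" "r \<noteq> n" "q \<noteq> r" "r \<noteq> q" by (auto simp: q_def r_def)
  have i: "n \<in> {1..n}" using n_pos by auto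
  have "2*n+1-n = q" "2*n+2-n = r" by (auto simp: q_def r_def)
  then have EF: "E n = el n q + cscale 2 (el q r)" "F n = cscale 2 (el q n) + el r q"
    by (simp_all add: E_def F_def kap_def q_def)
  define X where "X = mat 1 + el n q + cscale 2 (el q r) + el n r"
  define Y where "Y = mat 1 - cscale 2 (el q n) - el r q + el r n"
  define Z where "Z = mat 1 + cscale 2 (el q r) + el n r - el r q - el n n - cscale 2 (el q q) + el r n"
  have X: "one_param (E n) 1 = X" using x_eq [OF i, of 1] by (simp add: EF X_def r_def add.assoc)
  have Y: "one_param (F n) (- 1) = Y"
    using y_eq [OF i, of "-1"] by (simp add: EF Y_def r_def cscale_neg cscale_add) 
  have "X ** Y = Z"
    unfolding X_def Y_def Z_def using ran neq by (simp add: mat_algebra el_mul) (simp add: vec_eq_iff)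
  moreover have "Z ** X = mat 1 - el n n - cscale 2 (el q q) - el r r + el n r + el r n"
    unfolding X_def Z_def using ran neq by (simp add: mat_algebra el_mul) (simp add: vec_eq_iff)
  ultimately have "sbar_inv E F n = mat 1 - el n n - cscale 2 (el q q) - el r r + el n r + el r n"
    by (simp add: sbar_inv_def X Y)
  also have "\<dots> = smat (refl_sign n n) (srefl n n)"
  proof (rule eq_by_columns)
    fix c d assume cd: "c \<in> {1..CARD('m)}" "d \<in> {1..CARD('m)}"
    consider "d = n" | "d = q" | "d = r" | "d \<noteq> n" "d \<noteq> q" "d \<noteq> r" by blast
    then show "(mat 1 - el n n - cscale 2 (el q q) - el r r + el n r + el r n) $ \<iota> c $ \<iota> d =
      smat (refl_sign n n) (srefl n n) $ \<iota> c $ \<iota> d"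
    proof cases
      case 1
      have "srefl n n n = r" "refl_sign n n n = 1" by (auto simp: srefl_def refl_sign_def r_def)
      then show ?thesis using cd ran neq 1 by (simp add: smat_\<iota> el_\<iota> mat_\<iota>)
    next
      case 2
      have "srefl n n q = q" "refl_sign n n q = - 1" by (auto simp: srefl_def refl_sign_def q_def)
      then show ?thesis using cd ran neq 2 by (simp add: smat_\<iota> el_\<iota> mat_\<iota>)
    next
      case 3
      have "srefl n n r = n" "refl_sign n n r = 1" by (auto simp: srefl_def refl_sign_def r_def)
      then show ?thesis using cd ran neq 3 by (simp add: smat_\<iota> el_\<iota> mat_\<iota>)
    next
      case 4
      have "srefl n n d = d" "refl_sign n n d = 1" using 4 by (auto simp: srefl_def refl_sign_def r_def q_def)
      then show ?thesis using cd ran 4 by (simp add: smat_\<iota> el_\<iota> mat_\<iota>)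
    qed
  qed
  finally show ?thesis .
qed

lemma sbar_inv_less:
  assumes i: "i \<in> {1..n}" and lt: "i < n"
  shows "sbar_inv E F i = smat (refl_sign n i) (srefl n i)"
proof -
  define j b b' where "j = i + 1" and "b = 2*n+1-i" and "b' = 2*n+2-i"
  have b: "b' = b + 1" "b > j" "b + i = 2*n+1" using lt by (auto simp: b_def b'_def j_def)
  have r: "i \<in> {1..CARD('m)}" "j \<in> {1..CARD('m)}" "b \<in> {1..CARD('m)}" "b' \<in> {1..CARD('m)}"
    using index_range [OF i] unfolding j_def b_def b'_def by blast+
  have neq: "i \<noteq> j" "i \<noteq> b" "i \<noteq> b'" "j \<noteq> i" "j \<noteq> b" "j \<noteq> b'" "b \<noteq> i" "b \<noteq> j" "b \<noteq> b'"
     "b' \<noteq> i" "b' \<noteq> j" "b' \<noteq> b"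
    using b by (auto simp: j_def)
  have EF: "E i = el i j + el b b'" "F i = el j i + el b' b"
    using lt by (simp_all add: E_def F_def kap_def j_def b_def b'_def)
  have p: "E i ** E i = 0" "E i ** F i = el i i + el b b" "F i ** E i = el j j + el b' b'"
    "E i ** (F i ** E i) = E i"
    using r neq by (simp_all add: EF mat_algebra el_mul)
  have X: "one_param (E i) 1 = mat 1 + E i" and Y: "one_param (F i) (- 1) = mat 1 - F i"
    using x_eq [OF i, of 1] y_eq [OF i, of "-1"] lt by (simp_all add: cscale_neg)
  have "sbar_inv E F i = mat 1 + E i - F i - E i ** F i - F i ** E i"
    unfolding sbar_inv_def X Y by (simp add: mat_algebra p(1,4))
  also have "\<dots> = mat 1 + el i j + el b b' - el j i - el b' b - el i i - el j j - el b b - el b' b'"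
    unfolding p(2,3) unfolding EF by (simp add: algebra_simps)
  also have "\<dots> = smat (refl_sign n i) (srefl n i)" (is "?L = ?R")
  proof (rule eq_by_columns)
    fix c d assume cd: "c \<in> {1..CARD('m)}" "d \<in> {1..CARD('m)}"
    consider "d = i" | "d = j" | "d = b" | "d = b'" | "d \<notin> {i, j, b, b'}" by blast
    then show "?L $ \<iota> c $ \<iota> d = ?R $ \<iota> c $ \<iota> d"
    proof cases
      case 1
      have "srefl n i i = j" "refl_sign n i i = - 1" using lt by (auto simp: srefl_def refl_sign_def j_def)
      then show ?thesis using cd r neq 1 by (simp add: smat_\<iota> el_\<iota> mat_\<iota>)
    next
      case 2
      have "srefl n i j = i" "refl_sign n i j = 1" using lt by (auto simp: srefl_def refl_sign_def j_def)
      then show ?thesis using cd r neq 2 by (simp add: smat_\<iota> el_\<iota> mat_\<iota>)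
    next
      case 3
      have "srefl n i b = b'" "refl_sign n i b = - 1" using lt b by (auto simp: srefl_def refl_sign_def)
      then show ?thesis using cd r neq 3 by (simp add: smat_\<iota> el_\<iota> mat_\<iota>)
    next
      case 4
      have "srefl n i b' = b" "refl_sign n i b' = 1" using lt b by (auto simp: srefl_def refl_sign_def)
      then show ?thesis using cd r neq 4 by (simp add: smat_\<iota> el_\<iota> mat_\<iota>)
    next
      case 5
      have "srefl n i d = d" "refl_sign n i d = 1" using lt b 5 by (auto simp: srefl_def refl_sign_def j_def)
      then show ?thesis using cd r 5 by (simp add: smat_\<iota> el_\<iota> mat_\<iota>)
    qed
  qed
  finally show ?thesis .
qed

lemma sbar_inv_smat: "i \<in> {1..n} \<Longrightarrow> sbar_inv E F i = smat (refl_sign n i) (srefl n i)"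
  using sbar_inv_last sbar_inv_less [of i] by (cases "i = n") auto

end

section \<open>Lifts of words and their action on root vectors of the vector representation\<close>

definition word_inv :: "(nat \<Rightarrow> 'd::finite cmat) \<Rightarrow> (nat \<Rightarrow> 'd cmat) \<Rightarrow> nat list \<Rightarrow> 'd cmat" where
  "word_inv e f is = mprod (map (sbar_inv e f) (rev is))"

definition word_bar :: "(nat \<Rightarrow> 'd::finite cmat) \<Rightarrow> (nat \<Rightarrow> 'd cmat) \<Rightarrow> nat list \<Rightarrow> 'd cmat" where
  "word_bar e f is = mprod (map (sbar e f) is)"

lemma mprod_Nil [simp]: "mprod [] = mat 1"
  and mprod_Cons [simp]: "mprod (A # As) = A ** mprod As"
  by (simp_all add: mprod_def)

lemma mprod_append: "mprod (As @ Bs) = mprod As ** mprod Bs"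
  by (induction As) (simp_all add: matrix_mul_assoc)

lemma word_bar_simps [simp]: "word_bar e f [] = mat 1" "word_bar e f (i # is) = sbar e f i ** word_bar e f is"
  by (simp_all add: word_bar_def)

lemma word_inv_simps [simp]: "word_inv e f [] = mat 1" "word_inv e f (i # is) = word_inv e f is ** sbar_inv e f i"
  by (simp_all add: word_inv_def mprod_append)

lemma word_bar_append: "word_bar e f (xs @ ys) = word_bar e f xs ** word_bar e f ys"
  by (simp add: word_bar_def mprod_append)

lemma word_inv_append: "word_inv e f (xs @ ys) = word_inv e f ys ** word_inv e f xs"
  by (simp add: word_inv_def mprod_append)

lemma word_bar_inv: "word_bar e f is ** word_inv e f is = mat 1" "word_inv e f is ** word_bar e f is = mat 1"
proof (induction "is")
  case (Cons i "is")
  {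
    case 1
    have "word_bar e f (i # is) ** word_inv e f (i # is)
      = sbar e f i ** (word_bar e f is ** word_inv e f is) ** sbar_inv e f i" by (simp add: matrix_mul_assoc)
    then show ?case using Cons by (simp add: sbar_sbar_inv)
  next
    case 2
    have "word_inv e f (i # is) ** word_bar e f (i # is)
      = word_inv e f is ** (sbar_inv e f i ** sbar e f i) ** word_bar e f is" by (simp add: matrix_mul_assoc)
    then show ?case using Cons by (simp add: sbar_sbar_inv)
  }
qed simp_all

context vector_rep begin

lemma word_inv_smat:
  "reduced n is \<Longrightarrow> word_inv E F is = smat (inv_sign n (perm_inv n is)) (perm_inv n is)"
proof (induction "is")
  case Nil
  have "inv_sign n (\<lambda>a. a) a = 1" for a by (simp add: inv_sign_def)
  then show ?case by (auto simp: vec_eq_iff smat_nth mat_def id_def)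
next
  case (Cons i "is")
  have i: "i \<in> {1..n}" and sub: "set is \<subseteq> {1..n}" using reduced_set [OF Cons.prems] by auto
  have "word_inv E F (i # is) = smat (inv_sign n (perm_inv n is)) (perm_inv n is) ** smat (refl_sign n i) (srefl n i)"
    using Cons reduced_Cons sbar_inv_smat [OF i] by simp
  also have "\<dots> = smat (\<lambda>a. refl_sign n i a * inv_sign n (perm_inv n is) (srefl n i a)) (perm_inv n is \<circ> srefl n i)"
    by (rule smat_mul) (rule srefl_card [OF i])
  also have "\<dots> = smat (inv_sign n (perm_inv n (i # is))) (perm_inv n (i # is))"
    using inv_sign_Cons [OF sub i reduced_Cons_ascent [OF Cons.prems]]
    by (simp add: perm_inv_Cons fun_eq_iff smat_def vec_eq_iff)
  finally show ?case .
qed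

lemma word_inv_el:
  assumes red: "reduced n is" and ab: "a \<in> {1..CARD('m)}" "b \<in> {1..CARD('m)}"
  shows "word_inv E F is ** el a b =
    cscale (inv_sign n (perm_inv n is) a * inv_sign n (perm_inv n is) b)
      (el (perm_inv n is a) (perm_inv n is b)) ** word_inv E F is"
proof -
  have sub: "set is \<subseteq> {1..n}" by (rule reduced_set [OF red])
  let ?v = "perm_inv n is" and ?\<sigma> = "inv_sign n (perm_inv n is)"
  have "el (?v a) (?v b) ** smat ?\<sigma> ?v = cscale (?\<sigma> b) (el (?v a) b)"
    by (rule el_smat [OF ab(2) perm_inv_card [OF sub ab(2)] inj_perm_inv [OF sub] perm_inv_card [OF sub]])
  then show ?thesis
    unfolding word_inv_smat [OF red] cscale_mul_left smat_el [OF ab(1)]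
    by (simp add: cscale_cscale mult.assoc inv_sign_sq)
qed

text \<open>On each matrix unit of \<open>E j\<close> the two signs agree, because v takes adjacent
  values there. In the mirrored case neither i nor j is n, so both coefficients are 1 and the two
  units merely change places.\<close>

lemma word_inv_E:
  assumes red: "reduced n is" and ij: "i \<in> {1..n}" "j \<in> {1..n}" and m: "root_match n (perm_inv n is) j i"
  shows "word_inv E F is ** E j = E i ** word_inv E F is"
proof -
  let ?v = "perm_inv n is"
  have sub: "set is \<subseteq> {1..n}" by (rule reduced_set [OF red])
  define b where "b = 2*n+1-j"
  have b: "b + j = 2*n+1" "2*n+2-j = b + 1" using ij by (auto simp: b_def)
  have mir: "?v j + ?v (b + 1) = 2*n+2" "?v (j + 1) + ?v b = 2*n+2"
    by (rule perm_inv_mirror [OF sub]; use b ij in force)+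
  have r: "j \<in> {1..CARD('m)}" "j + 1 \<in> {1..CARD('m)}" "b \<in> {1..CARD('m)}" "b + 1 \<in> {1..CARD('m)}"
    using index_range [OF ij(2)] b by (simp_all add: b_def)
  have sgn: "inv_sign n ?v j * inv_sign n ?v (j + 1) = 1" "inv_sign n ?v b * inv_sign n ?v (b + 1) = 1"
  proof -
    have "?v (j + 1) = ?v j + 1" "?v (b + 1) = ?v b + 1" using m mir unfolding root_match_def by auto
    then show "inv_sign n ?v j * inv_sign n ?v (j + 1) = 1" "inv_sign n ?v b * inv_sign n ?v (b + 1) = 1"
      using inv_sign_adjacent [OF sub, of j] inv_sign_adjacent [OF sub, of b] b ij
      by (simp_all add: inv_sign_sq)
  qed
  have mid: "?v (n + 1) = n + 1" by (rule perm_inv_middle [OF sub])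
  have inj: "?v a = ?v c \<longleftrightarrow> a = c" for a c using inj_perm_inv [OF sub] by (simp add: inj_eq)
  have E: "el (?v j) (?v (j + 1)) + cscale (kap j) (el (?v b) (?v (b + 1))) = E i"
  proof (cases "?v j = i")
    case True
    then have v: "?v (j + 1) = i + 1" "?v b = 2*n+1-i" "?v (b + 1) = 2*n+2-i"
      using m mir ij by (auto simp: root_match_def)
    have "i = n \<longleftrightarrow> j = n"
    proof
      assume "i = n"
      then have "?v (j + 1) = ?v (n + 1)" using v mid by simp
      then show "j = n" by (simp add: inj)
    next
      assume "j = n"
      then show "i = n" using v mid by simp
    qed
    then show ?thesis using True v by (simp add: E_def kap_def)
  next
    case False
    then have v: "?v j = 2*n+1-i" "?v (j + 1) = 2*n+2-i" "?v b = i" "?v (b + 1) = i + 1"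
      using m mir ij by (auto simp: root_match_def)
    have "j \<noteq> n" using v mid ij by auto
    moreover have "i \<noteq> n"
    proof
      assume "i = n"
      then have "?v j = ?v (n + 1)" using v mid by simp
      then show False using ij by (simp add: inj)
    qed
    ultimately show ?thesis using v by (simp add: E_def kap_def add.commute)
  qed
  have Ej: "E j = el j (j + 1) + cscale (kap j) (el b (b + 1))"
    by (simp only: E_def b(2) b_def [symmetric])
  have "word_inv E F is ** E j = (el (?v j) (?v (j + 1)) + cscale (kap j) (el (?v b) (?v (b + 1)))) ** word_inv E F is"
    using word_inv_el [OF red r(1,2)] word_inv_el [OF red r(3,4)] sgn
    by (simp add: Ej mat_algebra)
  then show ?thesis by (simp only: E)
qed

text \<open>Conjugation moves the matrix unit at (a, b) to (v a, v b) up to sign, and a unit of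
  \<open>E j\<close> can reach (i, i+1) only if the roots match.\<close>

lemma conj_x_entry:
  assumes red: "reduced n is" and ij: "i \<in> {1..n}" "j \<in> {1..n}" and m: "\<not> root_match n (perm_inv n is) j i"
  shows "(word_inv E F is ** one_param (E j) t ** word_bar E F is) $ \<iota> i $ \<iota> (i + 1) = 0"
proof -
  let ?v = "perm_inv n is" and ?W = "word_bar E F is" and ?W' = "word_inv E F is"
  have sub: "set is \<subseteq> {1..n}" by (rule reduced_set [OF red])
  have conj: "?W' ** el a b ** ?W = cscale (inv_sign n ?v a * inv_sign n ?v b) (el (?v a) (?v b))"
    if "a \<in> {1..CARD('m)}" "b \<in> {1..CARD('m)}" for a b
    by (simp add: word_inv_el [OF red that] word_bar_inv mat_algebra)
  define b where "b = 2*n+1-j"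
  have b: "b + j = 2*n+1" "2*n+2-j = b + 1" using ij by (auto simp: b_def)
  have mir: "?v j + ?v (b + 1) = 2*n+2" "?v (j + 1) + ?v b = 2*n+2"
    by (rule perm_inv_mirror [OF sub]; use b ij in force)+
  have r: "j \<in> {1..CARD('m)}" "j + 1 \<in> {1..CARD('m)}" "b \<in> {1..CARD('m)}" "b + 1 \<in> {1..CARD('m)}"
    using index_range [OF ij(2)] b by (simp_all add: b_def)
  have ri: "i \<in> {1..CARD('m)}" "i + 1 \<in> {1..CARD('m)}" using index_range [OF ij(1)] by auto
  have z: "el (?v a) (?v c) $ \<iota> i $ \<iota> (i + 1) = 0"
    if "a \<in> {1..CARD('m)}" "c \<in> {1..CARD('m)}" "\<not> (?v a = i \<and> ?v c = i + 1)" for a c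
    using el_\<iota> [OF perm_inv_card [OF sub that(1)] perm_inv_card [OF sub that(2)] ri] that(3) by auto
  have Ej: "E j = el j (j + 1) + cscale (kap j) (el b (b + 1))"
    by (simp only: E_def b(2) b_def [symmetric])
  have "(?W' ** E j ** ?W) $ \<iota> i $ \<iota> (i + 1) = 0"
  proof -
    have "?W' ** E j ** ?W = ?W' ** el j (j + 1) ** ?W + cscale (kap j) (?W' ** el b (b + 1) ** ?W)"
      by (simp add: Ej mat_algebra)
    moreover have "\<not> (?v j = i \<and> ?v (j + 1) = i + 1)" "\<not> (?v b = i \<and> ?v (b + 1) = i + 1)"
      using m mir by (auto simp: root_match_def)
    ultimately show ?thesis using r z by (simp add: conj)
  qed
  moreover have "(?W' ** el n (n + 2) ** ?W) $ \<iota> i $ \<iota> (i + 1) = 0"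
  proof -
    have "n \<in> {1..CARD('m)}" "n + 2 \<in> {1..CARD('m)}" using size n_pos by auto
    \<comment> \<open>The quadratic term of the exponential lands on two mirrored indices; their sum
      2n+2 is even, whereas i + (i+1) is odd.\<close>
    moreover have "?v n + ?v (n + 2) = 2*n+2" using n_pos by (intro perm_inv_mirror [OF sub]) auto
    then have "\<not> (?v n = i \<and> ?v (n + 2) = i + 1)" by presburger
    ultimately show ?thesis using z by (simp add: conj)
  qed
  moreover have "?W' ** one_param (E j) t ** ?W =
      mat 1 + cscale t (?W' ** E j ** ?W) + (if j = n then cscale (t\<^sup>2) (?W' ** el n (n + 2) ** ?W) else 0)"
    by (simp add: x_eq [OF ij(2)] mat_algebra word_bar_inv)
  ultimately show ?thesis using ri by (auto simp: mat_def \<iota>_eq_iff)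
qed

subsection \<open>Unitriangular matrices\<close>

text \<open>Besides triangularity, the surplus columns are required to be trivial; thereby row 2n+1
  of such a matrix is a unit vector although it need not be the last one.\<close>

definition unitri :: "'m cmat set" where
  "unitri = {A. (\<forall>r s. r \<noteq> s \<and> (idx s < idx r \<or> 2*n+1 < idx s) \<longrightarrow> A $ r $ s = 0) \<and> (\<forall>r. A $ r $ r = 1)}"

lemma unitri_zero: "A \<in> unitri \<Longrightarrow> idx s < idx r \<Longrightarrow> A $ r $ s = 0"
  and unitri_zero': "A \<in> unitri \<Longrightarrow> r \<noteq> s \<Longrightarrow> 2*n+1 < idx s \<Longrightarrow> A $ r $ s = 0"
  and unitri_diag: "A \<in> unitri \<Longrightarrow> A $ r $ r = 1"
  by (cases "r = s"; simp add: unitri_def)+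

lemma closed_unitri: "closed unitri"
proof -
  have "closed {A :: 'm cmat. r \<noteq> s \<and> (idx s < idx r \<or> 2*n+1 < idx s) \<longrightarrow> A $ r $ s = 0}" for r s
    by (cases "r \<noteq> s \<and> (idx s < idx r \<or> 2*n+1 < idx s)")
      (simp_all only: simp_thms, auto intro!: closed_Collect_eq continuous_intros)
  moreover have "closed {A :: 'm cmat. A $ r $ r = 1}" for r
    by (intro closed_Collect_eq continuous_intros)
  ultimately show ?thesis unfolding unitri_def by (intro closed_Collect_conj closed_Collect_all)
qed

lemma unitri_one: "mat 1 \<in> unitri"
  by (auto simp: unitri_def mat_def)

lemma unitri_mul: assumes A: "A \<in> unitri" and B: "B \<in> unitri" shows "A ** B \<in> unitri"
proof -
  have "(A ** B) $ r $ s = 0" if rs: "r \<noteq> s" "idx s < idx r \<or> 2*n+1 < idx s" for r s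
  proof -
    have "A $ r $ q * B $ q $ s = 0" for q
    proof (cases "2*n+1 < idx s")
      case True
      then show ?thesis using unitri_zero' [OF A rs(1)] unitri_zero' [OF B, of q s] by (cases "q = s") auto
    next
      case False
      then have "idx q < idx r \<or> idx s < idx q" using rs(2) by linarith
      then show ?thesis using unitri_zero [OF A] unitri_zero [OF B] by auto
    qed
    then show ?thesis unfolding mmul_nth by (intro sum.neutral) blast
  qed
  moreover have "(A ** B) $ r $ r = 1" for r
  proof -
    have "(A ** B) $ r $ r = (\<Sum>q\<in>{r}. A $ r $ q * B $ q $ r)"
      unfolding mmul_nth
    proof (rule sum.mono_neutral_right)
      show "\<forall>q\<in>UNIV - {r}. A $ r $ q * B $ q $ r = 0"
      proof
        fix q assume "q \<in> UNIV - {r}"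
        then have "idx q < idx r \<or> idx r < idx q" using idx_inj [of q r] by auto
        then show "A $ r $ q * B $ q $ r = 0" using unitri_zero [OF A] unitri_zero [OF B] by auto
      qed
    qed auto
    then show ?thesis using assms by (simp add: unitri_diag)
  qed
  ultimately show ?thesis unfolding unitri_def by blast
qed

lemma unitri_superdiag:
  assumes A: "A \<in> unitri" and B: "B \<in> unitri" and i: "i \<in> {1..n}"
  shows "(A ** B) $ \<iota> i $ \<iota> (i + 1) = A $ \<iota> i $ \<iota> (i + 1) + B $ \<iota> i $ \<iota> (i + 1)"
proof -
  have r: "i \<in> {1..CARD('m)}" "i + 1 \<in> {1..CARD('m)}" using index_range [OF i] by auto
  have "(A ** B) $ \<iota> i $ \<iota> (i + 1) = (\<Sum>q\<in>{\<iota> i, \<iota> (i + 1)}. A $ \<iota> i $ q * B $ q $ \<iota> (i + 1))"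
    unfolding mmul_nth
  proof (rule sum.mono_neutral_right)
    show "\<forall>q\<in>UNIV - {\<iota> i, \<iota> (i + 1)}. A $ \<iota> i $ q * B $ q $ \<iota> (i + 1) = 0"
    proof
      fix q assume "q \<in> UNIV - {\<iota> i, \<iota> (i + 1)}"
      then have "idx q \<noteq> i" "idx q \<noteq> i + 1" unfolding idx_eq_iff [OF r(1)] idx_eq_iff [OF r(2)] by auto
      then consider "idx q < idx (\<iota> i)" | "idx (\<iota> (i + 1)) < idx q" using r by fastforce
      then show "A $ \<iota> i $ q * B $ q $ \<iota> (i + 1) = 0"
        using unitri_zero [OF A] unitri_zero [OF B] by cases auto
    qed
  qed auto
  also have "\<dots> = A $ \<iota> i $ \<iota> (i + 1) + B $ \<iota> i $ \<iota> (i + 1)"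
    using unitri_diag [OF A] unitri_diag [OF B] r by (simp add: \<iota>_eq_iff)
  finally show ?thesis .
qed

lemma x_unitri: assumes i: "i \<in> {1..n}" shows "one_param (E i) t \<in> unitri"
proof -
  have r: "i \<in> {1..CARD('m)}" "i + 1 \<in> {1..CARD('m)}" "2*n+1-i \<in> {1..CARD('m)}" "2*n+2-i \<in> {1..CARD('m)}"
     "n \<in> {1..CARD('m)}" "n + 2 \<in> {1..CARD('m)}"
    using index_range [OF i] size n_pos by auto
  have z: "el a b $ p $ q = 0"
    if "a \<in> {1..CARD('m)}" "b \<in> {1..CARD('m)}" "a < b" "b \<le> 2*n+1" "idx q \<le> idx p \<or> 2*n+1 < idx q" for a b p q
    using that by (auto simp: el_nth)
  have lt: "2*n+1-i < 2*n+2-i" "2*n+2-i \<le> 2*n+1" "i + 1 \<le> 2*n+1" "n + 2 \<le> 2*n+1" using i by auto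
  have "E i $ p $ q = 0" "el n (n + 2) $ p $ q = 0" if "idx q \<le> idx p \<or> 2*n+1 < idx q" for p q
    using r lt that z [of _ _ q p] by (simp_all add: E_def)
  then have EN: "E i $ p $ q = 0" "el n (n + 2) $ p $ q = 0"
    if "p = q \<or> idx q < idx p \<or> 2*n+1 < idx q" for p q
    using that by auto
  show ?thesis
    unfolding x_eq [OF i] unitri_def mem_Collect_eq
  proof (intro conjI allI impI)
    fix p q assume pq: "p \<noteq> q \<and> (idx q < idx p \<or> 2*n+1 < idx q)"
    then show "(mat 1 + cscale t (E i) + (if i = n then cscale (t\<^sup>2) (el n (n + 2)) else 0)) $ p $ q = 0"
      using EN [of p q] by (auto simp: mat_def)
  next
    fix p
    show "(mat 1 + cscale t (E i) + (if i = n then cscale (t\<^sup>2) (el n (n + 2)) else 0)) $ p $ p = 1"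
      using EN [of p p] by (auto simp: mat_def)
  qed
qed

lemma x_superdiag:
  assumes ij: "i \<in> {1..n}" "j \<in> {1..n}"
  shows "one_param (E j) t $ \<iota> i $ \<iota> (i + 1) = (if i = j then t else 0)"
proof -
  have r: "i \<in> {1..CARD('m)}" "i + 1 \<in> {1..CARD('m)}" "j \<in> {1..CARD('m)}" "j + 1 \<in> {1..CARD('m)}"
     "2*n+1-j \<in> {1..CARD('m)}" "2*n+2-j \<in> {1..CARD('m)}" "n \<in> {1..CARD('m)}" "n + 2 \<in> {1..CARD('m)}"
    using index_range [OF ij(1)] index_range [OF ij(2)] size n_pos by auto
  have "i \<noteq> 2*n+1-j" using ij by auto
  then show ?thesis
    unfolding x_eq [OF ij(2)] using r by (auto simp: mat_def el_nth E_def \<iota>_eq_iff)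
qed

subsection \<open>The action of the parametrisation on row vectors\<close>

lemma one_param_diagm: "one_param (diagm d) t = diagm (\<lambda>a. exp (t * d a))"
proof -
  have "has_mderiv (\<lambda>t. diagm (\<lambda>a. exp (t * d a))) (diagm d ** diagm (\<lambda>a. exp (t * d a))) t" for t
    by (auto simp: has_mderiv_def diagm_mul_nth diagm_nth intro!: derivative_eq_intros)
  from one_param_ode_left [OF this, of t] have "diagm (\<lambda>a. exp (t * d a)) = one_param (diagm d) t ** diagm (\<lambda>a. 1)"
    by simp
  also have "diagm (\<lambda>a. 1) = mat 1" by (simp add: vec_eq_iff diagm_nth mat_def)
  finally show ?thesis by simp
qed

lemma coroot_H: "coroot (H i) c = diagm (\<lambda>a. exp (ln c * of_int (wt i a)))"
  unfolding coroot_def H_def by (simp add: one_param_diagm flip: one_param_def)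

lemma exp_ln_inverse:
  assumes "(c::complex) \<noteq> 0"
  shows "exp (ln (inverse c)) = 1 / c" "exp (- ln (inverse c)) = c"
    "exp (ln (inverse c) * 2) = 1 / c\<^sup>2" "exp (- (ln (inverse c) * 2)) = c\<^sup>2"
proof -
  show 1: "exp (ln (inverse c)) = 1 / c" and 2: "exp (- ln (inverse c)) = c"
    using assms by (simp_all add: inverse_eq_divide exp_minus)
  have "exp (ln (inverse c) * 2) = exp (ln (inverse c)) ^ 2"
    by (metis exp_double mult.commute)
  then show "exp (ln (inverse c) * 2) = 1 / c\<^sup>2" unfolding 1 by (simp add: power_divide)
  have "exp (- (ln (inverse c) * 2)) = exp (- ln (inverse c)) ^ 2"
    by (metis exp_double mult.commute mult_minus_left)
  then show "exp (- (ln (inverse c) * 2)) = c\<^sup>2" unfolding 2 .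
qed

text \<open>Multiplication by y_j(c) adds columns and the coroot then scales them. For j = n the
  exponential is quadratic, whence 2c/c^2 = 2/c and c^2/c^2 = 1 in column n.\<close>

lemma row_bold_y:
  fixes A :: "'m cmat"
  assumes j: "j \<in> {1..n}" and c: "c \<noteq> 0" and a: "a \<in> {1..2*n+1}"
  shows "(A ** bold_y F H j c) $ r $ \<iota> a =
    (if j < n then
       (if a = j \<or> a + j = 2*n+1 then A $ r $ \<iota> a / c + A $ r $ \<iota> (a + 1)
        else if a = j + 1 \<or> a + j = 2*n+2 then c * A $ r $ \<iota> a else A $ r $ \<iota> a)
     else
       (if a = n then A $ r $ \<iota> n / c\<^sup>2 + 2 / c * A $ r $ \<iota> (n + 1) + A $ r $ \<iota> (n + 2)
        else if a = n + 1 then A $ r $ \<iota> (n + 1) + c * A $ r $ \<iota> (n + 2)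
        else if a = n + 2 then c\<^sup>2 * A $ r $ \<iota> (n + 2) else A $ r $ \<iota> a))"
proof -
  have ar: "a \<in> {1..CARD('m)}" using a size by auto
  have Y: "(A ** bold_y F H j c) $ r $ \<iota> a =
     (A ** one_param (F j) c) $ r $ \<iota> a * exp (ln (inverse c) * of_int (wt j a))"
    using ar by (simp add: bold_y_def coroot_H matrix_mul_assoc mul_diagm_nth)
  show ?thesis
  proof (cases "j = n")
    case True
    have r: "n \<in> {1..CARD('m)}" "n + 1 \<in> {1..CARD('m)}" "n + 2 \<in> {1..CARD('m)}" using size n_pos by auto
    have eq: "2*n+1-n = n+1" "2*n+2-n = n+2" by auto
    have wt: "wt n a = (if a = n then 2 else if a = n + 2 then - 2 else 0)" by (auto simp: wt_def)
    have "(A ** one_param (F n) c) $ r $ \<iota> a =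
        A $ r $ \<iota> a + (if a = n then 2 * c * A $ r $ \<iota> (n + 1) + c\<^sup>2 * A $ r $ \<iota> (n + 2) else 0)
          + (if a = n + 1 then c * A $ r $ \<iota> (n + 2) else 0)"
      using r ar y_eq [OF j, of c] True
      by (simp add: F_def kap_def mat_algebra eq mul_el_nth \<iota>_eq_iff)
    moreover have "exp (ln (inverse c) * of_int (wt n a)) = (if a = n then 1 / c\<^sup>2 else if a = n + 2 then c\<^sup>2 else 1)"
      using exp_ln_inverse [OF c] by (auto simp: wt)
    ultimately show ?thesis unfolding Y unfolding True using c
      by (simp add: power2_eq_square field_simps)
  next
    case False
    define b where "b = 2*n+1-j"
    have lt: "j < n" using False j by auto
    have b: "2*n+2-j = b + 1" "b > j + 1" "b + j = 2*n+1" using lt by (auto simp: b_def)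
    have r: "j \<in> {1..CARD('m)}" "j + 1 \<in> {1..CARD('m)}" "b \<in> {1..CARD('m)}" "b + 1 \<in> {1..CARD('m)}"
      using index_range [OF j] b by (simp_all add: b_def)
    have ab: "a + j = 2*n+1 \<longleftrightarrow> a = b" "a + j = 2*n+2 \<longleftrightarrow> a = b + 1" using b by auto
    have wt: "wt j a = (if a = j \<or> a = b then 1 else if a = j + 1 \<or> a = b + 1 then - 1 else 0)"
      unfolding wt_def ab using b lt by auto
    have "(A ** one_param (F j) c) $ r $ \<iota> a =
        A $ r $ \<iota> a + (if a = j \<or> a = b then c * A $ r $ \<iota> (a + 1) else 0)"
    proof -
      have "kap j = 1" using False by (simp add: kap_def)
      then have Fj: "F j = el (j + 1) j + el (b + 1) b" by (simp only: F_def b(1) b_def [symmetric] cscale_1)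
      have "A ** one_param (F j) c = A + cscale c (A ** el (j + 1) j) + cscale c (A ** el (b + 1) b)"
        using y_eq [OF j, of c] False by (simp add: Fj mat_algebra)
      then show ?thesis using b(2) by (simp add: mul_el_nth \<iota>_eq_iff [OF ar r(1)] \<iota>_eq_iff [OF ar r(3)])
    qed
    moreover have "exp (ln (inverse c) * of_int (wt j a)) =
        (if a = j \<or> a = b then 1 / c else if a = j + 1 \<or> a = b + 1 then c else 1)"
      using exp_ln_inverse [OF c] by (auto simp: wt)
    ultimately show ?thesis unfolding Y ab using c lt b
      by (auto simp: field_simps)
  qed
qed

end

lemma continuous_on_mmul [continuous_intros]:
  fixes f g :: "'a::topological_space \<Rightarrow> 'd::finite cmat"
  assumes "continuous_on S f" "continuous_on S g"
  shows "continuous_on S (\<lambda>x. f x ** g x)"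
  unfolding matrix_matrix_mult_def by (intro continuous_intros assms)

section \<open>Rank-one relations and the action of lifts on coweights\<close>

context chevalley_system begin

lemma y_x: "i \<in> {1..n} \<Longrightarrow> j \<in> {1..n} \<Longrightarrow> i \<noteq> j \<Longrightarrow>
    one_param (f i) t' ** one_param (e j) t = one_param (e j) t ** one_param (f i) t'"
  using ef [of j i] by (intro one_param_commute) auto

lemma h_x: "i \<in> {1..n} \<Longrightarrow> j \<in> {1..n} \<Longrightarrow>
    coroot (h i) c ** one_param (e j) t = one_param (e j) (exp (of_int (cartan_B n i j) * ln c) * t) ** coroot (h i) c"
  by (rule coroot_shift) (rule he)

lemma sbar_inv_refl: "i \<in> {1..n} \<Longrightarrow> sbar_inv e f i = sl2_triple.refl (e i) (f i) 1"
  by (simp add: sbar_inv_def sl2_triple.refl_def [OF sl2])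

lemma x_sbar:
  assumes "i \<in> {1..n}" "t \<noteq> 0"
  shows "one_param (e i) t ** sbar e f i = one_param (f i) (1 / t) ** coroot (h i) t ** one_param (e i) (- (1 / t))"
  using sl2_triple.x_refl [OF sl2] assms by (simp add: sbar_refl)

lemma x_sbar_inv:
  assumes "i \<in> {1..n}" "t \<noteq> 0"
  shows "one_param (e i) t ** sbar_inv e f i = one_param (f i) (1 / t) ** coroot (h i) (- t) ** one_param (e i) (- (1 / t))"
  using sl2_triple.x_refl' [OF sl2] assms by (simp add: sbar_inv_refl)

lemma bold_y_eq:
  assumes "i \<in> {1..n}" "c \<noteq> 0"
  shows "bold_y f h i c = one_param (e i) (1 / c) ** sbar e f i ** one_param (e i) c"
  using sl2_triple.y_coroot [OF sl2] assms by (simp add: bold_y_def sbar_refl inverse_eq_divide)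

lemma coroot_h_inverse: "i \<in> {1..n} \<Longrightarrow> c \<noteq> 0 \<Longrightarrow> coroot (h i) c ** coroot (h i) (1 / c) = mat 1"
  by (rule sl2_triple.coroot_inverse [OF sl2])

lemma sbar_inv_x_sbar:
  assumes "i \<in> {1..n}" shows "sbar_inv e f i ** one_param (e i) t ** sbar e f i = one_param (f i) (- t)"
  using sl2_triple.refl_x [OF sl2 [OF assms], of 1 t] assms sbar_sbar_inv [of e f i]
  by (simp add: sbar_inv_refl flip: matrix_mul_assoc)

lemma sbar_inv_opposite:
  assumes "i \<in> {1..n}" shows "sbar_inv (\<lambda>i. - f i) (\<lambda>i. - e i) i = sbar_inv e f i"
  using sbar_opposite [OF assms] sbar_sbar_inv
  by (metis matrix_mul_assoc matrix_mul_lid matrix_mul_rid)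

lemma word_bar_opposite: "set is \<subseteq> {1..n} \<Longrightarrow> word_bar (\<lambda>i. - f i) (\<lambda>i. - e i) is = word_bar e f is"
  by (induction "is") (simp_all add: sbar_opposite)

lemma word_inv_opposite: "set is \<subseteq> {1..n} \<Longrightarrow> word_inv (\<lambda>i. - f i) (\<lambda>i. - e i) is = word_inv e f is"
  by (induction "is") (simp_all add: sbar_inv_opposite)

definition hsum :: "(nat \<Rightarrow> complex) \<Rightarrow> 'd cmat" where
  "hsum m = (\<Sum>l\<in>{1..n}. cscale (m l) (h l))"

end

lemma mmul_sum_left: "(\<Sum>l\<in>S. A l) ** B = (\<Sum>l\<in>S. A l ** (B :: 'd::finite cmat))"
  by (induction S rule: infinite_finite_induct) (simp_all add: matrix_add_rdistrib)

lemma mmul_sum_right: "B ** (\<Sum>l\<in>S. A l) = (\<Sum>l\<in>S. (B :: 'd::finite cmat) ** A l)"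
  by (induction S rule: infinite_finite_induct) (simp_all add: matrix_add_ldistrib)

text \<open>The action of s_k on coordinates with respect to the simple coroots: from the coweight
  its pairing with alpha_k times the k-th coroot is subtracted.\<close>

definition coweight_refl :: "nat \<Rightarrow> nat \<Rightarrow> (nat \<Rightarrow> complex) \<Rightarrow> nat \<Rightarrow> complex" where
  "coweight_refl n k m = m(k := m k - (\<Sum>l\<in>{1..n}. m l * of_int (cartan_B n l k)))"

context chevalley_system begin

lemma hsum_e:
  assumes "j \<in> {1..n}"
  shows "hsum m ** e j - e j ** hsum m = cscale (\<Sum>l\<in>{1..n}. m l * of_int (cartan_B n l j)) (e j)"
proof -
  have "hsum m ** e j - e j ** hsum m = (\<Sum>l\<in>{1..n}. cscale (m l) (h l ** e j - e j ** h l))"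
    by (simp add: hsum_def mmul_sum_left mmul_sum_right mat_algebra sum_subtractf)
  also have "\<dots> = (\<Sum>l\<in>{1..n}. cscale (m l * of_int (cartan_B n l j)) (e j))"
    using assms by (intro sum.cong) (simp_all add: he cscale_cscale)
  also have "\<dots> = cscale (\<Sum>l\<in>{1..n}. m l * of_int (cartan_B n l j)) (e j)"
    by (simp add: vec_eq_iff sum_distrib_right)
  finally show ?thesis .
qed

lemma sbar_h:
  assumes "k \<in> {1..n}" "l \<in> {1..n}"
  shows "sbar e f k ** h l = (h l - cscale (of_int (cartan_B n l k)) (h k)) ** sbar e f k"
  unfolding sbar_refl [OF assms(1)]
  by (rule sl2_triple.refl_cartan [OF sl2 [OF assms(1)] he [OF assms(2,1)] hf [OF assms(2,1)]]) simp

lemma sbar_hsum: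
  assumes k: "k \<in> {1..n}"
  shows "sbar e f k ** hsum m = hsum (coweight_refl n k m) ** sbar e f k"
proof -
  have "sbar e f k ** hsum m =
     (\<Sum>l\<in>{1..n}. cscale (m l) (h l - cscale (of_int (cartan_B n l k)) (h k))) ** sbar e f k"
    using k by (simp add: hsum_def mmul_sum_left mmul_sum_right cscale_mul_right cscale_mul_left sbar_h)
  also have "(\<Sum>l\<in>{1..n}. cscale (m l) (h l - cscale (of_int (cartan_B n l k)) (h k)))
     = hsum m - cscale (\<Sum>l\<in>{1..n}. m l * of_int (cartan_B n l k)) (h k)"
    by (simp add: hsum_def cscale_diff sum_subtractf cscale_cscale vec_eq_iff sum_distrib_right)
  also have "\<dots> = hsum (coweight_refl n k m)"
  proof -
    have "hsum m = cscale (m k) (h k) + (\<Sum>l\<in>{1..n} - {k}. cscale (m l) (h l))" for m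
      unfolding hsum_def using k by (intro sum.remove) auto
    note this [of m] this [of "coweight_refl n k m"]
    moreover have "(\<Sum>l\<in>{1..n} - {k}. cscale (coweight_refl n k m l) (h l)) = (\<Sum>l\<in>{1..n} - {k}. cscale (m l) (h l))"
      by (intro sum.cong) (auto simp: coweight_refl_def)
    ultimately show ?thesis by (simp add: coweight_refl_def vec_eq_iff algebra_simps)
  qed
  finally show ?thesis .
qed

lemma word_bar_hsum:
  "set is \<subseteq> {1..n} \<Longrightarrow> word_bar e f is ** hsum m = hsum (foldr (coweight_refl n) is m) ** word_bar e f is"
proof (induction "is")
  case (Cons i "is")
  have "word_bar e f (i # is) ** hsum m = sbar e f i ** (word_bar e f is ** hsum m)"
    by (simp add: matrix_mul_assoc)
  also have "\<dots> = (sbar e f i ** hsum (foldr (coweight_refl n) is m)) ** word_bar e f is"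
    using Cons by (simp add: matrix_mul_assoc)
  also have "sbar e f i ** hsum (foldr (coweight_refl n) is m) = hsum (foldr (coweight_refl n) (i # is) m) ** sbar e f i"
    using Cons by (simp add: sbar_hsum)
  finally show ?case by (simp add: matrix_mul_assoc)
qed simp

end

text \<open>Coordinates of \<open>\<rho>\<^sup>\<or>\<close> with respect to the simple coroots.\<close>

definition rho_coords :: "nat \<Rightarrow> nat \<Rightarrow> complex" where
  "rho_coords n l = (if l = n then of_nat (n * (n + 1)) / 4 else of_nat l * (2 * of_nat n + 1 - of_nat l) / 2)"

lemma rho_coords_cartan:
  assumes n: "n \<ge> 2" and k: "k \<in> {1..n}"
  shows "(\<Sum>l\<in>{1..n}. rho_coords n l * of_int (cartan_B n l k)) = 1"
proof -
  let ?g = "\<lambda>l. rho_coords n l * of_int (cartan_B n l k)"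
  have "(\<Sum>l\<in>{1..n}. ?g l) = (\<Sum>l\<in>{1..n} \<inter> {k - 1, k, k + 1}. ?g l)"
    by (intro sum.mono_neutral_right) (auto simp: cartan_B_def)
  also have "\<dots> = 1"
  proof -
    consider "k = 1" "n = 2" | "k = 1" "n > 2" | "k = n" | "1 < k" "k + 1 = n" | "1 < k" "k + 1 < n"
      using k n by fastforce
    then show ?thesis
    proof cases
      case 1
      then have "{1..n} \<inter> {k - 1, k, k + 1} = {1, 2}" by auto
      then show ?thesis using 1 by (simp add: rho_coords_def cartan_B_def)
    next
      case 2
      then have "{1..n} \<inter> {k - 1, k, k + 1} = {1, 2}" by auto
      then show ?thesis using 2 by (simp add: rho_coords_def cartan_B_def field_simps)
    next
      case 3
      then have "{1..n} \<inter> {k - 1, k, k + 1} = {n - 1, n}" using n by auto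
      moreover obtain p where "n = Suc p" using n by (cases n) auto
      ultimately show ?thesis using 3 n by (simp add: rho_coords_def cartan_B_def field_simps)
    next
      case 4
      then have "{1..n} \<inter> {k - 1, k, k + 1} = {k - 1, k, k + 1}" by auto
      moreover obtain p where "k = Suc p" using 4 by (cases k) auto
      ultimately show ?thesis using 4 by (auto simp: rho_coords_def cartan_B_def field_simps)
    next
      case 5
      then have "{1..n} \<inter> {k - 1, k, k + 1} = {k - 1, k, k + 1}" by auto
      moreover obtain p where "k = Suc p" using 5 by (cases k) auto
      ultimately show ?thesis using 5 by (auto simp: rho_coords_def cartan_B_def field_simps)
    qed
  qed
  finally show ?thesis .
qed

lemma root_match_descent:
  assumes "i \<in> {1..n}" "root_match n v j i"
  shows "srefl n i (v (j + 1)) < srefl n i (v j)"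
  using assms by (cases "i < n") (auto simp: root_match_def srefl_def)

subsection \<open>Pairing a representation with the vector representation\<close>

text \<open>A pair holds the matrices of one element in both representations, so a parameter read in
  the second component is the parameter of the first.\<close>

locale paired = chevalley_system n e f h + V: vector_rep n \<iota>
  for n and e f h :: "nat \<Rightarrow> 'd::finite cmat" and \<iota> :: "nat \<Rightarrow> 'm::finite"
begin

sublocale V: chevalley_system n V.E V.F V.H
  by (rule V.chevalley)

definition pm :: "'d cmat \<times> 'm cmat \<Rightarrow> 'd cmat \<times> 'm cmat \<Rightarrow> 'd cmat \<times> 'm cmat" where
  "pm p q = (fst p ** fst q, snd p ** snd q)"

definition px where "px i t = (one_param (e i) t, one_param (V.E i) t)"
definition py where "py i t = (one_param (f i) t, one_param (V.F i) t)"
definition ph where "ph i c = (coroot (h i) c, coroot (V.H i) c)"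
definition ps where "ps i = (sbar e f i, sbar V.E V.F i)"
definition ps' where "ps' i = (sbar_inv e f i, sbar_inv V.E V.F i)"
definition chi :: "nat \<Rightarrow> 'd cmat \<times> 'm cmat \<Rightarrow> complex" where
  "chi i p = snd p $ \<iota> i $ \<iota> (i + 1)"

sublocale rank_one_system pm "(mat 1, mat 1)" "{1..n}" px py ph ps ps' "UNIV \<times> V.unitri" chi
proof
  fix i j :: nat and t t' c :: complex and u v w :: "'d cmat \<times> 'm cmat"
  show "pm (pm u v) w = pm u (pm v w)" by (simp add: pm_def matrix_mul_assoc)
  show "pm (mat 1, mat 1) u = u" "pm u (mat 1, mat 1) = u" by (simp_all add: pm_def)
  show "continuous_on UNIV (\<lambda>p. pm (fst p) (snd p))"
    unfolding pm_def by (intro continuous_intros)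
  show "(mat 1, mat 1) \<in> UNIV \<times> V.unitri" by (simp add: V.unitri_one)
  show "closed (UNIV \<times> V.unitri :: ('d cmat \<times> 'm cmat) set)"
    by (intro closed_Times V.closed_unitri closed_UNIV)
  assume i: "i \<in> {1..n}"
  show "continuous_on UNIV (px i)"
    unfolding px_def by (intro continuous_on_Pair continuous_one_param)
  show "px i (t + t') = pm (px i t) (px i t')" by (simp add: px_def pm_def one_param_add)
  show "px i 0 = (mat 1, mat 1)" by (simp add: px_def)
  show "pm (py i t) (py i (- t)) = (mat 1, mat 1)" by (simp add: py_def pm_def)
  show "pm (ps i) (ps' i) = (mat 1, mat 1)" "pm (ps' i) (ps i) = (mat 1, mat 1)"
    by (simp_all add: ps_def ps'_def pm_def sbar_sbar_inv)
  show "px i t \<in> UNIV \<times> V.unitri" using i by (simp add: px_def V.x_unitri)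
  show "continuous_on UNIV (chi i)" unfolding chi_def by (intro continuous_intros)
  show "chi i (mat 1, mat 1) = 0"
    using V.index_range [OF i] by (simp add: chi_def mat_def V.\<iota>_eq_iff)
  show "c \<noteq> 0 \<Longrightarrow> pm (ph i c) (ph i (1 / c)) = (mat 1, mat 1)"
    using i by (simp add: pm_def ph_def coroot_h_inverse V.coroot_h_inverse)
  show "t \<noteq> 0 \<Longrightarrow> pm (px i t) (ps i) = pm (pm (py i (1 / t)) (ph i t)) (px i (- (1 / t)))"
    using i by (simp add: pm_def px_def py_def ph_def ps_def x_sbar V.x_sbar)
  show "t \<noteq> 0 \<Longrightarrow> pm (px i t) (ps' i) = pm (pm (py i (1 / t)) (ph i (- t))) (px i (- (1 / t)))"
    using i by (simp add: pm_def px_def py_def ph_def ps'_def x_sbar_inv V.x_sbar_inv)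
  show "u \<in> UNIV \<times> V.unitri \<Longrightarrow> v \<in> UNIV \<times> V.unitri \<Longrightarrow> chi i (pm u v) = chi i u + chi i v"
    unfolding chi_def pm_def using V.unitri_superdiag [OF _ _ i, of "snd u" "snd v"] by (auto simp: mem_Times_iff)
  assume j: "j \<in> {1..n}"
  show "i \<noteq> j \<Longrightarrow> pm (py i t') (px j t) = pm (px j t) (py i t')"
    using i j by (simp add: pm_def px_def py_def y_x V.y_x)
  show "c \<noteq> 0 \<Longrightarrow> \<exists>t'. pm (ph i c) (px j t) = pm (px j t') (ph i c)"
    using i j by (intro exI [of _ "exp (of_int (cartan_B n i j) * ln c) * t"])
      (simp add: pm_def px_def ph_def h_x V.h_x)
  show "chi i (px j t) = (if i = j then t else 0)"
    using V.x_superdiag [OF i j] by (simp add: chi_def px_def)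
qed (auto simp: pm_def V.unitri_mul)

definition wb where "wb is = (word_bar e f is, word_bar V.E V.F is)"
definition wi where "wi is = (word_inv e f is, word_inv V.E V.F is)"

lemma wb_wi [simp]: "pm (wb is) (wi is) = (mat 1, mat 1)" "pm (wi is) (wb is) = (mat 1, mat 1)"
  by (simp_all add: pm_def wb_def wi_def word_bar_inv)

lemma wb_Nil: "wb [] = (mat 1, mat 1)" and wi_Nil: "wi [] = (mat 1, mat 1)"
  by (simp_all add: wb_def wi_def)

lemma wb_Cons: "wb (i # is) = pm (ps i) (wb is)"
  by (simp add: pm_def wb_def ps_def)

lemma wb_snoc: "wb (is @ [i]) = pm (wb is) (ps i)" and wi_snoc: "wi (is @ [i]) = pm (ps' i) (wi is)"
  by (simp_all add: pm_def wb_def wi_def ps_def ps'_def word_bar_append word_inv_append)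

lemma chi_conj_x:
  assumes "reduced n is" "i \<in> {1..n}" "j \<in> {1..n}" "\<not> root_match n (perm_inv n is) j i"
  shows "chi i (pm (pm (wi is) (px j t)) (wb is)) = 0"
  using V.conj_x_entry [OF assms] by (simp add: chi_def pm_def wi_def px_def wb_def)

text \<open>Along a reduced word the root stays positive. Before each new letter i, the conjugate
  has no alpha_i-coordinate, because a matching root would turn the ascent at j into a descent; it
  therefore lies in \<open>R i\<close>, which the lift of s_i conjugates into
  \<open>U\<close>.\<close>

lemma conj_x_U: "reduced n (j # is) \<Longrightarrow> pm (pm (wi is) (px j t)) (wb is) \<in> U"
proof (induction "is" rule: rev_induct)
  case Nil
  then have "j \<in> {1..n}" by (auto simp: reduced_def)
  then show ?case using x_U by (simp add: wi_Nil wb_Nil)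
next
  case (snoc i "is")
  have red: "reduced n (j # is)" using reduced_append(1) [of n "j # is" "[i]"] snoc.prems by simp
  have ij: "i \<in> {1..n}" "j \<in> {1..n}" using reduced_set [OF snoc.prems] by auto
  let ?z = "pm (pm (wi is) (px j t)) (wb is)"
  have "\<not> root_match n (perm_inv n is) j i"
    using root_match_descent [OF ij(1), of "perm_inv n is" j] reduced_Cons_ascent [OF snoc.prems]
    by (auto simp: perm_inv_append perm_inv_Cons)
  then have "chi i ?z = 0" using chi_conj_x [OF reduced_Cons [OF red] ij] by simp
  then obtain r where "r \<in> R i" "?z = r" using U_decomp_left [OF snoc.IH [OF red] ij(1)] ij by auto
  then have "pm (pm (ps' i) ?z) (ps i) \<in> U" using R_conj(1) [OF ij(1)] by simp
  then show ?case by (simp add: wb_snoc wi_snoc assoc)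
qed

end

section \<open>The grading by rho^vee and conjugation of simple root vectors\<close>

lemma sums_Pair: "f sums a \<Longrightarrow> g sums b \<Longrightarrow> (\<lambda>k. (f k, g k)) sums (a, b)"
  unfolding sums_def
proof -
  assume "(\<lambda>n. sum f {..<n}) \<longlonglongrightarrow> a" "(\<lambda>n. sum g {..<n}) \<longlonglongrightarrow> b"
  moreover have "(\<Sum>k<n. (f k, g k)) = (sum f {..<n}, sum g {..<n})" for n
    by (induction n) (simp_all add: zero_prod_def)
  ultimately show "(\<lambda>n. \<Sum>k<n. (f k, g k)) \<longlonglongrightarrow> (a, b)" by (simp add: tendsto_Pair)
qed

lemma tendsto_mmul:
  fixes f g :: "'a \<Rightarrow> 'd::finite cmat"
  assumes "(f \<longlongrightarrow> a) F" "(g \<longlongrightarrow> b) F"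
  shows "((\<lambda>x. f x ** g x) \<longlongrightarrow> a ** b) F"
  unfolding matrix_matrix_mult_def
  by (intro tendsto_vec_lambda tendsto_sum tendsto_mult tendsto_vec_nth assms)

lemma one_param_difference_quotient:
  "((\<lambda>t. cscale (1 / t) (one_param A t - mat 1)) \<longlongrightarrow> A) (at 0)"
proof (intro vec_tendstoI)
  fix r s
  have "((\<lambda>t. one_param A t $ r $ s) has_field_derivative A $ r $ s) (at 0)"
    using one_param_mderiv_left [of A 0] by (simp add: has_mderiv_def)
  then show "((\<lambda>t. cscale (1 / t) (one_param A t - mat 1) $ r $ s) \<longlongrightarrow> A $ r $ s) (at 0)"
    by (simp add: DERIV_def)
qed

lemma one_param_weight:
  fixes H B :: "'d::finite cmat"
  assumes "H ** B - B ** H = cscale c B"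
  shows "one_param H s ** B = cscale (exp (c * s)) (B ** one_param H s)"
proof -
  have "H ** B = B ** (H + cscale c (mat 1))"
    using assms by (simp add: mat_algebra algebra_simps)
  from one_param_intertwine [OF this, of s] show ?thesis
    by (simp add: one_param_shift mat_algebra)
qed

lemma scaleR_mmul: "(r *\<^sub>R A) ** B = r *\<^sub>R (A ** (B :: 'd::finite cmat))"
  "A ** (r *\<^sub>R B) = r *\<^sub>R (A ** (B :: 'd::finite cmat))"
  by (simp_all add: vec_eq_iff mmul_nth scaleR_sum_right)

lemma scaleR_cscale: "r *\<^sub>R cscale c A = cscale (of_real r * c) A"
  by (simp only: vec_eq_iff vector_scaleR_component cscale_nth) (simp add: scaleR_conv_of_real)

lemma tendsto_cscale_zero: "(f \<longlongrightarrow> 0) F \<Longrightarrow> ((\<lambda>s. cscale (f s) A) \<longlongrightarrow> 0) F"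
  by (intro vec_tendstoI) (use tendsto_mult_left_zero in simp)

lemma mpow_mprod: "mpow A k = mprod (replicate k A)"
  by (induction k) simp_all

context chevalley_system begin

lemma weight_mprod:
  assumes H: "\<And>i. i \<in> {1..n} \<Longrightarrow> H ** e i - e i ** H = e i" and ks: "set ks \<subseteq> {1..n}"
  shows "H ** mprod (map e ks) - mprod (map e ks) ** H = cscale (of_nat (length ks)) (mprod (map e ks))"
  using ks
proof (induction ks)
  case (Cons k ks)
  let ?M = "mprod (map e ks)"
  have eH: "H ** e k = e k ** H + e k" using H [of k] Cons.prems by (simp add: algebra_simps)
  have MH: "H ** ?M = ?M ** H + cscale (of_nat (length ks)) ?M" using Cons by (simp add: algebra_simps)
  have "H ** (e k ** ?M) = (H ** e k) ** ?M" by (simp add: matrix_mul_assoc)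
  also have "\<dots> = e k ** (H ** ?M) + e k ** ?M" by (simp add: eH mat_algebra)
  also have "\<dots> = e k ** ?M ** H + cscale (of_nat (Suc (length ks))) (e k ** ?M)"
    by (simp add: MH mat_algebra) (simp add: vec_eq_iff algebra_simps)
  finally show ?case by simp
qed simp

lemma hsum_conj:
  assumes "set is \<subseteq> {1..n}"
  shows "hsum m ** word_inv e f is = word_inv e f is ** hsum (foldr (coweight_refl n) is m)"
proof -
  let ?W = "word_bar e f is" and ?W' = "word_inv e f is" and ?H' = "hsum (foldr (coweight_refl n) is m)"
  have "?W' ** (?W ** hsum m) ** ?W' = ?W' ** (?H' ** ?W) ** ?W'"
    by (simp only: word_bar_hsum [OF assms])
  moreover have "?W' ** (?W ** hsum m) ** ?W' = hsum m ** ?W'"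
    by (simp add: matrix_mul_assoc word_bar_inv)
  moreover have "?W' ** (?H' ** ?W) ** ?W' = ?W' ** ?H'"
    by (simp add: word_bar_inv flip: matrix_mul_assoc)
  ultimately show ?thesis by simp
qed

text \<open>The conjugated root vector is again an eigenvector; the eigenvalue is left implicit here
  and identified in \<open>conj_e\<close> by a look at the vector representation.\<close>

lemma hsum_conj_e:
  assumes "is": "set is \<subseteq> {1..n}" and j: "j \<in> {1..n}"
  defines "Z \<equiv> word_inv e f is ** e j ** word_bar e f is"
  shows "hsum m ** Z - Z ** hsum m =
    cscale (\<Sum>l\<in>{1..n}. foldr (coweight_refl n) is m l * of_int (cartan_B n l j)) Z"
proof -
  let ?W = "word_bar e f is" and ?W' = "word_inv e f is" and ?H' = "hsum (foldr (coweight_refl n) is m)"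
  have "hsum m ** Z = ?W' ** (?H' ** e j) ** ?W"
    unfolding Z_def using hsum_conj [OF "is", of m] by (simp add: matrix_mul_assoc)
  moreover have "Z ** hsum m = ?W' ** (e j ** ?H') ** ?W"
    unfolding Z_def using word_bar_hsum [OF "is", of m] by (simp flip: matrix_mul_assoc)
  ultimately have "hsum m ** Z - Z ** hsum m = ?W' ** (?H' ** e j - e j ** ?H') ** ?W"
    by (simp add: mat_algebra)
  then show ?thesis unfolding hsum_e [OF j] Z_def by (simp add: mat_algebra)
qed

end

context vector_rep begin

lemma E_superdiag:
  assumes ij: "i \<in> {1..n}" "j \<in> {1..n}"
  shows "E j $ \<iota> i $ \<iota> (i + 1) = (if i = j then 1 else 0)"
proof -
  have r: "i \<in> {1..CARD('m)}" "i + 1 \<in> {1..CARD('m)}" "j \<in> {1..CARD('m)}" "j + 1 \<in> {1..CARD('m)}"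
     "2*n+1-j \<in> {1..CARD('m)}" "2*n+2-j \<in> {1..CARD('m)}"
    using index_range [OF ij(1)] index_range [OF ij(2)] by auto
  have "i \<noteq> 2*n+1-j" using ij by auto
  then show ?thesis
    unfolding E_def using el_\<iota> [OF r(3,4,1,2)] el_\<iota> [OF r(5,6,1,2)] by auto
qed

end

context paired begin

definition pscale :: "complex \<Rightarrow> 'd cmat \<times> 'm cmat \<Rightarrow> 'd cmat \<times> 'm cmat" where
  "pscale c p = (cscale c (fst p), cscale c (snd p))"

definition monomial :: "nat list \<Rightarrow> 'd cmat \<times> 'm cmat" where
  "monomial ks = (mprod (map e ks), mprod (map V.E ks))"

text \<open>A filtration by the number of factors \<open>e i\<close>. The span is real, so complex
  coefficients enter through \<open>pscale\<close>; as a finite-dimensional subspace it is closed,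
  which allows passage to limits.\<close>

definition mspan :: "nat \<Rightarrow> ('d cmat \<times> 'm cmat) set" where
  "mspan k = span {pscale c (monomial ks) |c ks. set ks \<subseteq> {1..n} \<and> k \<le> length ks}"

lemma pm_add: "pm (p + q) w = pm p w + pm q w" "pm w (p + q) = pm w p + pm w q"
  by (simp_all add: pm_def matrix_add_ldistrib matrix_add_rdistrib)

lemma pm_diff: "pm (p - q) w = pm p w - pm q w" "pm w (p - q) = pm w p - pm w q"
  by (simp_all add: pm_def matrix_sub_ldistrib matrix_sub_rdistrib)

lemma pm_scaleR: "pm (r *\<^sub>R p) w = r *\<^sub>R pm p w" "pm w (r *\<^sub>R p) = r *\<^sub>R pm w p"
  by (simp_all add: pm_def scaleR_mmul)

lemma pm_zero: "pm 0 w = 0" "pm w 0 = 0"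
  by (simp_all add: pm_def zero_prod_def)

lemma pscale_add: "pscale c (p + q) = pscale c p + pscale c q"
  by (simp add: pscale_def cscale_add)

lemma pscale_scaleR: "pscale c (r *\<^sub>R p) = r *\<^sub>R pscale c p"
  by (simp add: pscale_def vec_eq_iff)

lemma pscale_zero [simp]: "pscale c 0 = 0"
  by (simp add: pscale_def zero_prod_def)

lemma pscale_pscale: "pscale a (pscale b p) = pscale (a * b) p"
  by (simp add: pscale_def cscale_cscale)

lemma pm_pscale: "pm (pscale c p) w = pscale c (pm p w)" "pm w (pscale c p) = pscale c (pm w p)"
  by (simp_all add: pm_def pscale_def mat_algebra)

lemma monomial_append: "pm (monomial ks) (monomial ls) = monomial (ks @ ls)"
  by (simp add: pm_def monomial_def mprod_append)

lemma mspan_gen: "set ks \<subseteq> {1..n} \<Longrightarrow> k \<le> length ks \<Longrightarrow> pscale c (monomial ks) \<in> mspan k"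
  unfolding mspan_def by (rule span_base) blast

lemma mspan_least:
  assumes "subspace S" "\<And>c ks. set ks \<subseteq> {1..n} \<Longrightarrow> k \<le> length ks \<Longrightarrow> pscale c (monomial ks) \<in> S"
  shows "mspan k \<subseteq> S"
  unfolding mspan_def by (rule span_minimal) (use assms in auto)

lemma subspace_mspan: "subspace (mspan k)"
  by (simp add: mspan_def)

lemma closed_mspan: "closed (mspan k)"
  by (simp add: mspan_def)

lemma mspan_pscale: assumes "p \<in> mspan k" shows "pscale c p \<in> mspan k"
proof -
  have "mspan k \<subseteq> {p. pscale c p \<in> mspan k}"
  proof (rule mspan_least)
    show "subspace {p. pscale c p \<in> mspan k}"
      using subspace_mspan unfolding subspace_def by (simp add: pscale_add pscale_scaleR)
  qed (auto simp: pscale_pscale mspan_gen)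
  then show ?thesis using assms by blast
qed

lemma mspan_mul: assumes "p \<in> mspan k" "q \<in> mspan k" shows "pm p q \<in> mspan k"
proof -
  have *: "pm (pscale c (monomial ks)) q \<in> mspan k"
    if ks: "set ks \<subseteq> {1..n}" "k \<le> length ks" and q: "q \<in> mspan k" for c ks q
  proof -
    have "mspan k \<subseteq> {q. pm (pscale c (monomial ks)) q \<in> mspan k}"
    proof (rule mspan_least)
      show "subspace {q. pm (pscale c (monomial ks)) q \<in> mspan k}"
        using subspace_mspan unfolding subspace_def by (simp add: pm_add pm_scaleR pm_zero)
    qed (use ks in \<open>simp add: pm_pscale monomial_append pscale_pscale mspan_gen\<close>)
    then show ?thesis using q by blast
  qed
  have "mspan k \<subseteq> {p. pm p q \<in> mspan k}"
  proof (rule mspan_least)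
    show "subspace {p. pm p q \<in> mspan k}"
      using subspace_mspan unfolding subspace_def by (simp add: pm_add pm_scaleR pm_zero)
  qed (use * assms(2) in auto)
  then show ?thesis using assms(1) by blast
qed

text \<open>The partial sums of the exponential series without its constant term lie in the closed
  subspace \<open>mspan 1\<close>.\<close>

lemma px_mspan: assumes i: "i \<in> {1..n}" shows "px i t - (mat 1, mat 1) \<in> mspan 1"
proof -
  define T where "T k = (1 / fact k) *\<^sub>R pscale (t ^ k) (monomial (replicate k i))" for k
  have T: "T k = ((1 / fact k) *\<^sub>R mpow (cscale t (e i)) k, (1 / fact k) *\<^sub>R mpow (cscale t (V.E i)) k)" for k
    by (simp add: T_def pscale_def monomial_def mpow_cscale) (simp add: mpow_mprod)
  have "T sums px i t" unfolding T px_def by (intro sums_Pair one_param_sums)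
  then have "(\<lambda>k. T (Suc k)) sums (px i t - T 0)" by (simp add: sums_Suc_iff)
  moreover have "T 0 = (mat 1, mat 1)" by (simp add: T)
  ultimately have lim: "(\<lambda>N. \<Sum>k<N. T (Suc k)) \<longlonglongrightarrow> px i t - (mat 1, mat 1)" by (simp add: sums_def)
  have "(\<Sum>k<N. T (Suc k)) \<in> mspan 1" for N
    unfolding T_def
    by (intro subspace_sum subspace_scale subspace_mspan mspan_gen) (use i in auto)
  then show ?thesis by (rule closed_sequentially [OF closed_mspan _ lim])
qed

lemma U_mspan: assumes "u \<in> U" shows "u - (mat 1, mat 1) \<in> mspan 1"
proof -
  have "u - (mat 1, mat 1) \<in> mspan 1" if "u \<in> U0" for u
    using that
  proof (induction rule: U0.induct)
    case one
    then show ?case using subspace_0 [OF subspace_mspan] by simp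
  next
    case (step i u t)
    let ?o = "(mat 1, mat 1) :: 'd cmat \<times> 'm cmat"
    have eq: "pm (px i t) u - ?o = pm (px i t - ?o) (u - ?o) + (px i t - ?o) + (u - ?o)"
      by (simp add: pm_diff)
    show ?case unfolding eq by (intro subspace_add [OF subspace_mspan] mspan_mul px_mspan step)
  qed
  then have "U0 \<subseteq> (\<lambda>u. u - (mat 1, mat 1)) -` mspan 1" by auto
  moreover have "closed ((\<lambda>u. u - (mat 1, mat 1)) -` mspan 1)"
    by (intro closed_vimage closed_mspan continuous_intros)
  ultimately show ?thesis using assms closure_minimal unfolding U_def by blast
qed

text \<open>The root vector is the derivative of x_j(t) at 0, and the conjugated curve stays in
  \<open>U\<close>, hence within 1 + \<open>mspan 1\<close>.\<close>

lemma conj_e_mspan: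
  assumes "reduced n (j # is)"
  shows "pm (pm (wi is) (e j, V.E j)) (wb is) \<in> mspan 1"
proof (rule Lim_in_closed_set [OF closed_mspan _ at_neq_bot])
  let ?f = "\<lambda>t. pm (pm (wi is) (pscale (1 / t) (px j t - (mat 1, mat 1)))) (wb is)"
  have "?f t = pscale (1 / t) (pm (pm (wi is) (px j t)) (wb is) - (mat 1, mat 1))" for t
    by (simp add: pm_pscale pm_diff)
  then have "?f t \<in> mspan 1" for t
    using mspan_pscale [OF U_mspan [OF conj_x_U [OF assms]]] by simp
  then show "\<forall>\<^sub>F t in at 0. ?f t \<in> mspan 1" by simp
  show "(?f \<longlongrightarrow> pm (pm (wi is) (e j, V.E j)) (wb is)) (at 0)"
    unfolding pm_def pscale_def px_def
    by (simp, intro tendsto_Pair tendsto_mmul tendsto_const one_param_difference_quotient)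
qed

lemma mspan_split:
  assumes "Z \<in> mspan 1"
  shows "\<exists>q b. b \<in> mspan 2 \<and> Z = (\<Sum>i\<in>{1..n}. pscale (q i) (e i, V.E i)) + b"
proof -
  let ?L = "\<lambda>q. \<Sum>i\<in>{1..n}. pscale (q i) (e i, V.E i)"
  let ?S = "{Z. \<exists>q b. b \<in> mspan 2 \<and> Z = ?L q + b}"
  have L0: "?L (\<lambda>_. 0) = 0" by (simp add: pscale_def prod_eq_iff fst_sum snd_sum)
  have S: "Z \<in> ?S" if "b \<in> mspan 2" "Z = ?L q + b" for Z q b
    by (rule CollectI, rule exI [of _ q], rule exI [of _ b]) (simp add: that)
  have "mspan 1 \<subseteq> ?S"
  proof (rule mspan_least)
    show "subspace ?S"
      unfolding subspace_def
    proof (intro conjI ballI allI)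
      show "0 \<in> ?S" by (rule S [of 0 _ "\<lambda>_. 0"]) (simp_all only: L0 add_0 subspace_0 [OF subspace_mspan])
    next
      fix Z Z' assume "Z \<in> ?S" "Z' \<in> ?S"
      then obtain q b q' b' where Z: "b \<in> mspan 2" "Z = ?L q + b" "b' \<in> mspan 2" "Z' = ?L q' + b'" by blast
      have "pscale (c + c') p = pscale c p + pscale c' p" for c c' p
        by (simp add: pscale_def vec_eq_iff distrib_right)
      then have eq: "Z + Z' = ?L (\<lambda>i. q i + q' i) + (b + b')"
        unfolding Z by (simp add: sum.distrib)
      show "Z + Z' \<in> ?S" by (rule S [OF _ eq]) (intro subspace_add subspace_mspan Z)
    next
      fix r Z assume "Z \<in> ?S"
      then obtain q b where Z: "b \<in> mspan 2" "Z = ?L q + b" by blast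
      have "r *\<^sub>R pscale c p = pscale (of_real r * c) p" for c p
        by (simp add: pscale_def scaleR_cscale)
      then have eq: "r *\<^sub>R Z = ?L (\<lambda>i. of_real r * q i) + r *\<^sub>R b"
        unfolding Z by (simp add: scaleR_add_right scaleR_sum_right)
      show "r *\<^sub>R Z \<in> ?S" by (rule S [OF _ eq]) (intro subspace_scale subspace_mspan Z)
    qed
    fix c ks assume ks: "set ks \<subseteq> {1..n}" "1 \<le> length ks"
    show "pscale c (monomial ks) \<in> ?S"
    proof (cases "length ks = 1")
      case True
      then obtain i where i: "ks = [i]" by (cases ks) auto
      have "?L (\<lambda>j. if j = i then c else 0) = (\<Sum>j\<in>{1..n}. if j = i then pscale c (e i, V.E i) else 0)"
        by (intro sum.cong) (auto simp: pscale_def zero_prod_def)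
      also have "\<dots> = pscale c (monomial ks)" using ks i by (simp add: monomial_def)
      finally have "pscale c (monomial ks) = ?L (\<lambda>j. if j = i then c else 0) + 0" by simp
      then show ?thesis by (rule S [OF subspace_0 [OF subspace_mspan]])
    next
      case False
      then have "pscale c (monomial ks) \<in> mspan 2" using ks by (intro mspan_gen) auto
      moreover have "pscale c (monomial ks) = ?L (\<lambda>_. 0) + pscale c (monomial ks)" by (simp only: L0 add_0)
      ultimately show ?thesis by (rule S)
    qed
  qed
  then show ?thesis using assms by blast
qed

text \<open>Conjugation by \<open>exp(-s\<rho>\<^sup>\<or>)\<close> scales monomials of length \<open>L\<close> by \<open>e\<^sup>-\<^sup>L\<^sup>s\<close>; a vector of weight one in
  \<open>mspan 2\<close> is thus a limit of zero.\<close>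

lemma mspan_weight_one:
  assumes H: "\<And>i. i \<in> {1..n} \<Longrightarrow> H ** e i - e i ** H = e i"
    and H': "\<And>i. i \<in> {1..n} \<Longrightarrow> H' ** V.E i - V.E i ** H' = V.E i"
    and b: "b \<in> mspan 2" and w: "pm (H, H') b - pm b (H, H') = b"
  shows "b = 0"
proof -
  define T where "T s = (one_param H (of_real s), one_param H' (of_real s))" for s :: real
  \<comment> \<open>The extra factor exp s makes \<Phi> the identity in weight one, while weight L
    is scaled by exp(s(1-L)), which tends to 0 for L at least 2.\<close>
  define \<Phi> where "\<Phi> s p = pscale (of_real (exp s)) (pm (pm (T (- s)) p) (T s))" for s p
  have TT: "pm (T (- s)) (T s) = (mat 1, mat 1)" for s by (simp add: T_def pm_def)
  have weight: "\<Phi> s p = pscale (of_real (exp (s * (1 - real L)))) p"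
    if "H ** fst p - fst p ** H = cscale (of_nat L) (fst p)" "H' ** snd p - snd p ** H' = cscale (of_nat L) (snd p)"
    for s p L
  proof -
    have "pm (T (- s)) p = pscale (exp (of_nat L * of_real (- s))) (pm p (T (- s)))"
      using one_param_weight [OF that(1), of "of_real (- s)"] one_param_weight [OF that(2), of "of_real (- s)"]
      by (simp add: T_def pm_def pscale_def)
    moreover have "pm (T (- s)) (T s) = (mat 1, mat 1)" by (rule TT)
    ultimately have "\<Phi> s p = pscale (of_real (exp s) * exp (of_nat L * of_real (- s))) p"
      by (simp add: \<Phi>_def pm_pscale pscale_pscale assoc)
    also have "of_real (exp s) * exp (of_nat L * of_real (- s)) = (of_real (exp (s * (1 - real L))) :: complex)"
    proof -
      have "(of_real (exp s) * exp (of_nat L * of_real (- s)) :: complex) = of_real (exp s * exp (real L * (- s)))"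
        by (simp flip: exp_of_real)
      then show ?thesis by (simp add: algebra_simps flip: exp_add)
    qed
    finally show ?thesis .
  qed
  have "mspan 2 \<subseteq> {p. ((\<lambda>s. \<Phi> s p) \<longlongrightarrow> 0) at_top}"
  proof (rule mspan_least)
    have add: "\<Phi> s (p + q) = \<Phi> s p + \<Phi> s q" and scale: "\<Phi> s (r *\<^sub>R p) = r *\<^sub>R \<Phi> s p" and zero: "\<Phi> s 0 = 0" for s p q r
      by (simp_all add: \<Phi>_def pm_add pscale_add pm_scaleR pscale_scaleR pm_zero)
    show "subspace {p. ((\<lambda>s. \<Phi> s p) \<longlongrightarrow> 0) at_top}"
      unfolding subspace_def
    proof (intro conjI ballI allI)
      fix p q r
      assume "p \<in> {p. ((\<lambda>s. \<Phi> s p) \<longlongrightarrow> 0) at_top}"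
      then have p: "((\<lambda>s. \<Phi> s p) \<longlongrightarrow> 0) at_top" by simp
      show "r *\<^sub>R p \<in> {p. ((\<lambda>s. \<Phi> s p) \<longlongrightarrow> 0) at_top}"
        using tendsto_scaleR [OF tendsto_const p, of r] by (simp add: scale)
      assume "q \<in> {p. ((\<lambda>s. \<Phi> s p) \<longlongrightarrow> 0) at_top}"
      then show "p + q \<in> {p. ((\<lambda>s. \<Phi> s p) \<longlongrightarrow> 0) at_top}"
        using tendsto_add [OF p, of "\<lambda>s. \<Phi> s q" 0] by (simp add: add)
    qed (simp add: zero)
    fix c ks assume ks: "set ks \<subseteq> {1..n}" "2 \<le> length ks"
    let ?p = "pscale c (monomial ks)"
    have "H ** fst ?p - fst ?p ** H = cscale (of_nat (length ks)) (fst ?p)"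
      "H' ** snd ?p - snd ?p ** H' = cscale (of_nat (length ks)) (snd ?p)"
      using weight_mprod [OF H ks(1)] V.weight_mprod [OF H' ks(1)]
      by (simp_all add: pscale_def monomial_def mat_algebra mult.commute flip: cscale_diff)
    from weight [OF this] have "\<Phi> s ?p = pscale (of_real (exp (s * (1 - real (length ks))))) ?p" for s .
    moreover have "((\<lambda>s. pscale (of_real (exp (s * (1 - real (length ks))))) ?p) \<longlongrightarrow> 0) at_top"
    proof -
      have "filterlim (\<lambda>s. (1 - real (length ks)) * s) at_bot at_top"
        by (rule filterlim_tendsto_neg_mult_at_bot [OF tendsto_const _ filterlim_ident]) (use ks in auto)
      then have "filterlim (\<lambda>s. s * (1 - real (length ks))) at_bot at_top" by (simp add: mult.commute)
      then have "((\<lambda>s. exp (s * (1 - real (length ks)))) \<longlongrightarrow> 0) at_top"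
        by (rule filterlim_compose [OF exp_at_bot])
      then have z: "((\<lambda>s. of_real (exp (s * (1 - real (length ks)))) :: complex) \<longlongrightarrow> 0) at_top"
        using tendsto_of_real [where 'a = complex] by fastforce
      then show ?thesis
        unfolding pscale_def zero_prod_def by (intro tendsto_Pair tendsto_cscale_zero)
    qed
    ultimately show "?p \<in> {p. ((\<lambda>s. \<Phi> s p) \<longlongrightarrow> 0) at_top}" by simp
  qed
  then have "((\<lambda>s. \<Phi> s b) \<longlongrightarrow> 0) at_top" using b by blast
  moreover have "\<Phi> s b = b" for s
  proof -
    have "H ** fst b - fst b ** H = cscale (of_nat 1) (fst b)" "H' ** snd b - snd b ** H' = cscale (of_nat 1) (snd b)"
      using w by (simp_all add: pm_def prod_eq_iff)
    from weight [OF this, of s] show ?thesis by (simp add: pscale_def)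
  qed
  ultimately show ?thesis using tendsto_unique [OF trivial_limit_at_top_linorder tendsto_const] by simp
qed

text \<open>Weight considerations leave a combination of the \<open>e i\<close>; its coefficients, signs included, are seen
  in the vector representation.\<close>

lemma conj_e:
  assumes n: "n \<ge> 2" and red: "reduced n (j # is)" and i: "i \<in> {1..n}" and m: "root_match n (perm_inv n is) j i"
  shows "word_inv e f is ** e j ** word_bar e f is = e i"
proof -
  have j: "j \<in> {1..n}" and sub: "set is \<subseteq> {1..n}" using reduced_set [OF red] by auto
  let ?Z = "pm (pm (wi is) (e j, V.E j)) (wb is)"
  let ?m = "rho_coords n"
  have ZV: "snd ?Z = V.E i"
    using V.word_inv_E [OF reduced_Cons [OF red] i j m]
    by (simp add: pm_def wi_def wb_def word_bar_inv flip: matrix_mul_assoc)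
  have Z: "fst ?Z = word_inv e f is ** e j ** word_bar e f is" by (simp add: pm_def wi_def wb_def)
  define \<alpha> where "\<alpha> = (\<Sum>l\<in>{1..n}. foldr (coweight_refl n) is ?m l * of_int (cartan_B n l j))"
  have w: "hsum ?m ** fst ?Z - fst ?Z ** hsum ?m = cscale \<alpha> (fst ?Z)"
    "V.hsum ?m ** snd ?Z - snd ?Z ** V.hsum ?m = cscale \<alpha> (snd ?Z)"
    using hsum_conj_e [OF sub j, of ?m] V.hsum_conj_e [OF sub j, of ?m]
    unfolding \<alpha>_def by (simp_all add: pm_def wi_def wb_def)
  have H: "hsum ?m ** e k - e k ** hsum ?m = e k" and H': "V.hsum ?m ** V.E k - V.E k ** V.hsum ?m = V.E k"
    if "k \<in> {1..n}" for k
    using hsum_e [OF that, of ?m] V.hsum_e [OF that, of ?m] rho_coords_cartan [OF n that] by simp_all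
  \<comment> \<open>The weight of \<open>?Z\<close> is determined in the vector representation,
    where the conjugate is already known to be \<open>V.E i\<close>.\<close>
  have "V.E i = cscale \<alpha> (V.E i)" using w(2) H' [OF i] unfolding ZV by simp
  then have "V.E i $ \<iota> i $ \<iota> (i + 1) = \<alpha> * V.E i $ \<iota> i $ \<iota> (i + 1)" by (metis cscale_nth)
  then have \<alpha>: "\<alpha> = 1" using V.E_superdiag [OF i i] by simp
  obtain q b where b: "b \<in> mspan 2" "?Z = (\<Sum>k\<in>{1..n}. pscale (q k) (e k, V.E k)) + b"
    using mspan_split [OF conj_e_mspan [OF red]] by blast
  let ?H = "(hsum ?m, V.hsum ?m)" and ?L = "\<Sum>k\<in>{1..n}. pscale (q k) (e k, V.E k)"
  have bZ: "b = ?Z - ?L" using b(2) by simp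
  have "pm ?H (pscale c (e k, V.E k)) - pm (pscale c (e k, V.E k)) ?H = pscale c (e k, V.E k)"
    if "k \<in> {1..n}" for c k
    using H [OF that] H' [OF that] by (simp add: pm_def pscale_def mat_algebra flip: cscale_diff)
  moreover have "pm ?H (\<Sum>k\<in>S. g k) = (\<Sum>k\<in>S. pm ?H (g k))" "pm (\<Sum>k\<in>S. g k) ?H = (\<Sum>k\<in>S. pm (g k) ?H)" for g and S :: "nat set"
    by (induction S rule: infinite_finite_induct) (simp_all add: pm_add pm_zero)
  ultimately have "pm ?H ?L - pm ?L ?H = ?L"
    by (simp add: sum_subtractf [symmetric])
  moreover have "pm ?H ?Z - pm ?Z ?H = ?Z"
    using w unfolding \<alpha> by (simp add: pm_def [of ?H] pm_def [of _ ?H] prod_eq_iff)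
  ultimately have "pm ?H b - pm b ?H = b" unfolding bZ by (simp add: pm_diff algebra_simps)
  then have "b = 0" using mspan_weight_one [OF H H' b(1)] by blast
  then have Zq: "?Z = ?L" using b(2) by simp
  \<comment> \<open>The entry (k, k+1) isolates the coefficient of \<open>V.E k\<close>; since the
    pairs share their coefficients, this also determines them in the given representation.\<close>
  have q: "q k = (if k = i then 1 else 0)" if k: "k \<in> {1..n}" for k
  proof -
    have "V.E i $ \<iota> k $ \<iota> (k + 1) = (\<Sum>l\<in>{1..n}. q l * V.E l $ \<iota> k $ \<iota> (k + 1))"
      unfolding ZV [symmetric] Zq by (simp add: snd_sum pscale_def)
    also have "\<dots> = (\<Sum>l\<in>{1..n}. if k = l then q l else 0)"
      using V.E_superdiag [OF k] by (intro sum.cong) auto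
    also have "\<dots> = q k" using k by simp
    finally show ?thesis using V.E_superdiag [OF k i] by simp
  qed
  have "fst ?Z = (\<Sum>k\<in>{1..n}. cscale (q k) (e k))" unfolding Zq by (simp add: fst_sum pscale_def)
  also have "\<dots> = (\<Sum>k\<in>{1..n}. if k = i then e i else 0)" by (intro sum.cong) (auto simp: q)
  also have "\<dots> = e i" using i by simp
  finally show ?thesis using Z by simp
qed

end

text \<open>A list of letters with parameters, so that decompositions can be built by induction
  along the reduced word.\<close>

definition theta :: "(nat \<Rightarrow> 'd::finite cmat) \<Rightarrow> (nat \<Rightarrow> 'd cmat) \<Rightarrow> (nat \<times> complex) list \<Rightarrow> 'd cmat" where
  "theta f h ks = mprod (map (\<lambda>(i, c). bold_y f h i c) ks)"

lemma theta_simps [simp]: "theta f h [] = mat 1" "theta f h ((i, c) # ks) = bold_y f h i c ** theta f h ks"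
  by (simp_all add: theta_def)

section \<open>Independence of the lift from the reduced word\<close>

context paired begin

lemma opposite_paired: "paired n (\<lambda>i. - f i) (\<lambda>i. - e i) (\<lambda>i. - h i) \<iota>"
  by (intro paired.intro opposite V.vector_rep_axioms)

lemma conj_f:
  assumes n: "n \<ge> 2" and red: "reduced n (j # is)" and i: "i \<in> {1..n}" and m: "root_match n (perm_inv n is) j i"
  shows "word_inv e f is ** f j ** word_bar e f is = f i"
proof -
  have "set is \<subseteq> {1..n}" using reduced_set [OF red] by auto
  then show ?thesis
    using paired.conj_e [OF opposite_paired assms] by (simp add: word_inv_opposite word_bar_opposite mat_algebra)
qed

text \<open>As both root vectors are carried over with coefficient exactly 1, their exponentials are
  too, and with them \<open>sbar\<close>.\<close>

lemma conj_sbar: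
  assumes n: "n \<ge> 2" and red: "reduced n (j # is)" and i: "i \<in> {1..n}" and m: "root_match n (perm_inv n is) j i"
  shows "sbar e f j ** word_bar e f is = word_bar e f is ** sbar e f i"
proof -
  let ?W = "word_bar e f is" and ?W' = "word_inv e f is"
  have "A ** ?W = ?W ** B" if "?W' ** A ** ?W = B" for A B
    unfolding that [symmetric] by (simp add: matrix_mul_assoc word_bar_inv)
  from this [OF conj_e [OF assms]] this [OF conj_f [OF assms]]
  have "one_param (e j) t ** ?W = ?W ** one_param (e i) t" "one_param (f j) t ** ?W = ?W ** one_param (f i) t" for t
    by (blast intro: one_param_intertwine)+
  then show ?thesis by (simp add: sbar_def) (simp add: matrix_mul_assoc [symmetric], simp add: matrix_mul_assoc)
qed

text \<open>The exchange condition holds for lifts, without signs: up to the crossing letter, the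
  prefix carries \<open>sbar\<close> of j over to \<open>sbar\<close> of i.\<close>

lemma exchange_word_bar:
  assumes n: "n \<ge> 2" and red: "reduced n is" and j: "j \<in> {1..n}" and desc: "perm_inv n is (j + 1) < perm_inv n is j"
  shows "\<exists>ls. length is = Suc (length ls) \<and> reduced n (j # ls) \<and> perm_inv n is = perm_inv n (j # ls) \<and>
    word_bar e f is = sbar e f j ** word_bar e f ls"
proof -
  have sub: "set is \<subseteq> {1..n}" by (rule reduced_set [OF red])
  obtain xs i ys where split: "is = xs @ i # ys" and m: "root_match n (perm_inv n xs) j i"
    using exchange_position [OF sub j desc] by blast
  have i: "i \<in> {1..n}" and subs: "set xs \<subseteq> {1..n}" "set ys \<subseteq> {1..n}" using sub split by auto
  have "perm_inv n xs j < perm_inv n xs (j + 1)" using m by (auto simp: root_match_def)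
  then have "reduced n (j # xs)" using reduced_append(1) red split by (intro reduced_ConsI j) blast
  then have "sbar e f j ** word_bar e f xs = word_bar e f xs ** sbar e f i" by (rule conj_sbar [OF n _ i m])
  then have W: "word_bar e f is = sbar e f j ** word_bar e f (xs @ ys)"
    by (simp add: split word_bar_append matrix_mul_assoc)
  have eq: "perm_inv n is = perm_inv n (j # xs @ ys)"
    using perm_inv_exchange [of xs i ys n j] sub split j m by simp
  have "reduced n (j # xs @ ys)"
    unfolding reduced_def using reducedD [OF red] eq split subs j by auto
  then show ?thesis using W eq split by (intro exI [of _ "xs @ ys"]) simp
qed

text \<open>Takes the place of braid relations: exchange moves the first letter of one word to the
  front of the other, and the remaining words agree by induction.\<close>

lemma word_bar_unique:
  assumes n: "n \<ge> 2"
  shows "reduced n is \<Longrightarrow> reduced n js \<Longrightarrow> perm_inv n is = perm_inv n js \<Longrightarrow> word_bar e f is = word_bar e f js"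
proof (induction js arbitrary: "is")
  case Nil
  have "length is = length ([] :: nat list)" by (rule reduced_length_eq [OF Nil.prems])
  then show ?case by simp
next
  case (Cons j js)
  have j: "j \<in> {1..n}" and sub: "set js \<subseteq> {1..n}" using reduced_set [OF Cons.prems(2)] by auto
  have "perm_inv n is (j + 1) < perm_inv n is j"
    using perm_inv_Cons_descent [OF sub j reduced_Cons_ascent [OF Cons.prems(2)]] Cons.prems(3) by simp
  then obtain ls where ls: "reduced n (j # ls)" "perm_inv n is = perm_inv n (j # ls)"
      "word_bar e f is = sbar e f j ** word_bar e f ls"
    using exchange_word_bar [OF n Cons.prems(1) j] by blast
  have "perm_inv n (j # ls) = perm_inv n (j # js)" using ls(2) Cons.prems(3) by simp
  then have "perm_inv n (j # j # ls) = perm_inv n (j # j # js)" by (simp add: perm_inv_Cons)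
  then have "perm_inv n ls = perm_inv n js" by (simp only: perm_inv_Cons_Cons [OF j])
  then have "word_bar e f ls = word_bar e f js"
    using Cons.IH [OF reduced_Cons [OF ls(1)] reduced_Cons [OF Cons.prems(2)]] by simp
  then show ?case by (simp add: ls(3))
qed

subsection \<open>Decomposing the parametrisation\<close>

definition ptheta where "ptheta ks = (theta f h ks, theta V.F V.H ks)"

lemma ptheta_Cons:
  assumes "i \<in> {1..n}" "c \<noteq> 0"
  shows "ptheta ((i, c) # ks) = pm (px i (1 / c)) (pm (ps i) (pm (px i c) (ptheta ks)))"
  using assms by (simp add: ptheta_def pm_def px_def ps_def bold_y_eq V.bold_y_eq matrix_mul_assoc)

text \<open>One letter contributes x_j(1/c) s_j x_j(c). The factor x_j(c) u is split as r x_j(t);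
  conjugating r by s_j keeps it in \<open>U\<close> on the left, while x_j(t) is carried across the
  lift of \<open>is\<close> to the right.\<close>

lemma theta_step:
  assumes red: "reduced n (j # is)" and c: "c \<noteq> 0" and u: "u \<in> U"
  shows "\<exists>u'\<in>U. \<exists>t. pm (px j (1 / c)) (pm (ps j) (pm (px j c) (pm (pm u (wb is)) b))) =
    pm (pm u' (wb (j # is))) (pm (pm (pm (wi is) (px j t)) (wb is)) b)"
proof -
  have j: "j \<in> {1..n}" using reduced_set [OF red] by simp
  have "pm (px j c) u \<in> U" by (intro U_mul x_U j u)
  then obtain r where r: "r \<in> R j" "pm (px j c) u = pm r (px j (chi j (pm (px j c) u)))"
    using U_decomp_right [OF _ j] by blast
  define t where "t = chi j (pm (px j c) u)"
  have "pm (px j c) (pm u (pm (wb is) b)) = pm (pm (px j c) u) (pm (wb is) b)" by (simp only: assoc)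
  also have "pm (px j c) u = pm r (px j t)" using r(2) by (simp only: t_def)
  finally have eq: "pm (px j c) (pm u (pm (wb is) b)) = pm r (pm (px j t) (pm (wb is) b))" by (simp only: assoc)
  have cancel: "pm (ps' j) (pm (ps j) q) = q" "pm (wb is) (pm (wi is) q) = q" for q
    using s_inverse(2) [OF j] by (simp_all flip: assoc)
  let ?u = "pm (px j (1 / c)) (pm (pm (ps j) r) (ps' j))"
  have "?u \<in> U" by (rule U_mul [OF x_U [OF j] R_conj(2) [OF j r(1)]])
  moreover have "pm (px j (1 / c)) (pm (ps j) (pm (px j c) (pm (pm u (wb is)) b))) =
    pm (pm ?u (wb (j # is))) (pm (pm (pm (wi is) (px j t)) (wb is)) b)"
    by (simp add: assoc wb_Cons eq cancel)
  ultimately show ?thesis by blast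
qed

lemma theta_decomp:
  "reduced n (map fst ks) \<Longrightarrow> (\<And>i c. (i, c) \<in> set ks \<Longrightarrow> c \<noteq> 0) \<Longrightarrow>
    \<exists>u\<in>U. \<exists>b\<in>U. ptheta ks = pm (pm u (wb (map fst ks))) b"
proof (induction ks)
  case Nil
  then show ?case using U_one by (auto simp: ptheta_def wb_Nil intro!: bexI [of _ "(mat 1, mat 1)"])
next
  case (Cons ic ks)
  obtain j c where ic: "ic = (j, c)" by force
  have red: "reduced n (j # map fst ks)" using Cons.prems ic by simp
  have c: "c \<noteq> 0" using Cons.prems(2) [of j c] ic by simp
  have j: "j \<in> {1..n}" using reduced_set [OF red] by simp
  obtain u b where ub: "u \<in> U" "b \<in> U" "ptheta ks = pm (pm u (wb (map fst ks))) b"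
    using Cons.IH [OF reduced_Cons [OF red]] Cons.prems(2) by (metis list.set_intros(2))
  obtain u' t where u': "u' \<in> U" "ptheta (ic # ks) = pm (pm u' (wb (j # map fst ks)))
      (pm (pm (pm (wi (map fst ks)) (px j t)) (wb (map fst ks))) b)"
    using theta_step [OF red c ub(1), of b] unfolding ic ptheta_Cons [OF j c] ub(3) by blast
  moreover have "pm (pm (pm (wi (map fst ks)) (px j t)) (wb (map fst ks))) b \<in> U"
    by (intro U_mul conj_x_U red ub)
  ultimately show ?case unfolding ic by auto
qed

text \<open>If the suffix already inverts the \<open>k\<close>-th simple root, prepending further letters of a reduced
  word does not change the \<open>k\<close>-th coordinate of the right-hand unipotent factor.\<close>

lemma theta_extend:
  assumes k: "k \<in> {1..n}"
    and suf: "u \<in> U" "b \<in> U" "ptheta suf = pm (pm u (wb (map fst suf))) b"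
    and inv: "a \<in> {1..2*n+1}" "a' \<in> {1..2*n+1}" "a' < a"
      "perm_inv n (map fst suf) a = k" "perm_inv n (map fst suf) a' = k + 1"
  shows "reduced n (map fst (pre @ suf)) \<Longrightarrow> (\<And>i c. (i, c) \<in> set pre \<Longrightarrow> c \<noteq> 0) \<Longrightarrow>
    \<exists>u\<in>U. \<exists>b'\<in>U. ptheta (pre @ suf) = pm (pm u (wb (map fst (pre @ suf)))) b' \<and> chi k b' = chi k b \<and>
      (\<exists>a\<in>{1..2*n+1}. \<exists>a'\<in>{1..2*n+1}. a' < a \<and> perm_inv n (map fst (pre @ suf)) a = k \<and>
        perm_inv n (map fst (pre @ suf)) a' = k + 1)"
proof (induction pre)
  case Nil
  show ?case
    by (intro bexI [of _ u] bexI [of _ b] conjI bexI [of _ a] bexI [of _ a'])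
      (simp_all only: append_Nil suf inv)
next
  case (Cons ic pre)
  obtain j c where ic: "ic = (j, c)" by force
  let ?is = "map fst (pre @ suf)"
  have red: "reduced n (j # ?is)" using Cons.prems ic by simp
  have c: "c \<noteq> 0" using Cons.prems(2) [of j c] ic by simp
  have j: "j \<in> {1..n}" and sub: "set ?is \<subseteq> {1..n}" using reduced_set [OF red] by auto
  obtain u b' a a' where IH: "u \<in> U" "b' \<in> U" "ptheta (pre @ suf) = pm (pm u (wb ?is)) b'" "chi k b' = chi k b"
      "a \<in> {1..2*n+1}" "a' \<in> {1..2*n+1}" "a' < a" "perm_inv n ?is a = k" "perm_inv n ?is a' = k + 1"
    using Cons.IH [OF reduced_Cons [OF red]] Cons.prems(2) by (metis list.set_intros(2))
  let ?v = "perm_inv n ?is"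
  have inj: "?v p = ?v q \<longleftrightarrow> p = q" for p q using inj_perm_inv [OF sub] by (simp add: inj_eq)
  have mir: "?v p + ?v q = 2*n+2" if "p + q = 2*n+2" "p \<ge> 1" "q \<ge> 1" for p q
    by (rule perm_inv_mirror [OF sub]) (use that in auto)
  have asc: "?v j < ?v (j + 1)" by (rule reduced_Cons_ascent [OF red])
  define q q' where "q = 2*n+2-a" and "q' = 2*n+2-a'"
  have q: "a + q = 2*n+2" "q \<ge> 1" "a' + q' = 2*n+2" "q' \<ge> 1" using IH by (auto simp: q_def q'_def)
  have vq: "k + ?v q = 2*n+2" "k + 1 + ?v q' = 2*n+2"
    using mir [OF q(1)] mir [OF q(3)] q IH by auto
  \<comment> \<open>A match would place k and k+1 at ascending positions j and j+1, up to mirroring,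
    whereas \<open>a' < a\<close> puts them in descending order.\<close>
  have nomatch: "\<not> root_match n ?v j k"
  proof
    assume "root_match n ?v j k"
    then consider "?v j = ?v a" "?v (j + 1) = ?v a'" | "?v j = ?v q'" "?v (j + 1) = ?v q"
      unfolding root_match_def using vq IH by fastforce
    then show False
    proof cases
      case 1
      then have "j = a" "j + 1 = a'" by (simp_all only: inj)
      then show False using IH by simp
    next
      case 2
      then have "j = q'" "j + 1 = q" by (simp_all only: inj)
      then show False using IH q by simp
    qed
  qed
  \<comment> \<open>The new letter could undo the descent only at (j, j+1) or its mirror image, but
    there the values ascend since the word is reduced.\<close>
  have desc: "srefl n j a' < srefl n j a"
  proof (rule ccontr)
    assume "\<not> ?thesis"
    moreover have "srefl n j a' \<noteq> srefl n j a" using injD [OF inj_srefl [OF j], of a' a] IH by auto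
    ultimately have lt: "srefl n j a < srefl n j a'" by simp
    have "a' + a \<noteq> 2*n+2"
    proof
      assume "a' + a = 2*n+2"
      then have "?v a' + ?v a = 2*n+2" using IH by (intro mir) auto
      then have "k + 1 + k = 2*n+2" using IH by simp
      then show False by presburger
    qed
    from srefl_flip [OF j IH(7) lt this]
    consider "a' = j" "a = j + 1" | "a' + j = 2*n+1" "a + j = 2*n+2" by blast
    then show False
    proof cases
      case 1
      then show False using asc IH by simp
    next
      case 2
      then have "q = j" "q' = j + 1" using q by auto
      then show False using asc vq by simp
    qed
  qed
  obtain u' t where u': "u' \<in> U" "ptheta ((ic # pre) @ suf) = pm (pm u' (wb (j # ?is)))
      (pm (pm (pm (wi ?is) (px j t)) (wb ?is)) b')"
    using theta_step [OF red c IH(1), of b'] ptheta_Cons [OF j c, of "pre @ suf"] unfolding ic IH(3) by auto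
  let ?z = "pm (pm (wi ?is) (px j t)) (wb ?is)"
  have z: "?z \<in> U" by (rule conj_x_U [OF red])
  have "chi k (pm ?z b') = chi k b"
    using chi_mul [OF k U_T [OF z] U_T [OF IH(2)]] chi_conj_x [OF reduced_Cons [OF red] k j nomatch] IH(4) by simp
  moreover have "pm ?z b' \<in> U" by (intro U_mul z IH)
  moreover have "srefl n j a \<in> {1..2*n+1}" "srefl n j a' \<in> {1..2*n+1}"
    using srefl_range [OF j] IH by auto
  moreover have "perm_inv n (j # ?is) (srefl n j a) = k" "perm_inv n (j # ?is) (srefl n j a') = k + 1"
    using IH by (simp_all add: perm_inv_Cons srefl_srefl [OF j])
  ultimately show ?case using u' desc unfolding ic
    by (intro bexI [of _ u'] bexI [of _ "pm ?z b'"] conjI bexI [of _ "srefl n j a"] bexI [of _ "srefl n j a'"]) auto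
qed

end

subsection \<open>Rows in the vector representation\<close>

context vector_rep begin

text \<open>Removes the left unipotent factor: its row 2n+1 is a unit vector.\<close>

lemma row_unitri:
  assumes "A \<in> unitri" shows "(A ** B) $ \<iota> (2*n+1) $ s = B $ \<iota> (2*n+1) $ s"
proof -
  have r: "2*n+1 \<in> {1..CARD('m)}" using size by auto
  have "(A ** B) $ \<iota> (2*n+1) $ s = (\<Sum>q\<in>{\<iota> (2*n+1)}. A $ \<iota> (2*n+1) $ q * B $ q $ s)"
    unfolding mmul_nth
  proof (rule sum.mono_neutral_right)
    show "\<forall>q\<in>UNIV - {\<iota> (2*n+1)}. A $ \<iota> (2*n+1) $ q * B $ q $ s = 0"
    proof
      fix q assume q: "q \<in> UNIV - {\<iota> (2*n+1)}"
      then have "idx q \<noteq> 2*n+1" unfolding idx_eq_iff [OF r] by simp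
      then consider "idx q < idx (\<iota> (2*n+1))" | "2*n+1 < idx q" using r by fastforce
      then show "A $ \<iota> (2*n+1) $ q * B $ q $ s = 0"
        using unitri_zero [OF assms] unitri_zero' [OF assms, of "\<iota> (2*n+1)" q] q by cases auto
    qed
  qed auto
  then show ?thesis using unitri_diag [OF assms] by simp
qed

text \<open>Row 2n+1 of the lift times b is row k of b up to a sign; as b has diagonal entry 1, the
  hypothesis that column k shows 1 fixes this sign.\<close>

lemma row_decomp:
  assumes red: "reduced n is" and u: "u \<in> unitri" and b: "b \<in> unitri" and A: "A = u ** word_bar E F is ** b"
    and v: "perm_inv n is (2*n+1) = k" and k: "k \<in> {1..n}" and one: "A $ \<iota> (2*n+1) $ \<iota> k = 1"
  shows "b $ \<iota> k $ \<iota> (k + 1) = A $ \<iota> (2*n+1) $ \<iota> (k + 1)"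
proof -
  let ?v = "perm_inv n is" and ?W = "word_bar E F is" and ?\<sigma> = "inv_sign n (perm_inv n is)"
  have sub: "set is \<subseteq> {1..n}" by (rule reduced_set [OF red])
  have r: "2*n+1 \<in> {1..CARD('m)}" using size by auto
  have kr: "k \<in> {1..CARD('m)}" using index_range [OF k] by auto
  have row: "A $ \<iota> (2*n+1) $ s = (?W ** b) $ \<iota> (2*n+1) $ s" for s
    unfolding A matrix_mul_assoc [symmetric] by (rule row_unitri [OF u])
  have "b = smat ?\<sigma> ?v ** (?W ** b)"
    unfolding word_inv_smat [OF red, symmetric] by (simp add: matrix_mul_assoc word_bar_inv)
  moreover have "(smat ?\<sigma> ?v ** M) $ \<iota> k $ s = ?\<sigma> (2*n+1) * M $ \<iota> (2*n+1) $ s" for M :: "'m cmat" and s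
  proof -
    have "smat ?\<sigma> ?v $ \<iota> k $ q = (if q = \<iota> (2*n+1) then ?\<sigma> (2*n+1) else 0)" for q
    proof -
      have "\<iota> k = \<iota> (?v (idx q)) \<longleftrightarrow> ?v (2*n+1) = ?v (idx q)"
        using v \<iota>_eq_iff [OF kr perm_inv_card [OF sub idx_range]] by simp
      also have "\<dots> \<longleftrightarrow> q = \<iota> (2*n+1)"
        using inj_perm_inv [OF sub] idx_eq_iff [OF r, of q] by (auto simp: inj_eq)
      finally show ?thesis using r by (simp add: smat_nth)
    qed
    then show ?thesis by (simp add: mmul_nth if_distrib [of "\<lambda>z. z * _"] cong: if_cong)
  qed
  ultimately have bk: "b $ \<iota> k $ s = ?\<sigma> (2*n+1) * A $ \<iota> (2*n+1) $ s" for s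
    unfolding row by metis
  have "?\<sigma> (2*n+1) = 1" using bk [of "\<iota> k"] one unitri_diag [OF b] by simp
  then show ?thesis using bk by simp
qed

definition block :: "(nat \<Rightarrow> complex) \<Rightarrow> 'm cmat" where
  "block d = mprod (map (\<lambda>i. bold_y F H i (d i)) [1..<Suc n])"

text \<open>On the mirrored side a running sum \<open>g\<close> travels to the left and leaves its
  scaled values behind, while each letter on the other side involves only neighbouring columns. The
  convention \<open>d 0 = 1\<close> lets column 2n+1 enter the sum like the others.\<close>

lemma row_partial_block:
  fixes A :: "'m cmat" and r :: 'm and d :: "nat \<Rightarrow> complex"
  defines "\<rho> \<equiv> \<lambda>a. A $ r $ \<iota> a"
  defines "g \<equiv> \<lambda>i. \<Sum>l<i. \<rho> (2*n+1-l) / d l"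
  assumes d: "\<And>i. i \<in> {1..n} \<Longrightarrow> d i \<noteq> 0" and d0: "d 0 = 1"
  defines "\<rho>' \<equiv> \<lambda>j a. (A ** mprod (map (\<lambda>i. bold_y F H i (d i)) [1..<Suc j])) $ r $ \<iota> a"
  shows "j < n \<Longrightarrow>
    (\<forall>a. 1 \<le> a \<and> a \<le> j \<longrightarrow> \<rho>' j a = d (a - 1) / d a * \<rho> a + \<rho> (a + 1)) \<and>
    \<rho>' j (j + 1) = d j * \<rho> (j + 1) \<and>
    (\<forall>a. j + 1 < a \<and> a + j < 2*n+1 \<longrightarrow> \<rho>' j a = \<rho> a) \<and>
    (\<forall>b. b + j = 2*n+1 \<longrightarrow> \<rho>' j b = g (j + 1)) \<and>
    (\<forall>b i. b + i = 2*n+2 \<and> 1 \<le> i \<and> i \<le> j \<longrightarrow> \<rho>' j b = d i * g i)"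
proof (induction j)
  case 0
  show ?case using d0 by (auto simp: \<rho>'_def \<rho>_def g_def)
next
  case (Suc j)
  have lt: "Suc j < n" "j < n" using Suc.prems by auto
  note IH = Suc.IH [OF lt(2)]
  have jn: "Suc j \<in> {1..n}" using lt by auto
  have step: "\<rho>' (Suc j) a = (if a = Suc j \<or> a + Suc j = 2*n+1 then \<rho>' j a / d (Suc j) + \<rho>' j (a + 1)
        else if a = Suc j + 1 \<or> a + Suc j = 2*n+2 then d (Suc j) * \<rho>' j a else \<rho>' j a)"
    if "a \<in> {1..2*n+1}" for a
    using row_bold_y [OF jn d [OF jn] that, of "A ** mprod (map (\<lambda>i. bold_y F H i (d i)) [1..<Suc j])" r] lt(1)
    unfolding \<rho>'_def by (simp add: mprod_append matrix_mul_assoc)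
  have g: "g (Suc j + 1) = g (Suc j) + \<rho> (2*n+1 - Suc j) / d (Suc j)" by (simp add: g_def)
  show ?case
  proof (intro conjI allI impI)
    fix a assume a: "1 \<le> a \<and> a \<le> Suc j"
    show "\<rho>' (Suc j) a = d (a - 1) / d a * \<rho> a + \<rho> (a + 1)"
    proof (cases "a = Suc j")
      case True
      then show ?thesis using step [of a] IH lt by auto
    next
      case False
      then show ?thesis using step [of a] IH lt a by auto
    qed
  next
    show "\<rho>' (Suc j) (Suc j + 1) = d (Suc j) * \<rho> (Suc j + 1)" using step [of "Suc j + 1"] IH lt by auto
  next
    fix a assume "Suc j + 1 < a \<and> a + Suc j < 2*n+1"
    then show "\<rho>' (Suc j) a = \<rho> a" using step [of a] IH lt by auto
  next
    fix b assume b: "b + Suc j = 2*n+1"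
    have "\<rho>' (Suc j) b = \<rho>' j b / d (Suc j) + \<rho>' j (b + 1)" using step [of b] b lt by auto
    also have "\<rho>' j b = \<rho> b" using IH b lt by auto
    also have "\<rho>' j (b + 1) = g (j + 1)" using IH b by auto
    finally have "\<rho>' (Suc j) b = \<rho> b / d (Suc j) + g (j + 1)" .
    moreover have "2*n+1 - Suc j = b" using b by simp
    ultimately show "\<rho>' (Suc j) b = g (Suc j + 1)" using g by (simp add: add.commute)
  next
    fix b i assume bi: "b + i = 2*n+2 \<and> 1 \<le> i \<and> i \<le> Suc j"
    show "\<rho>' (Suc j) b = d i * g i"
    proof (cases "i = Suc j")
      case True
      have "\<rho>' (Suc j) b = d (Suc j) * \<rho>' j b" using step [of b] bi True lt by auto
      also have "\<rho>' j b = g (j + 1)" using IH bi True by auto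
      finally show ?thesis using True by simp
    next
      case False
      then have "\<rho>' (Suc j) b = \<rho>' j b" using step [of b] bi lt by auto
      also have "\<dots> = d i * g i" using IH bi False by auto
      finally show ?thesis .
    qed
  qed
qed

lemma row_block:
  fixes A :: "'m cmat" and r :: 'm and d :: "nat \<Rightarrow> complex"
  defines "\<rho> \<equiv> \<lambda>a. A $ r $ \<iota> a"
  defines "g \<equiv> \<lambda>i. \<Sum>l<i. \<rho> (2*n+1-l) / d l"
  assumes d: "\<And>i. i \<in> {1..n} \<Longrightarrow> d i \<noteq> 0" and d0: "d 0 = 1"
  defines "\<rho>' \<equiv> \<lambda>a. (A ** block d) $ r $ \<iota> a"
  shows "1 \<le> a \<Longrightarrow> a < n \<Longrightarrow> \<rho>' a = d (a - 1) / d a * \<rho> a + \<rho> (a + 1)"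
    and "\<rho>' n = d (n - 1) * \<rho> n / (d n)\<^sup>2 + 2 / d n * \<rho> (n + 1) + g n"
    and "\<rho>' (n + 1) = \<rho> (n + 1) + d n * g n"
    and "\<rho>' (n + 2) = (d n)\<^sup>2 * g n"
    and "b + i = 2*n+2 \<Longrightarrow> 1 \<le> i \<Longrightarrow> i < n \<Longrightarrow> \<rho>' b = d i * g i"
proof -
  obtain j where j: "n = Suc j" using n_pos by (cases n) auto
  define B where "B = A ** mprod (map (\<lambda>i. bold_y F H i (d i)) [1..<Suc j])"
  have P: "(\<forall>a. 1 \<le> a \<and> a \<le> j \<longrightarrow> B $ r $ \<iota> a = d (a - 1) / d a * \<rho> a + \<rho> (a + 1)) \<and>
    B $ r $ \<iota> (j + 1) = d j * \<rho> (j + 1) \<and>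
    (\<forall>a. j + 1 < a \<and> a + j < 2*n+1 \<longrightarrow> B $ r $ \<iota> a = \<rho> a) \<and>
    (\<forall>b. b + j = 2*n+1 \<longrightarrow> B $ r $ \<iota> b = g (j + 1)) \<and>
    (\<forall>b i. b + i = 2*n+2 \<and> 1 \<le> i \<and> i \<le> j \<longrightarrow> B $ r $ \<iota> b = d i * g i)"
    unfolding B_def \<rho>_def g_def by (rule row_partial_block [where d = d, OF d d0]) (use j in auto)
  have nn: "n \<in> {1..n}" using n_pos by auto
  have step: "\<rho>' a = (if a = n then B $ r $ \<iota> n / (d n)\<^sup>2 + 2 / d n * B $ r $ \<iota> (n + 1) + B $ r $ \<iota> (n + 2)
        else if a = n + 1 then B $ r $ \<iota> (n + 1) + d n * B $ r $ \<iota> (n + 2)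
        else if a = n + 2 then (d n)\<^sup>2 * B $ r $ \<iota> (n + 2) else B $ r $ \<iota> a)"
    if "a \<in> {1..2*n+1}" for a
  proof -
    have "[1..<Suc n] = [1..<Suc j] @ [n]" using j by simp
    then have "A ** block d = B ** bold_y F H n (d n)"
      unfolding block_def B_def by (simp add: mprod_append matrix_mul_assoc del: upt_Suc)
    then show ?thesis unfolding \<rho>'_def using row_bold_y [OF nn d [OF nn] that, of B r] by simp
  qed
  have B: "\<And>a. 1 \<le> a \<Longrightarrow> a < n \<Longrightarrow> B $ r $ \<iota> a = d (a - 1) / d a * \<rho> a + \<rho> (a + 1)"
    "B $ r $ \<iota> n = d (n - 1) * \<rho> n" "B $ r $ \<iota> (n + 1) = \<rho> (n + 1)" "B $ r $ \<iota> (n + 2) = g n"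
    "\<And>b i. b + i = 2*n+2 \<Longrightarrow> 1 \<le> i \<Longrightarrow> i < n \<Longrightarrow> B $ r $ \<iota> b = d i * g i"
  proof -
    fix a assume "1 \<le> a" "a < n"
    then show "B $ r $ \<iota> a = d (a - 1) / d a * \<rho> a + \<rho> (a + 1)" using P [THEN conjunct1] j by simp
  next
    show "B $ r $ \<iota> n = d (n - 1) * \<rho> n" using P [THEN conjunct2, THEN conjunct1] j by simp
  next
    show "B $ r $ \<iota> (n + 1) = \<rho> (n + 1)" using P [THEN conjunct2, THEN conjunct2, THEN conjunct1] j by simp
  next
    have "B $ r $ \<iota> b = g n" if "b + j = 2*n+1" for b
      using P [THEN conjunct2, THEN conjunct2, THEN conjunct2, THEN conjunct1] that j by simp
    moreover have "n + 2 + j = 2*n+1" using j by simp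
    ultimately show "B $ r $ \<iota> (n + 2) = g n" by blast
  next
    fix b i assume "b + i = 2*n+2" "1 \<le> i" "i < n"
    then show "B $ r $ \<iota> b = d i * g i"
      using P [THEN conjunct2, THEN conjunct2, THEN conjunct2, THEN conjunct2] j by simp
  qed
  show "\<rho>' n = d (n - 1) * \<rho> n / (d n)\<^sup>2 + 2 / d n * \<rho> (n + 1) + g n"
    "\<rho>' (n + 1) = \<rho> (n + 1) + d n * g n" "\<rho>' (n + 2) = (d n)\<^sup>2 * g n"
    using step [of n] step [of "n + 1"] step [of "n + 2"] B n_pos by auto
  show "1 \<le> a \<Longrightarrow> a < n \<Longrightarrow> \<rho>' a = d (a - 1) / d a * \<rho> a + \<rho> (a + 1)"
    using step [of a] B(1) [of a] by auto
  show "b + i = 2*n+2 \<Longrightarrow> 1 \<le> i \<Longrightarrow> i < n \<Longrightarrow> \<rho>' b = d i * g i"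
    using step [of b] B(5) [of b i] by auto
qed

end

lemma mprod_concat: "mprod (concat xss) = mprod (map mprod xss)"
  by (induction xss) (simp_all add: mprod_append)

definition tail_params :: "nat \<Rightarrow> (nat \<Rightarrow> nat \<Rightarrow> complex) \<Rightarrow> nat \<Rightarrow> (nat \<times> complex) list" where
  "tail_params n c k = concat (map (\<lambda>m. map (\<lambda>i. (i, c m i)) [1..<Suc n]) [k..<Suc n])"

lemma theta_tail_params:
  "theta f h (tail_params n c k) = mprod (map (\<lambda>m. mprod (map (\<lambda>i. bold_y f h i (c m i)) [1..<Suc n])) [k..<Suc n])"
  by (simp add: theta_def tail_params_def map_concat mprod_concat comp_def del: upt_Suc)

lemma fst_tail_params: "map fst (tail_params n c k) = coxeter_word n (n + 1 - k)"
  by (simp add: tail_params_def coxeter_word_def map_concat comp_def map_replicate_const del: upt_Suc)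

lemma tail_params_split: "1 \<le> k \<Longrightarrow> k \<le> n \<Longrightarrow> \<exists>pre. tail_params n c 1 = pre @ tail_params n c k"
proof -
  assume "1 \<le> k" "k \<le> n"
  then have "[1..<Suc n] = [1..<k] @ [k..<Suc n]"
    using upt_add_eq_append [of 1 k "Suc n - k"] by simp
  then show ?thesis by (auto simp: tail_params_def simp del: upt_Suc)
qed

lemma tail_params_nonzero:
  assumes "\<And>m i. m \<in> {1..n} \<Longrightarrow> i \<in> {1..n} \<Longrightarrow> c m i \<noteq> 0" "1 \<le> k" "(i, z) \<in> set (tail_params n c k)"
  shows "z \<noteq> 0"
  using assms by (auto simp: tail_params_def simp del: upt_Suc)

context vector_rep begin

text \<open>Row 2n+1 of the identity is a unit vector, so only the term l = 0 of the running sum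
  survives and \<open>g\<close> equals 1.\<close>

lemma row_first_block:
  assumes d: "\<And>i. i \<in> {1..n} \<Longrightarrow> d i \<noteq> 0" and d0: "d 0 = 1"
  defines "\<rho> \<equiv> \<lambda>a. block d $ \<iota> (2*n+1) $ \<iota> a"
  shows "1 \<le> a \<Longrightarrow> a < n \<Longrightarrow> \<rho> a = 0" and "\<rho> n = 1" and "\<rho> (n + 1) = d n" and "\<rho> (n + 2) = (d n)\<^sup>2"
    and "b + i = 2*n+2 \<Longrightarrow> 1 \<le> i \<Longrightarrow> i < n \<Longrightarrow> \<rho> b = d i"
proof -
  have r: "2*n+1 \<in> {1..CARD('m)}" using size by auto
  have one: "(mat 1 :: 'm cmat) $ \<iota> (2*n+1) $ \<iota> a = (if a = 2*n+1 then 1 else 0)" if "1 \<le> a" "a \<le> 2*n+1" for a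
    using mat_\<iota> [OF r range [OF that]] by auto
  have g: "(\<Sum>l<i. (mat 1 :: 'm cmat) $ \<iota> (2*n+1) $ \<iota> (2*n+1-l) / d l) = 1" if "1 \<le> i" "i \<le> n" for i
  proof -
    have "(\<Sum>l<i. (mat 1 :: 'm cmat) $ \<iota> (2*n+1) $ \<iota> (2*n+1-l) / d l) = (\<Sum>l<i. if l = 0 then 1 else 0)"
      using that d0 by (intro sum.cong refl) (subst one, auto)
    also have "\<dots> = 1" using that by simp
    finally show ?thesis .
  qed
  have lhs: "\<rho> a = (mat 1 ** block d) $ \<iota> (2*n+1) $ \<iota> a" for a by (simp add: \<rho>_def)
  show "\<rho> a = 0" if "1 \<le> a" "a < n"
    unfolding lhs using row_block(1) [where d = d, OF d d0 that, of "mat 1" "\<iota> (2*n+1)"] one [of a] one [of "a + 1"] that by simp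
  show "\<rho> n = 1"
    unfolding lhs using row_block(2) [where d = d and A = "mat 1" and r = "\<iota> (2*n+1)", OF d d0] g [of n] one [of n] one [of "n + 1"] n_pos by simp
  show "\<rho> (n + 1) = d n"
    unfolding lhs using row_block(3) [where d = d and A = "mat 1" and r = "\<iota> (2*n+1)", OF d d0] g [of n] one [of "n + 1"] n_pos by simp
  show "\<rho> (n + 2) = (d n)\<^sup>2"
    unfolding lhs using row_block(4) [where d = d and A = "mat 1" and r = "\<iota> (2*n+1)", OF d d0] g [of n] n_pos by simp
  show "\<rho> b = d i" if "b + i = 2*n+2" "1 \<le> i" "i < n"
    unfolding lhs using row_block(5) [where d = d and A = "mat 1" and r = "\<iota> (2*n+1)", OF d d0 that] g [of i] that by simp
qed

text \<open>Source of the last sum in the formula: each further block moves the leading 1 one column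
  to the left and adds one quotient to the entry next to it.\<close>

lemma row_next_block:
  fixes A :: "'m cmat"
  assumes d: "\<And>i. i \<in> {1..n} \<Longrightarrow> d i \<noteq> 0" and d0: "d 0 = 1" and p: "1 \<le> p" "Suc p < n"
    and zero: "\<And>a. 1 \<le> a \<Longrightarrow> a < Suc p \<Longrightarrow> A $ r $ \<iota> a = 0" and one: "A $ r $ \<iota> (Suc p) = 1"
  shows "\<And>a. 1 \<le> a \<Longrightarrow> a < p \<Longrightarrow> (A ** block d) $ r $ \<iota> a = 0" and "(A ** block d) $ r $ \<iota> p = 1"
    and "(A ** block d) $ r $ \<iota> (p + 1) = A $ r $ \<iota> (Suc p + 1) + d p / d (p + 1)"
proof -
  show "(A ** block d) $ r $ \<iota> a = 0" if "1 \<le> a" "a < p" for a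
    using row_block(1) [where d = d, OF d d0, of a A r] zero [of a] zero [of "a + 1"] that p by simp
  show "(A ** block d) $ r $ \<iota> p = 1"
    using row_block(1) [where d = d, OF d d0, of p A r] zero [of p] one p by simp
  show "(A ** block d) $ r $ \<iota> (p + 1) = A $ r $ \<iota> (Suc p + 1) + d p / d (p + 1)"
    using row_block(1) [where d = d, OF d d0, of "p + 1" A r] one p by simp
qed

text \<open>Source of the other terms: the running sum of the second block gives the first sum and
  the term with \<open>(c n)\<^sup>2\<close>, and the letter n of that block gives the remaining
  two.\<close>

lemma row_two_blocks:
  assumes n: "n \<ge> 2"
    and c: "\<And>i. i \<in> {1..n} \<Longrightarrow> c i \<noteq> 0" and c0: "c 0 = 1"
    and d: "\<And>i. i \<in> {1..n} \<Longrightarrow> d i \<noteq> 0" and d0: "d 0 = 1"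
  defines "\<rho> \<equiv> \<lambda>a. (block c ** block d) $ \<iota> (2*n+1) $ \<iota> a"
  shows "\<And>a. 1 \<le> a \<Longrightarrow> a < n - 1 \<Longrightarrow> \<rho> a = 0" and "\<rho> (n - 1) = 1"
    and "\<rho> n = (\<Sum>j=1..n-1. c j / d (j - 1)) + (c n)\<^sup>2 / d (n - 1) + 2 * (c n / d n) + d (n - 1) / (d n)\<^sup>2"
proof -
  note C = row_first_block [where d = c, OF c c0]
  obtain p where p: "n = Suc p" "p \<ge> 1" using n by (cases n) auto
  show "\<rho> a = 0" if "1 \<le> a" "a < n - 1" for a
    unfolding \<rho>_def using row_block(1) [where d = d, OF d d0, of a "block c" "\<iota> (2*n+1)"] C(1) [of a] C(1) [of "a + 1"] that
    by simp
  show "\<rho> (n - 1) = 1"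
    unfolding \<rho>_def using row_block(1) [where d = d, OF d d0, of p "block c" "\<iota> (2*n+1)"] C(1) [of p] C(2) p by simp
  have "(\<Sum>l<n. block c $ \<iota> (2*n+1) $ \<iota> (2*n+1-l) / d l) = (\<Sum>l<p. c (l + 1) / d l) + (c n)\<^sup>2 / d p"
  proof -
    have "block c $ \<iota> (2*n+1) $ \<iota> (2*n+1-l) = c (l + 1)" if "l < p" for l
      by (rule C(5)) (use that p in auto)
    moreover have "block c $ \<iota> (2*n+1) $ \<iota> (2*n+1-p) = (c n)\<^sup>2"
    proof -
      have "2*n+1-p = n+2" using p by simp
      then show ?thesis by (simp only: C(4))
    qed
    moreover have "(\<Sum>l<n. block c $ \<iota> (2*n+1) $ \<iota> (2*n+1-l) / d l) =
      (\<Sum>l<p. block c $ \<iota> (2*n+1) $ \<iota> (2*n+1-l) / d l) + block c $ \<iota> (2*n+1) $ \<iota> (2*n+1-p) / d p"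
      unfolding p(1) by (rule sum.lessThan_Suc)
    ultimately show ?thesis by simp
  qed
  also have "(\<Sum>l<p. c (l + 1) / d l) = (\<Sum>j=1..p. c j / d (j - 1))"
    using sum.atLeast1_atMost_eq [of "\<lambda>j. c j / d (j - 1)" p] by simp
  finally have g: "(\<Sum>l<n. block c $ \<iota> (2*n+1) $ \<iota> (2*n+1-l) / d l) = (\<Sum>j=1..p. c j / d (j - 1)) + (c n)\<^sup>2 / d p" .
  have np: "n - 1 = p" using p by simp
  show "\<rho> n = (\<Sum>j=1..n-1. c j / d (j - 1)) + (c n)\<^sup>2 / d (n - 1) + 2 * (c n / d n) + d (n - 1) / (d n)\<^sup>2"
    unfolding \<rho>_def np
    using row_block(2) [where d = d and A = "block c" and r = "\<iota> (2*n+1)", OF d d0] C(2) C(3) np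
    by (simp only: g) simp
qed

lemma row_tail_params:
  assumes n: "n \<ge> 2" and c: "\<And>m i. m \<in> {1..n} \<Longrightarrow> i \<in> {1..n} \<Longrightarrow> c m i \<noteq> 0"
    and c0: "\<And>m. m \<in> {1..n} \<Longrightarrow> c m 0 = 1" and k: "k \<in> {1..n-1}"
  defines "\<rho> \<equiv> \<lambda>a. theta F H (tail_params n c k) $ \<iota> (2*n+1) $ \<iota> a"
  shows "\<rho> k = 1"
    and "\<rho> (k + 1) = (\<Sum>j=1..n-1. c k j / c (k+1) (j-1)) + (c k n)^2 / c (k+1) (n-1) + 2 * (c k n / c (k+1) n)
              + c (k+1) (n-1) / (c (k+1) n)^2 + (\<Sum>j=k+1..n-1. c (n+k-j+1) (j-1) / c (n+k-j+1) j)"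
proof -
  define A where "A m = mprod (map (\<lambda>m. block (c m)) [k..<Suc m])" for m
  define T where "T = (\<Sum>j=1..n-1. c k j / c (k+1) (j-1)) + (c k n)^2 / c (k+1) (n-1) + 2 * (c k n / c (k+1) n)
              + c (k+1) (n-1) / (c (k+1) n)^2"
  have A_Suc: "A (Suc m) = A m ** block (c (Suc m))" if "k \<le> Suc m" for m
    using that by (simp add: A_def mprod_append)
  \<comment> \<open>After the blocks k, ..., m the leading 1 stands in column n+k-m, so it reaches
    column k exactly at m = n. Induction starts at m = k+1, where two blocks have been
    multiplied.\<close>
  have rows: "(\<forall>a. 1 \<le> a \<and> a + m < n + k \<longrightarrow> A m $ \<iota> (2*n+1) $ \<iota> a = 0) \<and>
      (\<forall>p. p + m = n + k \<longrightarrow> A m $ \<iota> (2*n+1) $ \<iota> p = 1 \<and>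
         A m $ \<iota> (2*n+1) $ \<iota> (p + 1) = T + (\<Sum>m'\<in>{k+2..m}. c m' (n+k-m') / c m' (n+k+1-m')))"
    if "m \<le> n" "k + 1 \<le> m" for m
    using that(2,1)
  proof (induction m rule: dec_induct)
    case base
    have "A (k + 1) = block (c k) ** block (c (k + 1))" by (simp add: A_def)
    moreover have kk: "k \<in> {1..n}" "k + 1 \<in> {1..n}" using k by auto
    note two = row_two_blocks [where c = "c k" and d = "c (k + 1)", OF n c [OF kk(1)] c0 [OF kk(1)] c [OF kk(2)] c0 [OF kk(2)]]
    have "p = n - 1" "p + 1 = n" if "p + (k + 1) = n + k" for p using that by auto
    ultimately show ?case using two unfolding T_def by auto
  next
    case (step m)
    have m: "Suc m \<in> {1..n}" using step by auto
    define p where "p = n + k - Suc m"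
    have p: "p + Suc m = n + k" "1 \<le> p" "Suc p < n" using step k by (auto simp: p_def)
    have IH: "\<And>a. 1 \<le> a \<Longrightarrow> a < Suc p \<Longrightarrow> A m $ \<iota> (2*n+1) $ \<iota> a = 0" "A m $ \<iota> (2*n+1) $ \<iota> (Suc p) = 1"
      "A m $ \<iota> (2*n+1) $ \<iota> (Suc p + 1) = T + (\<Sum>m'\<in>{k+2..m}. c m' (n+k-m') / c m' (n+k+1-m'))"
      using step p by auto
    note N = row_next_block [where d = "c (Suc m)", OF c [OF m] c0 [OF m] p(2,3) IH(1,2)]
    have eq: "A (Suc m) = A m ** block (c (Suc m))" using step by (intro A_Suc) auto
    have "{k+2..Suc m} = insert (Suc m) {k+2..m}" using step by auto
    then have "(\<Sum>m'\<in>{k+2..Suc m}. c m' (n+k-m') / c m' (n+k+1-m')) =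
        c (Suc m) (n+k-Suc m) / c (Suc m) (n+k+1-Suc m) + (\<Sum>m'\<in>{k+2..m}. c m' (n+k-m') / c m' (n+k+1-m'))"
      by simp
    moreover have "n+k-Suc m = p" "n+k+1-Suc m = p+1" using p by auto
    ultimately have sum: "(\<Sum>m'\<in>{k+2..Suc m}. c m' (n+k-m') / c m' (n+k+1-m')) =
        c (Suc m) p / c (Suc m) (p + 1) + (\<Sum>m'\<in>{k+2..m}. c m' (n+k-m') / c m' (n+k+1-m'))"
      by (simp only:)
    show ?case
    proof (intro conjI allI impI)
      fix a assume "1 \<le> a \<and> a + Suc m < n + k"
      then show "A (Suc m) $ \<iota> (2*n+1) $ \<iota> a = 0" unfolding eq using p by (intro N(1)) auto
    next
      fix q assume "q + Suc m = n + k"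
      then have q: "q = p" using p by simp
      show "A (Suc m) $ \<iota> (2*n+1) $ \<iota> q = 1" unfolding eq q by (rule N(2))
      show "A (Suc m) $ \<iota> (2*n+1) $ \<iota> (q + 1) = T + (\<Sum>m'\<in>{k+2..Suc m}. c m' (n+k-m') / c m' (n+k+1-m'))"
        unfolding eq q sum using N(3) IH(3) by simp
    qed
  qed
  have \<rho>: "\<rho> a = A n $ \<iota> (2*n+1) $ \<iota> a" for a
    by (simp add: \<rho>_def A_def theta_tail_params block_def del: upt_Suc)
  have kn: "k + 1 \<le> n" using k by auto
  show "\<rho> k = 1" unfolding \<rho> using rows [OF order_refl kn] by auto
  have "\<rho> (k + 1) = T + (\<Sum>m'\<in>{k+2..n}. c m' (n+k-m') / c m' (n+k+1-m'))"
    unfolding \<rho> using rows [OF order_refl kn] by auto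
  \<comment> \<open>Block m' is indexed by j = n+k+1-m', the column to the right of the leading 1
    after that block.\<close>
  also have "(\<Sum>m'\<in>{k+2..n}. c m' (n+k-m') / c m' (n+k+1-m')) = (\<Sum>j=k+1..n-1. c (n+k-j+1) (j-1) / c (n+k-j+1) j)"
    by (rule sum.reindex_bij_witness [where i = "\<lambda>j. n + k + 1 - j" and j = "\<lambda>m. n + k + 1 - m"])
      (auto simp: Suc_diff_le)
  finally show "\<rho> (k + 1) = (\<Sum>j=1..n-1. c k j / c (k+1) (j-1)) + (c k n)^2 / c (k+1) (n-1) + 2 * (c k n / c (k+1) n)
              + c (k+1) (n-1) / (c (k+1) n)^2 + (\<Sum>j=k+1..n-1. c (n+k-j+1) (j-1) / c (n+k-j+1) j)"
    by (simp only: T_def)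
qed

lemma row_tail_params_last:
  assumes c: "\<And>m i. m \<in> {1..n} \<Longrightarrow> i \<in> {1..n} \<Longrightarrow> c m i \<noteq> 0" and c0: "\<And>m. m \<in> {1..n} \<Longrightarrow> c m 0 = 1"
  shows "theta F H (tail_params n c n) $ \<iota> (2*n+1) $ \<iota> n = 1"
    "theta F H (tail_params n c n) $ \<iota> (2*n+1) $ \<iota> (n + 1) = c n n"
proof -
  have nn: "n \<in> {1..n}" using n_pos by auto
  have "theta F H (tail_params n c n) = block (c n)"
    by (simp add: theta_tail_params block_def upt_conv_Cons del: upt_Suc) 
  then show "theta F H (tail_params n c n) $ \<iota> (2*n+1) $ \<iota> n = 1"
    "theta F H (tail_params n c n) $ \<iota> (2*n+1) $ \<iota> (n + 1) = c n n"
    using row_first_block(2,3) [where d = "c n", OF c [OF nn] c0 [OF nn]] by simp_all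
qed

end

subsection \<open>Subgroups and regular functions\<close>

lemma subgroup_gen_mul:
  "A \<in> subgroup_gen S \<Longrightarrow> B \<in> subgroup_gen S \<Longrightarrow> A ** B \<in> subgroup_gen S"
  by (induction rule: subgroup_gen.induct) (auto simp: matrix_mul_assoc [symmetric] intro: subgroup_gen.intros)

lemma subgroup_gen_base: "A \<in> S \<Longrightarrow> A \<in> subgroup_gen S"
  using subgroup_gen.gen [OF _ subgroup_gen.one, of A S] by simp

lemma subgroup_gen_mono: "S \<subseteq> T \<Longrightarrow> A \<in> subgroup_gen S \<Longrightarrow> A \<in> subgroup_gen T"
  by (rotate_tac, induction rule: subgroup_gen.induct) (auto intro: subgroup_gen.intros)

lemma subgroup_gen_mprod: "(\<And>A. A \<in> set As \<Longrightarrow> A \<in> subgroup_gen S) \<Longrightarrow> mprod As \<in> subgroup_gen S"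
  by (induction As) (auto intro: subgroup_gen.one subgroup_gen_mul)

lemma unip_x: "i \<in> {1..n} \<Longrightarrow> one_param (e i) t \<in> unip n e"
  unfolding unip_def by (rule subgroup_gen_base) auto

lemma unip_mul: "A \<in> unip n e \<Longrightarrow> B \<in> unip n e \<Longrightarrow> A ** B \<in> unip n e"
  unfolding unip_def by (rule subgroup_gen_mul)

lemma unip_uminus: "unip n (\<lambda>i. - f i) = unip n f"
proof -
  have "{one_param (- f i) t |i t. i \<in> {1..n}} = {one_param (f i) t |i t. i \<in> {1..n}}"
    unfolding one_param_uminus by (auto, metis minus_minus)
  then show ?thesis by (simp add: unip_def)
qed

lemma closure_unip_mul:
  assumes "A \<in> closure (unip n e)" "B \<in> closure (unip n e)" shows "A ** B \<in> closure (unip n e)"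
proof -
  have "(\<lambda>p. fst p ** snd p) ` closure (unip n e \<times> unip n e) \<subseteq> closure (unip n e)"
    by (rule image_closure_subset) (auto intro!: continuous_intros closure_subset [THEN subsetD] unip_mul)
  then show ?thesis using assms by (force simp: closure_Times)
qed

lemma poly_map_continuous: "poly_map p \<Longrightarrow> continuous_on UNIV p"
  by (induction rule: poly_map.induct) (auto intro!: continuous_intros)

lemma matrix_inv_eqI:
  fixes A B :: "'d::finite cmat"
  assumes "A ** B = mat 1" "B ** A = mat 1" shows "matrix_inv A = B"
proof -
  have "A ** matrix_inv A = mat 1 \<and> matrix_inv A ** A = mat 1"
    unfolding matrix_inv_def by (rule someI [of _ B]) (simp add: assms)
  then have "B ** (A ** matrix_inv A) = B" by simp
  then show ?thesis by (simp add: matrix_mul_assoc assms)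
qed

context chevalley_system begin

lemma group_x: "i \<in> {1..n} \<Longrightarrow> one_param (e i) t \<in> group_B n e f"
  and group_y: "i \<in> {1..n} \<Longrightarrow> one_param (f i) t \<in> group_B n e f"
  unfolding group_B_def by (rule subgroup_gen_base; blast)+

lemma group_mul: "A \<in> group_B n e f \<Longrightarrow> B \<in> group_B n e f \<Longrightarrow> A ** B \<in> group_B n e f"
  unfolding group_B_def by (rule subgroup_gen_mul)

lemma group_unip: "A \<in> unip n e \<Longrightarrow> A \<in> group_B n e f" "A \<in> unip n f \<Longrightarrow> A \<in> group_B n e f"
  unfolding group_B_def unip_def by (erule subgroup_gen_mono [rotated]; blast)+

lemma group_sbar: "i \<in> {1..n} \<Longrightarrow> sbar e f i \<in> group_B n e f" "i \<in> {1..n} \<Longrightarrow> sbar_inv e f i \<in> group_B n e f"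
  unfolding sbar_def sbar_inv_def by (intro group_mul group_x group_y; assumption)+

lemma group_coroot:
  assumes "i \<in> {1..n}" "c \<noteq> 0" shows "coroot (h i) c \<in> group_B n e f"
  unfolding sl2_triple.coroot_refl [OF sl2 [OF assms(1)] assms(2)] sl2_triple.refl_def [OF sl2 [OF assms(1)]]
  by (intro group_mul group_x group_y assms(1))

lemma group_word_inv: "set is \<subseteq> {1..n} \<Longrightarrow> word_inv e f is \<in> group_B n e f"
  unfolding word_inv_def group_B_def
  by (rule subgroup_gen_mprod) (use group_sbar(2) in \<open>auto simp: group_B_def\<close>)

lemma group_theta:
  assumes "\<And>i c. (i, c) \<in> set ks \<Longrightarrow> i \<in> {1..n} \<and> c \<noteq> 0" shows "theta f h ks \<in> group_B n e f"
proof -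
  have "bold_y f h i c \<in> group_B n e f" if "(i, c) \<in> set ks" for i c
    using assms [OF that] bold_y_eq [of i c] by (auto intro!: group_mul group_x group_sbar)
  then show ?thesis
    unfolding theta_def group_B_def by (intro subgroup_gen_mprod) (auto simp: group_B_def)
qed

lemma torus_elem_coroot:
  assumes "k \<in> {1..n}" shows "torus_elem n h (\<lambda>i. if i = k then t else 1) = coroot (h k) t"
proof -
  have one: "coroot A 1 = mat 1" for A :: "'d cmat"
  proof -
    have "coroot A 1 = one_param A (ln 1)" by (simp only: coroot_def one_param_def)
    then show ?thesis by simp
  qed
  have others: "mprod (map (\<lambda>i. coroot (h i) (if i = k then t else 1)) ls) = mat 1" if "k \<notin> set ls" for ls
    using that by (induction ls) (auto simp: one)
  have "[1..<Suc n] = [1..<k] @ k # [Suc k..<Suc n]"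
    using assms upt_add_eq_append [of 1 k "Suc n - k"] upt_conv_Cons [of k "Suc n"] by (simp del: upt_Suc)
  then show ?thesis unfolding torus_elem_def by (simp add: mprod_append others del: upt_Suc)
qed

end

lemma char_val_fund_weight: "k \<in> {1..n} \<Longrightarrow> char_val n (fund_weight k) a = a k"
proof -
  assume k: "k \<in> {1..n}"
  have "char_val n (fund_weight k) a = (\<Prod>i\<in>{1..n}. if i = k then a k else 1)"
    unfolding char_val_def fund_weight_def by (intro prod.cong) auto
  then show ?thesis using k by simp
qed

section \<open>Evaluation of the minor\<close>

context paired begin

lemma fst_U_closure: assumes "u \<in> U" shows "fst u \<in> closure (unip n e)"
proof -
  have "fst u \<in> unip n e" if "u \<in> U0" for u
    using that
  proof (induction rule: U0.induct)
    case one
    then show ?case by (simp add: unip_def subgroup_gen.one)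
  next
    case (step i u t)
    then show ?case by (simp add: pm_def px_def unip_mul unip_x)
  qed
  then have "fst ` closure U0 \<subseteq> closure (unip n e)"
    by (intro image_closure_subset) (auto intro!: continuous_intros closure_subset [THEN subsetD])
  then show ?thesis using assms unfolding U_def by blast
qed

lemma conj_x_closure:
  assumes "reduced n (j # is)"
  shows "word_inv e f is ** one_param (e j) t ** word_bar e f is \<in> closure (unip n e)"
  using fst_U_closure [OF conj_x_U [OF assms]] by (simp add: pm_def wi_def px_def wb_def)

lemma conj_y_closure:
  assumes "reduced n (j # is)"
  shows "word_inv e f is ** one_param (f j) t ** word_bar e f is \<in> closure (unip n f)"
proof -
  have "set is \<subseteq> {1..n}" using reduced_set [OF assms] by auto
  then show ?thesis
    using paired.conj_x_closure [OF opposite_paired assms, of "- t"]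
    by (simp add: word_inv_opposite word_bar_opposite unip_uminus one_param_uminus)
qed

text \<open>Every j is a descent, so exchange writes the lift with \<open>sbar\<close> of j in
  front. This turns x_j(t) into y_j(-t), and the rest of the word is handled by the opposite of
  \<open>conj_x_closure\<close>.\<close>

lemma conj_longest_closure:
  assumes n: "n \<ge> 2" and red: "reduced n is"
    and desc: "\<And>j. j \<in> {1..n} \<Longrightarrow> perm_inv n is (j + 1) < perm_inv n is j" and u: "u \<in> U"
  shows "word_inv e f is ** fst u ** word_bar e f is \<in> closure (unip n f)"
proof -
  let ?W = "word_bar e f is" and ?W' = "word_inv e f is"
  have gen: "?W' ** one_param (e j) t ** ?W \<in> closure (unip n f)" if j: "j \<in> {1..n}" for j t
  proof -
    obtain ls where ls: "reduced n (j # ls)" "?W = sbar e f j ** word_bar e f ls"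
      using exchange_word_bar [OF n red j desc [OF j]] by blast
    have Wj: "word_bar e f (j # ls) = ?W" by (simp add: ls(2))
    have "?W' = ?W' ** (word_bar e f (j # ls) ** word_inv e f (j # ls))" by (simp only: word_bar_inv matrix_mul_rid)
    also have "\<dots> = (?W' ** ?W) ** word_inv e f (j # ls)" unfolding Wj by (simp only: matrix_mul_assoc)
    also have "\<dots> = word_inv e f (j # ls)" by (simp only: word_bar_inv matrix_mul_lid)
    finally have W': "?W' = word_inv e f ls ** sbar_inv e f j" by simp
    have "?W' ** one_param (e j) t ** ?W
       = word_inv e f ls ** (sbar_inv e f j ** one_param (e j) t ** sbar e f j) ** word_bar e f ls"
      unfolding W' ls(2) by (simp add: matrix_mul_assoc)
    also have "\<dots> \<in> closure (unip n f)" unfolding sbar_inv_x_sbar [OF j] by (rule conj_y_closure [OF ls(1)])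
    finally show ?thesis .
  qed
  have "?W' ** fst u ** ?W \<in> closure (unip n f)" if "u \<in> U0" for u
    using that
  proof (induction rule: U0.induct)
    case one
    then show ?case using closure_subset [of "unip n f"] by (auto simp: word_bar_inv unip_def subgroup_gen.one)
  next
    case (step j u t)
    have "(?W' ** one_param (e j) t ** ?W) ** (?W' ** fst u ** ?W) \<in> closure (unip n f)"
      by (intro closure_unip_mul gen step)
    moreover have "?W ** (?W' ** A) = A" for A :: "'d cmat" by (simp add: matrix_mul_assoc word_bar_inv)
    ultimately show ?case by (simp add: pm_def px_def matrix_mul_assoc [symmetric])
  qed
  then have "(\<lambda>u. ?W' ** fst u ** ?W) ` closure U0 \<subseteq> closure (unip n f)"
    by (intro image_closure_subset) (auto intro!: continuous_intros)
  then show ?thesis using u unfolding U_def by blast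
qed

lemma wbar_eq:
  assumes n: "n \<ge> 2" and red: "reduced n is" shows "wbar n e f (weyl_word n is) = word_bar e f is"
proof -
  let ?js = "SOME js. reduced_word n (weyl_word n is) js"
  have "reduced_word n (weyl_word n is) ?js"
    by (rule someI [of _ "is"]) (simp add: reduced_word_iff [OF n red] red)
  then show ?thesis
    unfolding wbar_def reduced_word_iff [OF n red] word_bar_def [symmetric]
    using word_bar_unique [OF n _ red] by blast
qed

text \<open>Formulated for the polynomial \<open>p\<close> instead of \<open>D\<close>: limits of
  unipotent elements are not known to lie in the group, where alone \<open>D\<close> is controlled,
  whereas \<open>p\<close> is continuous everywhere.\<close>

lemma principal_minor_closure:
  assumes k: "k \<in> {1..n}" and D: "is_principal_minor n e f h k D"
    and p: "poly_map p" "\<And>g. g \<in> group_B n e f \<Longrightarrow> D g = p g"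
    and u: "u \<in> closure (unip n f)" and v: "v \<in> closure (unip n e)" and t: "t \<noteq> 0"
  shows "p (u ** coroot (h k) t ** v) = t"
proof -
  let ?S = "{q. p (fst q ** coroot (h k) t ** snd q) = t}"
  have "(u, v) \<in> ?S" if "u \<in> unip n f" "v \<in> unip n e" for u v
  proof -
    have "D (u ** torus_elem n h (\<lambda>i. if i = k then t else 1) ** v) = char_val n (fund_weight k) (\<lambda>i. if i = k then t else 1)"
      using D that t unfolding is_principal_minor_def by auto
    moreover have "u ** coroot (h k) t ** v \<in> group_B n e f"
      using that k t by (intro group_mul group_unip group_coroot)
    ultimately show ?thesis using p(2) k by (simp add: torus_elem_coroot char_val_fund_weight)
  qed
  then have "unip n f \<times> unip n e \<subseteq> ?S" by auto
  moreover have "closed ?S"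
    by (intro closed_Collect_eq continuous_on_const
        continuous_on_compose2 [OF poly_map_continuous [OF p(1)]] continuous_intros) auto
  ultimately have "closure (unip n f \<times> unip n e) \<subseteq> ?S" by (rule closure_minimal)
  then show ?thesis using u v by (auto simp: closure_Times)
qed

lemma minor_value:
  assumes n: "n \<ge> 2" and k: "k \<in> {1..n}" and D: "is_principal_minor n e f h k D"
    and c: "\<And>m i. m \<in> {1..n} \<Longrightarrow> i \<in> {1..n} \<Longrightarrow> c m i \<noteq> 0"
    and row: "theta V.F V.H (tail_params n c k) $ \<iota> (2*n+1) $ \<iota> k = 1"
  shows "gen_minor n e f D (longest_elem n) (simple_refl n k) (Theta_minus n f h c)
    = theta V.F V.H (tail_params n c k) $ \<iota> (2*n+1) $ \<iota> (k + 1)"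
proof -
  define w where "w = coxeter_word n n"
  define t where "t = theta V.F V.H (tail_params n c k) $ \<iota> (2*n+1) $ \<iota> (k + 1)"
  have red: "reduced n w" unfolding w_def using reduced_coxeter_word n by simp
  have sub: "set w \<subseteq> {1..n}" by (rule reduced_set [OF red])
  have desc: "perm_inv n w (j + 1) < perm_inv n w j" if "j \<in> {1..n}" for j
    unfolding w_def
    using perm_inv_coxeter_word [of n n j] perm_inv_coxeter_word [of n n "j + 1"] that n
      perm_inv_middle [OF sub] unfolding w_def by (cases "j = n") auto
  have wbar_w: "wbar n e f (longest_elem n) = word_bar e f w"
    unfolding longest_elem_coxeter_word [OF n] w_def [symmetric] by (rule wbar_eq [OF n red])
  have redk: "reduced n [k]" by (rule reduced_ConsI) (use k in \<open>auto simp: reduced_def\<close>)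
  have "simple_refl n k = weyl_word n [k]" by (simp add: weyl_word_def)
  then have wbar_k: "wbar n e f (simple_refl n k) = sbar e f k" using wbar_eq [OF n redk] by simp
  have Theta: "Theta_minus n f h c = theta f h (tail_params n c 1)"
    by (simp add: Theta_minus_def theta_tail_params)
  define ls where "ls = coxeter_word n (n + 1 - k)"
  have red_ls: "reduced n ls" unfolding ls_def using k by (intro reduced_coxeter_word) auto
  have sub_ls: "set ls \<subseteq> {1..n}" by (rule reduced_set [OF red_ls])
  have v_last: "perm_inv n ls (2*n+1) = k" unfolding ls_def by (rule perm_inv_coxeter_word_last) (use k in auto)
  have fst_k: "map fst (tail_params n c k) = ls" and fst_1: "map fst (tail_params n c 1) = w"
    unfolding ls_def w_def fst_tail_params by simp_all
  have nz: "z \<noteq> 0" if "(i, z) \<in> set (tail_params n c 1)" for i z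
    using tail_params_nonzero [of n c 1 i z] c that by auto
  have nzk: "z \<noteq> 0" if "(i, z) \<in> set (tail_params n c k)" for i z
    using tail_params_nonzero [of n c k i z] c k that by auto
  obtain u b where ub: "u \<in> U" "b \<in> U" "ptheta (tail_params n c k) = pm (pm u (wb ls)) b"
    using theta_decomp [of "tail_params n c k"] red_ls nzk unfolding fst_k by blast
  have chi_b: "chi k b = t"
  proof -
    have "snd u \<in> V.unitri" "snd b \<in> V.unitri" using U_T [OF ub(1)] U_T [OF ub(2)] by auto
    moreover have "theta V.F V.H (tail_params n c k) = snd u ** word_bar V.E V.F ls ** snd b"
      using ub(3) by (simp add: ptheta_def pm_def wb_def)
    ultimately show ?thesis
      unfolding chi_def t_def by (rule V.row_decomp [OF red_ls _ _ _ v_last k row])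
  qed
  \<comment> \<open>The descent needed by \<open>theta_extend\<close>: k sits at index 2n+1, so k+1
    necessarily sits at a smaller one.\<close>
  obtain a' where a': "a' \<in> {1..2*n+1}" "perm_inv n ls a' = k + 1"
  proof -
    have "perm_inv n ls ` {1..2*n+1} = {1..2*n+1}"
    proof (rule endo_inj_surj)
      show "inj_on (perm_inv n ls) {1..2*n+1}" using inj_perm_inv [OF sub_ls] inj_on_subset by blast
    qed (use perm_inv_range [OF sub_ls] in blast)+
    moreover have "k + 1 \<in> {1..2*n+1}" using k by auto
    ultimately have "k + 1 \<in> perm_inv n ls ` {1..2*n+1}" by simp
    then show thesis using that by (metis imageE)
  qed
  have "a' \<noteq> 2*n+1" using a' v_last by auto
  then have a'_lt: "a' < 2*n+1" using a' by auto
  obtain pre where pre: "tail_params n c 1 = pre @ tail_params n c k"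
    using tail_params_split [of k n c] k by auto
  have "\<exists>u\<in>U. \<exists>b'\<in>U. ptheta (pre @ tail_params n c k) = pm (pm u (wb (map fst (pre @ tail_params n c k)))) b' \<and>
      chi k b' = chi k b \<and> (\<exists>a\<in>{1..2*n+1}. \<exists>a'\<in>{1..2*n+1}. a' < a \<and>
        perm_inv n (map fst (pre @ tail_params n c k)) a = k \<and> perm_inv n (map fst (pre @ tail_params n c k)) a' = k + 1)"
  proof (rule theta_extend [OF k ub(1,2), of "tail_params n c k" "2*n+1" a'])
    show "reduced n (map fst (pre @ tail_params n c k))" using red unfolding pre [symmetric] fst_1 .
    show "z \<noteq> 0" if "(i, z) \<in> set pre" for i z using nz [of i z] that unfolding pre by simp
  qed (use ub(3) a' a'_lt v_last in \<open>simp_all add: fst_k\<close>)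
  then obtain u' b' where ub': "u' \<in> U" "b' \<in> U" "ptheta (tail_params n c 1) = pm (pm u' (wb w)) b'" "chi k b' = t"
    unfolding pre [symmetric] fst_1 chi_b by blast
  then have Theta_eq: "Theta_minus n f h c = fst u' ** word_bar e f w ** fst b'"
    unfolding Theta by (simp add: ptheta_def pm_def wb_def)
  obtain r where r: "r \<in> R k" "b' = pm (px k t) r" using U_decomp_left [OF ub'(2) k] ub'(4) by auto
  define um where "um = word_inv e f w ** fst u' ** word_bar e f w"
  define up where "up = sbar_inv e f k ** fst r ** sbar e f k"
  have um: "um \<in> closure (unip n f)" unfolding um_def by (rule conj_longest_closure [OF n red desc ub'(1)])
  have up: "up \<in> closure (unip n e)"
    using fst_U_closure [OF R_conj(1) [OF k r(1)]] by (simp add: up_def pm_def ps_def ps'_def)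
  \<comment> \<open>The parameter is freed from t: along this curve the value is computed for
    nonzero s, and a vanishing t is reached by continuity.\<close>
  define g where "g s = um ** (one_param (e k) s ** sbar e f k) ** up" for s
  have gt: "matrix_inv (wbar n e f (longest_elem n)) ** Theta_minus n f h c ** wbar n e f (simple_refl n k) = g t"
  proof -
    have "fst b' ** sbar e f k = one_param (e k) t ** sbar e f k ** up"
      unfolding r(2) up_def by (simp add: pm_def px_def matrix_mul_assoc)
        (simp add: matrix_mul_assoc [symmetric], simp add: matrix_mul_assoc sbar_sbar_inv)
    then show ?thesis
      unfolding wbar_w wbar_k Theta_eq g_def um_def matrix_inv_eqI [OF word_bar_inv]
      by (simp add: matrix_mul_assoc [symmetric])
  qed
  obtain p where p: "poly_map p" "\<And>g. g \<in> group_B n e f \<Longrightarrow> D g = p g"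
    using D unfolding is_principal_minor_def regular_on_def by blast
  have val: "p (g s) = s" if s: "s \<noteq> 0" for s
  proof -
    have "g s = (um ** one_param (f k) (1 / s)) ** coroot (h k) s ** (one_param (e k) (- (1 / s)) ** up)"
      unfolding g_def x_sbar [OF k s] by (simp add: matrix_mul_assoc)
    also have "p \<dots> = s"
      using um up k s unip_x closure_subset
      by (intro principal_minor_closure [OF k D p] closure_unip_mul) (auto intro!: closure_subset [THEN subsetD] unip_x)
    finally show ?thesis .
  qed
  have "p (g t) = t"
  proof (cases "t = 0")
    case True
    have "continuous_on UNIV (\<lambda>s. p (g s))"
      unfolding g_def
      by (intro continuous_on_compose2 [OF poly_map_continuous [OF p(1)]] continuous_intros continuous_one_param) auto
    then have "((\<lambda>s. p (g s)) \<longlongrightarrow> p (g 0)) (at 0)" by (simp add: continuous_on_def)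
    moreover have "((\<lambda>s. p (g s)) \<longlongrightarrow> 0) (at 0)"
      by (rule Lim_transform_eventually [OF tendsto_ident_at]) (auto simp: eventually_at_filter val)
    ultimately show ?thesis using True LIM_unique by blast
  qed (rule val)
  \<comment> \<open>The factors \<open>um\<close> and \<open>up\<close> are only known to lie in
    closures, but the product is an honest group element; this is what allows \<open>p\<close> to be
    replaced by \<open>D\<close>.\<close>
  moreover have "g t \<in> group_B n e f"
  proof -
    have "i \<in> {1..n} \<and> z \<noteq> 0" if "(i, z) \<in> set (tail_params n c 1)" for i z
      using nz [OF that] that sub unfolding fst_1 [symmetric] by force
    then have "Theta_minus n f h c \<in> group_B n e f" unfolding Theta by (rule group_theta)
    then show ?thesis
      unfolding gt [symmetric] wbar_w wbar_k matrix_inv_eqI [OF word_bar_inv]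
      by (intro group_mul group_word_inv group_sbar k sub)
  qed
  ultimately show ?thesis unfolding gen_minor_def gt t_def [symmetric] using p(2) by simp
qed

end

subsection \<open>Finding room for the vector representation\<close>

lemma chevalley_gens_system: "chevalley_gens_B n e f h \<Longrightarrow> chevalley_system n e f h"
  unfolding chevalley_gens_B_def lie_def
  by unfold_locales (simp_all add: cscale_neg)

lemma sum_mult_vec:
  fixes h :: "nat \<Rightarrow> 'd::finite cmat"
  shows "((\<Sum>i\<in>S. z i *\<^sub>R h i) *v v) $ r = (\<Sum>i\<in>S. of_real (z i) * (h i *v v) $ r)"
proof -
  have "((x *\<^sub>R M) *v v) $ r = of_real x * (M *v v) $ r" for x and M :: "'d cmat"
  proof -
    have "((x *\<^sub>R M) *v v) $ r = x *\<^sub>R (M *v v) $ r"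
      by (simp add: matrix_vector_mult_def scaleR_sum_right)
    then show ?thesis by (simp only: scaleR_conv_of_real)
  qed
  then show ?thesis
    by (induction S rule: infinite_finite_induct) (simp_all add: matrix_vector_mult_add_rdistrib)
qed

text \<open>On a vector of weight l the relation becomes the vanishing of the sum of z_i l(h_i).
  Integer combinations of weights reach the k-th fundamental weight, for which this sum is
  z_k.\<close>

lemma weights_independent:
  fixes h :: "nat \<Rightarrow> 'd::finite cmat" and z :: "nat \<Rightarrow> real"
  assumes span: "weights_span_full n h" and zero: "(\<Sum>i\<in>{1..n}. z i *\<^sub>R h i) = 0" and k: "k \<in> {1..n}"
  shows "z k = 0"
proof -
  have weight: "(\<Sum>i\<in>{1..n}. of_real (z i) * of_int (l i)) = (0 :: complex)" if l: "is_weight n h l" for l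
  proof -
    obtain v where v: "v \<noteq> 0" "\<And>i. i \<in> {1..n} \<Longrightarrow> h i *v v = of_int (l i) *s v"
      using l unfolding is_weight_def by blast
    obtain r where r: "v $ r \<noteq> 0" using v(1) by (auto simp: vec_eq_iff)
    have "0 = ((\<Sum>i\<in>{1..n}. z i *\<^sub>R h i) *v v) $ r" by (simp only: zero matrix_vector_mult_0 zero_index)
    also have "\<dots> = (\<Sum>i\<in>{1..n}. of_real (z i) * (h i *v v) $ r)"
      by (rule sum_mult_vec)
    also have "\<dots> = (\<Sum>i\<in>{1..n}. of_real (z i) * of_int (l i)) * v $ r"
      by (simp add: v(2) sum_distrib_right mult.assoc)
    finally show ?thesis using r by simp
  qed
  obtain S m where S: "\<forall>l\<in>S. is_weight n h l" "\<forall>i\<in>{1..n}. fund_weight k i = (\<Sum>l\<in>S. m l * l i)"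
    using span k unfolding weights_span_full_def by blast
  have "complex_of_real (z k) = (\<Sum>i\<in>{1..n}. if i = k then of_real (z k) else 0)" using k by simp
  also have "\<dots> = (\<Sum>i\<in>{1..n}. of_real (z i) * of_int (fund_weight k i))"
    by (intro sum.cong) (auto simp: fund_weight_def)
  also have "\<dots> = (\<Sum>i\<in>{1..n}. \<Sum>l\<in>S. of_int (m l) * (of_real (z i) * of_int (l i)))"
    using S(2) by (intro sum.cong) (simp_all add: sum_distrib_left mult_ac)
  also have "\<dots> = (\<Sum>l\<in>S. of_int (m l) * (\<Sum>i\<in>{1..n}. of_real (z i) * of_int (l i)))"
    by (subst sum.swap) (simp add: sum_distrib_left)
  also have "\<dots> = 0" using S(1) weight by (intro sum.neutral) simp
  finally show ?thesis by simp
qed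

text \<open>The \<open>h i\<close> are linearly independent over the reals in a space of real
  dimension 2 d^2, where d is the size of the matrices. The bound makes a type of at least 2n+1
  elements constructible from the given index type.\<close>

lemma rank_bound:
  fixes h :: "nat \<Rightarrow> 'd::finite cmat"
  assumes span: "weights_span_full n h" shows "n \<le> 2 * CARD('d) * CARD('d)"
proof -
  have inj: "inj_on h {1..n}"
  proof (rule inj_onI, rule ccontr)
    fix i j assume ij: "i \<in> {1..n}" "j \<in> {1..n}" "h i = h j" "i \<noteq> j"
    let ?z = "\<lambda>l. (if l = i then 1 else 0) - (if l = j then 1 else 0 :: real)"
    have "(\<Sum>l\<in>{1..n}. ?z l *\<^sub>R h l) = (\<Sum>l\<in>{1..n}. (if l = i then h i else 0) - (if l = j then h j else 0))"
      by (intro sum.cong) auto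
    also have "\<dots> = 0" using ij by (simp add: sum_subtractf)
    finally have "?z i = 0" by (rule weights_independent [OF span _ ij(1)])
    then show False using ij by simp
  qed
  have "independent (h ` {1..n})"
    unfolding independent_explicit
  proof (intro conjI allI impI ballI)
    fix z v assume z: "(\<Sum>v\<in>h ` {1..n}. z v *\<^sub>R v) = 0" and v: "v \<in> h ` {1..n}"
    then obtain k where k: "k \<in> {1..n}" "v = h k" by blast
    have "(\<Sum>i\<in>{1..n}. z (h i) *\<^sub>R h i) = 0" using z unfolding sum.reindex [OF inj] comp_def .
    then show "z v = 0" using weights_independent [OF span _ k(1), of "\<lambda>i. z (h i)"] k(2) by simp
  qed simp
  then have "card (h ` {1..n}) \<le> DIM('d cmat)" by (rule independent_card_le)
  then show ?thesis using card_image [OF inj] by (simp add: mult_ac)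
qed

theorem theorem8p1:
  fixes n :: nat
    and e f h :: "nat \<Rightarrow> complex^'d::finite^'d"
    and \<Delta> :: "nat \<Rightarrow> complex^'d^'d \<Rightarrow> complex"
    and c :: "nat \<Rightarrow> nat \<Rightarrow> complex"
  assumes n: "n \<ge> 2"
    and G: "simply_connected_B n e f h"
    and Delta: "\<And>k. k \<in> {1..n} \<Longrightarrow> is_principal_minor n e f h k (\<Delta> k)"
    and c_nz: "\<And>m i. m \<in> {1..n} \<Longrightarrow> i \<in> {1..n} \<Longrightarrow> c m i \<noteq> 0"
    and c_0: "\<And>m. m \<in> {1..n} \<Longrightarrow> c m 0 = 1"
  shows "(\<forall>k\<in>{1..n-1}.
            gen_minor n e f (\<Delta> k) (longest_elem n) (simple_refl n k) (Theta_minus n f h c)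
            = (\<Sum>j=1..n-1. c k j / c (k+1) (j-1))
              + (c k n)^2 / c (k+1) (n-1)
              + 2 * (c k n / c (k+1) n)
              + c (k+1) (n-1) / (c (k+1) n)^2
              + (\<Sum>j=k+1..n-1. c (n+k-j+1) (j-1) / c (n+k-j+1) j))
         \<and> gen_minor n e f (\<Delta> n) (longest_elem n) (simple_refl n n) (Theta_minus n f h c)
            = c n n"
proof -
  have G': "chevalley_gens_B n e f h" "weights_span_full n h" using G by (simp_all add: simply_connected_B_def)
  \<comment> \<open>The type has 4 d^2 + 1 elements, with d the size of the given matrices, and by
    \<open>rank_bound\<close> this is at least 2n+1.\<close>
  let ?N = "CARD(((bool \<times> 'd) \<times> (bool \<times> 'd)) option)"
  have "2 * n + 1 \<le> ?N" using rank_bound [OF G'(2)] by (simp add: card_option card_prod mult_ac)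
  moreover obtain \<iota> :: "nat \<Rightarrow> ((bool \<times> 'd) \<times> (bool \<times> 'd)) option" where "bij_betw \<iota> {1..?N} UNIV"
    using ex_bij_betw_nat_finite_1 [of "UNIV :: (((bool \<times> 'd) \<times> (bool \<times> 'd)) option) set"] by auto
  ultimately interpret paired n e f h \<iota>
    using n chevalley_gens_system [OF G'(1)] by (intro paired.intro vector_rep.intro) auto
  show ?thesis
  proof (intro conjI ballI)
    fix k assume k: "k \<in> {1..n-1}"
    then have k': "k \<in> {1..n}" by auto
    note rows = V.row_tail_params [where c = c, OF n c_nz c_0 k]
    show "gen_minor n e f (\<Delta> k) (longest_elem n) (simple_refl n k) (Theta_minus n f h c)
            = (\<Sum>j=1..n-1. c k j / c (k+1) (j-1))
              + (c k n)^2 / c (k+1) (n-1)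
              + 2 * (c k n / c (k+1) n)
              + c (k+1) (n-1) / (c (k+1) n)^2
              + (\<Sum>j=k+1..n-1. c (n+k-j+1) (j-1) / c (n+k-j+1) j)"
      by (rule trans [OF minor_value [where c = c, OF n k' Delta [OF k'] c_nz rows(1)] rows(2)])
  next
    have n': "n \<in> {1..n}" using n by auto
    note rows = V.row_tail_params_last [where c = c, OF c_nz c_0]
    show "gen_minor n e f (\<Delta> n) (longest_elem n) (simple_refl n n) (Theta_minus n f h c) = c n n"
      by (rule trans [OF minor_value [where c = c, OF n n' Delta [OF n'] c_nz rows(1)] rows(2)])
  qed
qed

end
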